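(* Let $n$ be a positive integer such that $\varphi(n) \geq 6$, and let $\Psi_n(x, y)$ denote the homogenization of the minimal polynomial $\Psi_n(x)$ of $2\cos\left(\frac{2\pi}{n}\right)$. Then $$A_{\Psi_n} > \frac{16}{3}\exp\left(-\frac{2d(n)\log n}{\varphi(n)}\right)$$ and $$A_{\Psi_n} < 2^{\frac{4}{\varphi(n)}}\exp\left(\frac{2d(n)^2\log n}{\varphi(n)}\right) \left[\frac{16}{3} + 2^{1-\frac{4}{\varphi(n)}}B\left(\frac{1}{2},\frac{1}{2} - \frac{2}{\varphi(n)}\right) - 2\pi + \left(\frac{2}{n}B\left(\frac{1}{n}, 1 - \frac{4}{\varphi(n)}\right) - 2\right) - \left(\frac{2}{n}B\left(\frac{3}{n}, 1 - \frac{4}{\varphi(n)}\right) - \frac{2}{3}\right)\right].$$ Furthermore, $\lim_{n \to \infty} A_{\Psi_n} = \frac{16}{3}$.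
   Context: For a binary form $F(x,y)$ with real coefficients, $A_F$ denotes the area (Lebesgue measure) of the set $\{(x, y) \in \mathbb R^2 : |F(x, y)| \leq 1\}$. $\varphi$ is Euler's totient function and $d(n)$ is the number of positive divisors of $n$. $B(x,y) = \int_0^1 t^{x-1}(1-t)^{y-1}\,dt$ is the beta function. The homogenization of a polynomial $f(x)$ of degree $m$ is $y^m f(x/y)$; note $\Psi_n(x,y) = \prod_{1 \le k < n/2,\ \gcd(k,n)=1}\left(x - 2\cos\left(\frac{2\pi k}{n}\right)y\right)$ has degree $\varphi(n)/2$. *)

theory Defs
  imports "HOL-Analysis.Analysis" "HOL-Computational_Algebra.Computational_Algebra"
    "HOL-Number_Theory.Totient"
begin

definition is_min_poly_rat :: "real \<Rightarrow> rat poly \<Rightarrow> bool" where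
  "is_min_poly_rat x p \<longleftrightarrow>
     lead_coeff p = 1 \<and> poly (map_poly of_rat p) x = 0 \<and>
     (\<forall>q. q \<noteq> 0 \<and> poly (map_poly of_rat q) x = 0 \<longrightarrow> degree p \<le> degree q)"

(* Meaningful for algebraic x only; see is_min_poly_rat_min_poly_rat below. *)
definition min_poly_rat :: "real \<Rightarrow> rat poly" where
  "min_poly_rat x = (THE p. is_min_poly_rat x p)"

(* y^m f(x/y) with m = degree f, multiplied out so that it is also right at y = 0. *)
definition homogenize :: "real poly \<Rightarrow> real \<Rightarrow> real \<Rightarrow> real" where
  "homogenize f x y = (\<Sum>i\<le>degree f. coeff f i * x ^ i * y ^ (degree f - i))"

definition Psi :: "nat \<Rightarrow> real \<Rightarrow> real \<Rightarrow> real" where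
  "Psi n = homogenize (map_poly of_rat (min_poly_rat (2 * cos (2 * pi / real n))))"

(* Extended-valued: a bound A_F < c with c real asserts in particular that the area is finite. *)
definition form_area :: "(real \<Rightarrow> real \<Rightarrow> real) \<Rightarrow> ennreal" where
  "form_area F = emeasure lebesgue {(x, y). \<bar>F x y\<bar> \<le> 1}"

definition num_divisors :: "nat \<Rightarrow> nat" where
  "num_divisors n = card {d. d dvd n}"

lemma homogenize_altdef:
  assumes "y \<noteq> 0"
  shows "homogenize f x y = y ^ degree f * poly f (x / y)"
proof -
  have "coeff f i * x ^ i * y ^ (degree f - i) = y ^ degree f * (coeff f i * (x / y) ^ i)"
    if "i \<le> degree f" for i
    using assms that by (simp add: power_divide power_diff)
  thus ?thesis
    unfolding homogenize_def poly_altdef sum_distrib_left by (intro sum.cong) auto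
qed

lemma map_poly_of_rat_diff:
  "map_poly (of_rat :: rat \<Rightarrow> real) (p - q) = map_poly of_rat p - map_poly of_rat q"
  by (rule poly_eqI) (simp add: coeff_map_poly of_rat_diff)

lemma map_poly_of_rat_smult:
  "map_poly (of_rat :: rat \<Rightarrow> real) (smult c p) = smult (of_rat c) (map_poly of_rat p)"
  by (rule poly_eqI) (simp add: coeff_map_poly of_rat_mult)

lemma is_min_poly_rat_unique:
  assumes p: "is_min_poly_rat x p" and q: "is_min_poly_rat x q"
  shows "p = q"
proof (rule ccontr)
  assume "p \<noteq> q"
  have nz: "p \<noteq> 0" "q \<noteq> 0"
    using p q by (auto simp: is_min_poly_rat_def)
  have deg: "degree p = degree q"
    using p q nz by (auto simp: is_min_poly_rat_def intro!: antisym)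
  have "poly (map_poly of_rat (p - q)) x = 0"
    using p q by (simp add: is_min_poly_rat_def map_poly_of_rat_diff)
  with p \<open>p \<noteq> q\<close> have le: "degree p \<le> degree (p - q)"
    by (auto simp: is_min_poly_rat_def)
  moreover have "coeff (p - q) (degree p) = 0"
    using p q deg by (simp add: is_min_poly_rat_def)
  moreover have "degree (p - q) \<le> degree p"
    using deg by (intro degree_diff_le) auto
  ultimately have "lead_coeff (p - q) = 0"
    by (metis le_antisym)
  hence "p - q = 0"
    by (simp only: leading_coeff_0_iff)
  with \<open>p \<noteq> q\<close> show False
    by simp
qed

lemma is_min_poly_rat_exists:
  assumes "algebraic x"
  shows "\<exists>p. is_min_poly_rat x p"
proof -
  let ?P = "\<lambda>q. q \<noteq> 0 \<and> poly (map_poly (of_rat :: rat \<Rightarrow> real) q) x = 0"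
  from assms obtain r where r: "\<And>i. coeff r i \<in> \<rat>" "r \<noteq> 0" "poly r x = 0"
    by (auto simp: algebraic_altdef)
  define q where "q = map_poly (inv (of_rat :: rat \<Rightarrow> real)) r"
  have inv0: "inv (of_rat :: rat \<Rightarrow> real) 0 = 0"
    using inv_f_f[of "of_rat :: rat \<Rightarrow> real" 0] by (simp add: inj_def)
  have "map_poly of_rat q = r"
    using r(1) by (intro poly_eqI) (simp add: q_def coeff_map_poly inv0 f_inv_into_f Rats_def)
  with r have "?P q"
    by auto
  then obtain p where p: "?P p" "\<And>q. ?P q \<Longrightarrow> degree p \<le> degree q"
    using exists_least_iff[of "\<lambda>n. \<exists>q. ?P q \<and> degree q = n"]
    by (metis (lifting) linorder_not_less)
  have "is_min_poly_rat x (smult (1 / lead_coeff p) p)"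
    using p by (auto simp: is_min_poly_rat_def map_poly_of_rat_smult)
  thus ?thesis ..
qed

lemma is_min_poly_rat_min_poly_rat:
  assumes "algebraic x"
  shows "is_min_poly_rat x (min_poly_rat x)"
  unfolding min_poly_rat_def
  using is_min_poly_rat_exists[OF assms] is_min_poly_rat_unique by (metis theI)

end

theory Submission
  imports Defs "HOL-Real_Asymp.Real_Asymp"
begin

text \<open>
  Let \<open>m = totient n / 2\<close> be the degree of \<open>Psi n\<close> and \<open>Phi\<close> the \<open>n\<close>-th cyclotomic polynomial, so that
  \<open>Phi(z) = z^m Psi(z + 1/z)\<close>. Polar-type coordinates turn the area into the integral of
  \<open>|Psi(t)| powr (-2/m)\<close> over the line; \<open>t = 2 cos s\<close> on \<open>[-2, 2]\<close> and \<open>t = \<plusminus>(w + 1/w)\<close> with \<open>0 < w < 1\<close>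
  outside move it to the unit disc, where \<open>Phi\<close> is estimated as follows. As a power series,
  \<open>Phi\<close> is majorised by the product of \<open>1/(1 - x^d)\<close> over \<open>d dvd n\<close> (Bateman; by induction over the
  prime factors of \<open>n\<close>, bounding \<open>1/Phi\<close> along with \<open>Phi\<close>), so \<open>|Phi(z)| \<le> n powr (d(n)/2)\<close>
  for \<open>|z| \<le> 1\<close>; and since the product of the cyclotomic polynomials over the divisors of \<open>n\<close> is \<open>x^n - 1\<close>,
  \<open>|Phi(z)|\<close> is at least \<open>|1 - z^n|\<close> divided by \<open>n powr (d(n)^2/2)\<close>. The integrals of the majorants are
  Beta integrals. Minimality of the polynomial with roots \<open>2 cos(2 pi k/n)\<close> is shown by Landau's proof of the
  irreducibility of cyclotomic polynomials, carried out in the ring \<open>\<int>[z]\<close> for \<open>z = cis (2 pi/n)\<close>.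
\<close>

subsection \<open>Cyclotomic polynomials\<close>

text \<open>The bound \<open>n powr (d(n)/2)\<close> comes from truncation: \<open>Phi\<close> has
  degree \<open>totient n < n\<close>, and below degree \<open>n\<close> the series
  \<open>1/(1 - x^d)\<close> has exactly \<open>n/d\<close> nonzero coefficients, so the coefficient
  sum is at most the product of all \<open>n/d\<close>. The exponent
  \<open>-2/m = -4/totient n\<close> turns this into the stated exponential; \<open>d(n)\<close> is
  squared in the upper bound because each of the other factors of \<open>x^n - 1\<close> is
  estimated by the same quantity. With 1 in place of \<open>|Phi|\<close> the three integrals are
  2/3, 2/3 and 4, whence 16/3. The condition \<open>totient n >= 6\<close> keeps
  \<open>a = 4/totient n\<close> at most 2/3, so the singularities of order \<open>a\<close> are
  integrable. In the minimality proof the obstacle is that an integer polynomial of least degree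
  vanishing at \<open>2 cos (2 pi/n)\<close> is not known to be monic; multiplying by a fixed power
  of its leading coefficient takes the place of Gauss's lemma. For the limit,
  \<open>d(n)^2 log n / totient n\<close> has to vanish, which follows from
  \<open>d(n)^2 sqrt n <= K totient n\<close>, proved prime by prime with a loss only at small
  primes.\<close>

lemma monic_poly_eq_prod_roots:
  fixes p :: "'a :: idom poly"
  assumes S: "finite S" and deg: "degree p = card S" and lc: "lead_coeff p = 1"
    and roots: "\<And>z. z \<in> S \<Longrightarrow> poly p z = 0"
  shows "p = (\<Prod>z\<in>S. [:- z, 1:])"
proof (rule poly_eqI_degree_lead_coeff[where n = "card S" and A = S])
  have d: "degree (\<Prod>z\<in>S. [:- z, 1:]) = card S"
    by (subst degree_prod_sum_eq) auto
  show "coeff p (card S) = coeff (\<Prod>z\<in>S. [:- z, 1:]) (card S)"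
    using d deg lc lead_coeff_prod[of "\<lambda>z. [:- z, 1:]" S] by simp
  show "poly p z = poly (\<Prod>z\<in>S. [:- z, 1:]) z" if "z \<in> S" for z
    using that S roots by (simp add: poly_prod prod_zero_iff) 
qed (use assms in \<open>simp_all add: degree_prod_sum_eq\<close>)

text \<open>Exact order is encoded as a divisibility equivalence over all exponents, so that
  disjointness for different \<open>n\<close> and the effect of \<open>z \<mapsto> z ^ p\<close>
  become statements about divisibility of natural numbers.\<close>

definition primitive_roots :: "nat \<Rightarrow> complex set" where
  "primitive_roots n = {z. \<forall>k. z ^ k = 1 \<longleftrightarrow> n dvd k}"

definition cyclotomic :: "nat \<Rightarrow> complex poly" where
  "cyclotomic n = (\<Prod>z\<in>primitive_roots n. [:- z, 1:])"

lemma dvd_iff_all_eq: "(\<forall>k. m dvd k \<longleftrightarrow> n dvd k) \<longleftrightarrow> m = (n :: nat)"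
  by (metis dvd_antisym dvd_refl)

lemma primitive_roots_disjoint: "z \<in> primitive_roots m \<Longrightarrow> z \<in> primitive_roots n \<Longrightarrow> m = n"
  by (simp add: primitive_roots_def dvd_iff_all_eq)

lemma primitive_roots_power_eq_1_iff: "z \<in> primitive_roots n \<Longrightarrow> z ^ k = 1 \<longleftrightarrow> n dvd k"
  unfolding primitive_roots_def by blast

lemma finite_primitive_roots:
  assumes "n > 0"
  shows "finite (primitive_roots n)"
proof (rule finite_subset)
  show "primitive_roots n \<subseteq> {z. z ^ n = 1}"
    using primitive_roots_power_eq_1_iff[of _ n n] by auto
qed (use assms in \<open>simp add: finite_nth_roots\<close>)

lemma obtain_primitive_order:
  fixes z :: complex
  assumes "z ^ m = 1" "m > 0"
  obtains N where "N > 0" "N dvd m" "z \<in> primitive_roots N"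
proof -
  define N where "N = (LEAST N. N > 0 \<and> z ^ N = 1)"
  have N: "N > 0" "z ^ N = 1"
    using LeastI[of "\<lambda>N. N > 0 \<and> z ^ N = 1" m] assms by (auto simp: N_def)
  have le: "N \<le> k" if "k > 0" "z ^ k = 1" for k
    unfolding N_def using that by (intro Least_le) auto
  have "z ^ k = 1 \<longleftrightarrow> N dvd k" for k
  proof -
    have "z ^ k = z ^ (N * (k div N) + k mod N)"
      by simp
    also have "\<dots> = z ^ (k mod N)"
      unfolding power_add power_mult using N by simp
    finally have eq: "z ^ k = z ^ (k mod N)" .
    have "z ^ (k mod N) = 1 \<longleftrightarrow> k mod N = 0"
      using le[of "k mod N"] N by (metis gr0I mod_less_divisor not_le power_0)
    with eq show ?thesis
      by (simp add: dvd_eq_mod_eq_0)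
  qed
  then have pr: "z \<in> primitive_roots N"
    by (simp add: primitive_roots_def)
  with assms have "N dvd m"
    by (auto simp: primitive_roots_def)
  with N pr that show ?thesis
    by blast
qed

lemma cis_power_eq_1_iff:
  assumes "n > 0"
  shows "cis (2 * pi * real k / real n) ^ j = 1 \<longleftrightarrow> n dvd k * j"
proof -
  have "cis (2 * pi * real k / real n) ^ j = exp (2 * of_real pi * \<i> * of_nat (k * j) / of_nat n)"
    unfolding Complex.DeMoivre unfolding cis_conv_exp by (rule arg_cong[where f = exp]) (simp add: mult_ac)
  with complex_root_unity_eq_1[of n "k * j"] assms show ?thesis
    by simp
qed

lemma inj_on_cis_totatives:
  assumes "n > 0"
  shows "inj_on (\<lambda>k. cis (2 * pi * real k / real n)) (totatives n)"
proof (cases "n = 1")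
  case False
  have "totatives n \<subseteq> {..<n}"
    using False assms totatives_less[of _ n] by auto
  with Complex.bij_betw_roots_unity[OF assms] show ?thesis
    using bij_betw_imp_inj_on inj_on_subset by blast
qed simp

lemma primitive_roots_eq:
  assumes n: "n > 0"
  shows "primitive_roots n = (\<lambda>k. cis (2 * pi * real k / real n)) ` totatives n"
proof (intro equalityI subsetI)
  fix z assume z: "z \<in> primitive_roots n"
  then have "z ^ n = 1"
    by (simp add: primitive_roots_def)
  with Complex.bij_betw_roots_unity[OF n] obtain k where k: "k < n" "z = cis (2 * pi * real k / real n)"
    by (auto simp: bij_betw_def)
  have dvd: "n dvd k * j \<longleftrightarrow> n dvd j" for j
    using z cis_power_eq_1_iff[OF n, of k j] unfolding primitive_roots_def k(2) by blast
  show "z \<in> (\<lambda>k. cis (2 * pi * real k / real n)) ` totatives n"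
  proof (cases "k = 0")
    case True
    with dvd[of 1] have "n = 1"
      by simp
    \<comment> \<open>\<open>totatives 1\<close> is \<open>{1}\<close>, so the exponent 0 has to be
      traded for 1; both give the root 1.\<close>
    with k True show ?thesis
      by (auto intro!: image_eqI[of _ _ 1])
  next
    case False
    \<comment> \<open>\<open>g\<close> is \<open>n / gcd k n\<close>. It satisfies
      \<open>z ^ g = 1\<close>, and exactness of the order then gives \<open>n dvd g\<close>, which
      leaves only gcd 1.\<close>
    obtain g where g: "n = gcd k n * g"
      using gcd_dvd2[of k n] unfolding dvd_def by blast
    have "n dvd k * g"
      by (subst g, rule mult_dvd_mono) simp_all
    then have "n dvd g"
      by (simp only: dvd)
    then have "gcd k n * g dvd 1 * g"
      by (subst (asm) g) simp
    moreover have "g > 0"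
      using n g by (metis gr0I mult_0_right)
    ultimately have "gcd k n = 1"
      by (simp only: dvd_mult_cancel2 nat_mult_dvd_cancel_disj nat_dvd_1_iff_1 mult.commute[of _ g]) simp
    with False k show ?thesis
      by (auto simp: in_totatives_iff coprime_iff_gcd_eq_1 intro!: imageI)
  qed
next
  fix z assume "z \<in> (\<lambda>k. cis (2 * pi * real k / real n)) ` totatives n"
  then obtain k where "coprime k n" and k: "z = cis (2 * pi * real k / real n)"
    by (auto simp: in_totatives_iff)
  then have "n dvd k * j \<longleftrightarrow> n dvd j" for j
    by (metis coprime_commute coprime_dvd_mult_right_iff)
  then have "z ^ j = 1 \<longleftrightarrow> n dvd j" for j
    unfolding k using cis_power_eq_1_iff[OF n, of k j] by blast
  then show "z \<in> primitive_roots n"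
    unfolding primitive_roots_def by blast
qed

lemma card_primitive_roots: "n > 0 \<Longrightarrow> card (primitive_roots n) = totient n"
  using card_image[OF inj_on_cis_totatives[of n]] by (simp only: primitive_roots_eq totient_def)

lemma degree_cyclotomic: "n > 0 \<Longrightarrow> degree (cyclotomic n) = totient n"
  unfolding cyclotomic_def by (subst degree_prod_sum_eq) (simp_all add: card_primitive_roots)

lemma lead_coeff_cyclotomic: "lead_coeff (cyclotomic n) = 1"
  by (simp add: cyclotomic_def lead_coeff_prod)

lemma zero_notin_primitive_roots:
  assumes "n > 0"
  shows "0 \<notin> primitive_roots n"
proof
  assume "0 \<in> primitive_roots n"
  then have "(0 :: complex) ^ n = 1"
    using primitive_roots_power_eq_1_iff[of 0 n n] by simp
  with assms show False
    by (simp add: power_0_left)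
qed

lemma cyclotomic_nonzero_at_0: "n > 0 \<Longrightarrow> coeff (cyclotomic n) 0 \<noteq> 0"
  using zero_notin_primitive_roots[of n] finite_primitive_roots[of n]
  by (simp add: cyclotomic_def poly_0_coeff_0[symmetric] poly_prod prod_zero_iff)

lemma degree_monom_diff_1: "n > 0 \<Longrightarrow> degree (monom 1 n - [:c:] :: complex poly) = n"
  and lead_coeff_monom_diff_1: "n > 0 \<Longrightarrow> lead_coeff (monom 1 n - [:c:] :: complex poly) = 1"
proof -
  assume "n > 0"
  then show *: "degree (monom 1 n - [:c:] :: complex poly) = n"
    by (intro antisym degree_le le_degree) (auto simp: coeff_pCons split: nat.splits)
  then show "lead_coeff (monom 1 n - [:c:] :: complex poly) = 1"
    using \<open>n > 0\<close> by (auto simp: coeff_pCons split: nat.splits)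
qed

lemma monom_minus_const_eq_prod:
  assumes "n > 0" "w \<noteq> 0"
  shows "(monom 1 n - [:w:] :: complex poly) = (\<Prod>z | z ^ n = w. [:- z, 1:])"
proof (rule monic_poly_eq_prod_roots)
  show "degree (monom 1 n - [:w:]) = card {z. z ^ n = w}"
    using assms by (metis degree_monom_diff_1 card_nth_roots)
  show "lead_coeff (monom 1 n - [:w:]) = 1"
    using assms by (intro lead_coeff_monom_diff_1)
qed (use assms in \<open>simp_all add: poly_monom finite_nth_roots\<close>)

lemma prod_cyclotomic:
  assumes n: "n > 0"
  shows "(\<Prod>d | d dvd n. cyclotomic d) = monom 1 n - [:1:]"
proof -
  have fin: "finite {d. d dvd n}"
    using n by simp
  have eq: "{z. z ^ n = 1} = (\<Union>d\<in>{d. d dvd n}. primitive_roots d)"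
  proof (intro equalityI subsetI)
    fix z :: complex assume "z \<in> {z. z ^ n = 1}"
    then obtain N where "N dvd n" "z \<in> primitive_roots N"
      using obtain_primitive_order[of z n] n by auto
    then show "z \<in> (\<Union>d\<in>{d. d dvd n}. primitive_roots d)"
      by blast
  qed (auto simp: primitive_roots_def)
  have "monom 1 n - [:1:] = (\<Prod>z | z ^ n = 1. [:- z, 1 :: complex:])"
    using n by (simp add: monom_minus_const_eq_prod)
  also have "\<dots> = (\<Prod>d | d dvd n. cyclotomic d)"
    unfolding eq cyclotomic_def
  proof (rule prod.UNION_disjoint[OF fin])
    show "\<forall>d\<in>{d. d dvd n}. finite (primitive_roots d)"
      using n finite_primitive_roots by (auto dest: dvd_pos_nat)
    show "\<forall>d\<in>{d. d dvd n}. \<forall>e\<in>{d. d dvd n}. d \<noteq> e \<longrightarrow> primitive_roots d \<inter> primitive_roots e = {}"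
      using primitive_roots_disjoint by blast
  qed
  finally show ?thesis ..
qed

text \<open>If \<open>z\<close> has order \<open>N\<close>, then \<open>z ^ p\<close> has order
  \<open>N / p\<close> when \<open>p\<close> divides \<open>N\<close>, and order \<open>N\<close>
  otherwise. Solving for order \<open>n\<close> gives the two alternatives.\<close>

lemma power_in_primitive_roots_iff:
  assumes p: "prime p" and n: "n > 0"
  shows "z ^ p \<in> primitive_roots n \<longleftrightarrow>
    z \<in> primitive_roots (n * p) \<or> (\<not> p dvd n \<and> z \<in> primitive_roots n)"
proof -
  have p0: "p > 0"
    using p prime_gt_0_nat by blast
  have *: "z ^ p \<in> primitive_roots n \<longleftrightarrow> N = n * p \<or> (\<not> p dvd n \<and> N = n)"
    if N: "z \<in> primitive_roots N" for N
  proof -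
    have iff: "z ^ p \<in> primitive_roots n \<longleftrightarrow> (\<forall>k. N dvd p * k \<longleftrightarrow> n dvd k)"
    proof -
      have "(z ^ p) ^ k = 1 \<longleftrightarrow> N dvd p * k" for k
        by (simp only: power_mult[symmetric] primitive_roots_power_eq_1_iff[OF N])
      then show ?thesis
        unfolding primitive_roots_def by simp
    qed
    show ?thesis
    proof (cases "p dvd N")
      case True
      then obtain M where M: "N = p * M" ..
      have "(\<forall>k. N dvd p * k \<longleftrightarrow> n dvd k) \<longleftrightarrow> (\<forall>k. M dvd k \<longleftrightarrow> n dvd k)"
        using p0 M by simp
      also have "\<dots> \<longleftrightarrow> M = n"
        by (rule dvd_iff_all_eq)
      finally show ?thesis
        using iff M p0 True by auto
    next
      case False
      with p have "coprime N p"
        using prime_imp_coprime[of p N] by (simp add: coprime_commute)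
      then have "N dvd p * k \<longleftrightarrow> N dvd k" for k
        by (rule coprime_dvd_mult_right_iff)
      then have "(\<forall>k. N dvd p * k \<longleftrightarrow> n dvd k) \<longleftrightarrow> N = n"
        by (simp add: dvd_iff_all_eq)
      then show ?thesis
        using iff False by auto
    qed
  qed
  show ?thesis
  proof (cases "z ^ (n * p) = 1")
    case True
    then obtain N where N: "z \<in> primitive_roots N"
      using obtain_primitive_order[of z "n * p"] n p0 by auto
    then have "z \<in> primitive_roots M \<longleftrightarrow> N = M" for M
      using primitive_roots_disjoint[of z N M] by auto
    then show ?thesis
      unfolding *[OF N] by simp
  next
    case False
    have "z \<notin> primitive_roots (n * p)" "z \<notin> primitive_roots n"
      using False primitive_roots_power_eq_1_iff[of z "n * p" "n * p"]
        primitive_roots_power_eq_1_iff[of z n "n * p"] by auto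
    moreover have "z ^ p \<notin> primitive_roots n"
      using False primitive_roots_power_eq_1_iff[of "z ^ p" n n]
      by (auto simp: power_mult[symmetric] mult.commute)
    ultimately show ?thesis
      by simp
  qed
qed

lemma pcompose_linear_monom: "pcompose [:- w, 1:] (monom 1 p) = monom 1 p - [:w :: complex:]"
  by (simp add: pcompose_pCons)

text \<open>For \<open>w \<noteq> 0\<close> the polynomial \<open>x^p - w\<close> splits into
  distinct linear factors, so the left side is the product over all \<open>z\<close> with
  \<open>z ^ p\<close> of order \<open>n\<close>; the orders of these \<open>z\<close> are
  \<open>n * p\<close> and, if \<open>p\<close> does not divide \<open>n\<close>, also
  \<open>n\<close>.\<close>

lemma cyclotomic_pcompose:
  assumes p: "prime p" and n: "n > 0"
  shows "pcompose (cyclotomic n) (monom 1 p) =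
    (if p dvd n then cyclotomic (n * p) else cyclotomic (n * p) * cyclotomic n)"
proof -
  have p0: "p > 0"
    using p prime_gt_0_nat by blast
  have nz: "w \<noteq> 0" if "w \<in> primitive_roots n" for w
    using that zero_notin_primitive_roots[OF n] by blast
  have "pcompose (cyclotomic n) (monom 1 p) = (\<Prod>w\<in>primitive_roots n. monom 1 p - [:w:])"
    unfolding cyclotomic_def pcompose_prod pcompose_linear_monom ..
  also have "\<dots> = (\<Prod>w\<in>primitive_roots n. \<Prod>z | z ^ p = w. [:- z, 1:])"
    by (rule prod.cong[OF refl]) (rule monom_minus_const_eq_prod[OF p0 nz])
  also have "\<dots> = (\<Prod>z\<in>(\<Union>w\<in>primitive_roots n. {z. z ^ p = w}). [:- z, 1:])"
    using finite_primitive_roots[OF n] finite_nth_roots[OF p0]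
    by (intro prod.UNION_disjoint[symmetric]) auto
  also have "(\<Union>w\<in>primitive_roots n. {z. z ^ p = w}) = {z. z ^ p \<in> primitive_roots n}"
    by auto
  also have "\<dots> = (if p dvd n then primitive_roots (n * p) else primitive_roots (n * p) \<union> primitive_roots n)"
    unfolding power_in_primitive_roots_iff[OF p n] by auto
  also have "(\<Prod>z\<in>\<dots>. [:- z, 1:]) =
    (if p dvd n then cyclotomic (n * p) else cyclotomic (n * p) * cyclotomic n)"
  proof (cases "p dvd n")
    case False
    have "n * p \<noteq> n"
      using n prime_gt_1_nat[OF p] by simp
    then have "primitive_roots (n * p) \<inter> primitive_roots n = {}"
      using primitive_roots_disjoint by blast
    then show ?thesis
      using False n p0 by (simp add: cyclotomic_def prod.union_disjoint finite_primitive_roots)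
  qed (simp add: cyclotomic_def)
  finally show ?thesis .
qed

subsection \<open>The length of a cyclotomic polynomial\<close>

text \<open>Integrality travels with the coefficient bound, since both survive products and the
  substitution of \<open>x^p\<close>; the same induction thus also shows that cyclotomic polynomials
  have integer coefficients.\<close>

definition int_majorized :: "complex fps \<Rightarrow> real fps \<Rightarrow> bool" where
  "int_majorized f g \<longleftrightarrow> (\<forall>i. fps_nth f i \<in> \<int> \<and> cmod (fps_nth f i) \<le> fps_nth g i)"

definition geom_fps :: "nat \<Rightarrow> real fps" where
  "geom_fps d = Abs_fps (\<lambda>i. if d dvd i then 1 else 0)"

lemma int_majorized_nonneg: "int_majorized f g \<Longrightarrow> 0 \<le> fps_nth g i"
  unfolding int_majorized_def using norm_ge_zero order_trans by blast

lemma int_majorized_mult: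
  assumes "int_majorized f g" "int_majorized f' g'"
  shows "int_majorized (f * f') (g * g')"
  unfolding int_majorized_def fps_mult_nth
proof (intro allI conjI)
  fix n
  show "(\<Sum>i=0..n. fps_nth f i * fps_nth f' (n - i)) \<in> \<int>"
    using assms by (intro Ints_sum Ints_mult) (auto simp: int_majorized_def)
  show "cmod (\<Sum>i=0..n. fps_nth f i * fps_nth f' (n - i)) \<le> (\<Sum>i=0..n. fps_nth g i * fps_nth g' (n - i))"
    using assms int_majorized_nonneg
    by (intro sum_norm_le) (auto simp: norm_mult int_majorized_def intro!: mult_mono)
qed

lemma int_majorized_uminus: "int_majorized f g \<Longrightarrow> int_majorized (- f) g"
  by (auto simp: int_majorized_def)

text \<open>Every factor has nonnegative coefficients and constant term 1. Hence a majorant may be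
  padded with the factors of surplus divisors.\<close>

lemma int_majorized_1_prod_geom: "int_majorized 1 (\<Prod>d\<in>A. geom_fps d)"
proof (induction A rule: infinite_finite_induct)
  case (insert d A)
  have "int_majorized 1 (geom_fps d)"
    by (auto simp: int_majorized_def geom_fps_def)
  from int_majorized_mult[OF this insert.IH] insert.hyps show ?case
    by simp
qed (auto simp: int_majorized_def)

lemma int_majorized_compose:
  "int_majorized f g \<Longrightarrow> int_majorized (f oo (fps_X ^ p)) (g oo (fps_X ^ p))"
  by (auto simp: int_majorized_def fps_nth_compose_X_power)

lemma geom_fps_compose: "p > 0 \<Longrightarrow> geom_fps d oo (fps_X ^ p) = geom_fps (p * d)"
  by (rule fps_ext) (auto simp: geom_fps_def fps_nth_compose_X_power elim!: dvdE intro: dvd_mult_left)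

lemma divisors_mult_prime:
  fixes p x :: nat
  assumes p: "prime p"
  shows "{d. d dvd x * p} = (*) p ` {d. d dvd x} \<union> {d. d dvd x}"
proof (intro equalityI subsetI)
  fix d assume "d \<in> {d. d dvd x * p}"
  then have d: "d dvd x * p"
    by simp
  show "d \<in> (*) p ` {d. d dvd x} \<union> {d. d dvd x}"
  proof (cases "p dvd d")
    case True
    then obtain e where e: "d = p * e" ..
    with d have "e dvd x"
      using prime_gt_0_nat[OF p] by (simp add: mult.commute[of x])
    with e show ?thesis
      by blast
  next
    case False
    then have "coprime d p"
      using p prime_imp_coprime[of p d] by (simp add: coprime_commute)
    with d show ?thesis
      by (simp add: coprime_dvd_mult_left_iff)
  qed
next
  fix d assume "d \<in> (*) p ` {d. d dvd x} \<union> {d. d dvd x}"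
  then show "d \<in> {d. d dvd x * p}"
    by (auto simp: mult.commute[of x])
qed

lemma cyclotomic_1: "cyclotomic 1 = [:-1, 1:]"
proof -
  have "primitive_roots 1 = {1}"
    by (subst primitive_roots_eq) auto
  then show ?thesis
    by (simp add: cyclotomic_def)
qed

lemma int_majorized_cyclotomic_1:
  "int_majorized (fps_of_poly (cyclotomic 1)) (geom_fps 1)"
  "int_majorized (inverse (fps_of_poly (cyclotomic 1))) (geom_fps 1)"
proof -
  have eq: "fps_of_poly (cyclotomic 1) = - inverse (Abs_fps (\<lambda>_. 1))"
    unfolding cyclotomic_1
    by (rule fps_ext) (auto simp: fps_inverse_gp coeff_pCons split: nat.splits)
  show "int_majorized (fps_of_poly (cyclotomic 1)) (geom_fps 1)"
    unfolding eq by (intro int_majorized_uminus) (auto simp: fps_inverse_gp int_majorized_def geom_fps_def)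
  have "inverse (fps_of_poly (cyclotomic 1)) = - Abs_fps (\<lambda>_. 1)"
    unfolding eq by (simp add: fps_inverse_minus fps_inverse_idempotent)
  then show "int_majorized (inverse (fps_of_poly (cyclotomic 1))) (geom_fps 1)"
    by (auto simp: int_majorized_def geom_fps_def)
qed

text \<open>If \<open>p\<close> does not divide \<open>x\<close>, then
  \<open>cyclotomic (x * p)\<close> is \<open>cyclotomic x\<close> at \<open>X^p\<close> divided by
  \<open>cyclotomic x\<close>, so the reciprocal has to be bounded too; the divisors of
  \<open>x * p\<close> are those of \<open>x\<close> and their \<open>p\<close>-fold multiples,
  without overlap, so the majorants multiply exactly. If \<open>p\<close> divides \<open>x\<close>,
  only the multiples of \<open>p\<close> arise from the substitution, and the other divisors are
  padded in with the constant series 1.\<close>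

lemma int_majorized_cyclotomic:
  "n > 0 \<Longrightarrow> int_majorized (fps_of_poly (cyclotomic n)) (\<Prod>d | d dvd n. geom_fps d) \<and>
    int_majorized (inverse (fps_of_poly (cyclotomic n))) (\<Prod>d | d dvd n. geom_fps d)"
proof (induction n rule: prime_divisors_induct)
  case (unit n)
  then have "n = 1"
    by simp
  with int_majorized_cyclotomic_1 show ?case
    by simp
next
  case (factor p x)
  then have x: "x > 0" and p: "prime p"
    by auto
  have p0: "p > 0"
    using p prime_gt_0_nat by blast
  define H where "H = (\<lambda>n. \<Prod>d | d dvd n. geom_fps d)"
  define P where "P = fps_of_poly (cyclotomic x)"
  define C where "C = P oo (fps_X ^ p)"
  have P0: "fps_nth P 0 \<noteq> 0"
    using cyclotomic_nonzero_at_0[OF x] by (simp add: P_def)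
  have C0: "fps_nth C 0 \<noteq> 0"
    using P0 by (simp add: C_def fps_nth_compose_X_power)
  have IH: "int_majorized P (H x)" "int_majorized (inverse P) (H x)"
    using factor.IH[OF x] by (auto simp: P_def H_def)
  have HC: "H x oo (fps_X ^ p) = (\<Prod>d | d dvd x. geom_fps (p * d))"
    using p0 by (simp add: H_def fps_compose_prod_distrib geom_fps_compose)
  also have "\<dots> = (\<Prod>d\<in>(*) p ` {d. d dvd x}. geom_fps d)"
    using p0 by (subst prod.reindex) (auto simp: inj_on_def)
  finally have HC: "H x oo (fps_X ^ p) = (\<Prod>d\<in>(*) p ` {d. d dvd x}. geom_fps d)" .
  have MC: "int_majorized C (\<Prod>d\<in>(*) p ` {d. d dvd x}. geom_fps d)"
    using int_majorized_compose[OF IH(1), of p] by (simp add: C_def HC)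
  have iC: "inverse C = inverse P oo (fps_X ^ p)"
    unfolding C_def using P0 p0 by (intro fps_inverse_compose[symmetric]) auto
  have MiC: "int_majorized (inverse C) (\<Prod>d\<in>(*) p ` {d. d dvd x}. geom_fps d)"
    using int_majorized_compose[OF IH(2), of p] by (simp add: iC HC)
  have fin: "finite {d. d dvd x}"
    using x by simp
  have Ceq: "C = fps_of_poly (pcompose (cyclotomic x) (monom 1 p))"
    using p0 by (simp add: C_def P_def fps_of_poly_pcompose fps_of_poly_monom coeff_monom)
  have "int_majorized (fps_of_poly (cyclotomic (x * p))) (H (x * p)) \<and>
    int_majorized (inverse (fps_of_poly (cyclotomic (x * p)))) (H (x * p))"
  proof (cases "p dvd x")
    case True
    have "H (x * p) = (\<Prod>d\<in>(*) p ` {d. d dvd x} \<union> ({d. d dvd x} - (*) p ` {d. d dvd x}). geom_fps d)"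
      unfolding H_def divisors_mult_prime[OF p] by (rule arg_cong[where f = "prod geom_fps"]) blast
    also have "\<dots> = (\<Prod>d\<in>(*) p ` {d. d dvd x}. geom_fps d) *
      (\<Prod>d\<in>{d. d dvd x} - (*) p ` {d. d dvd x}. geom_fps d)"
      using fin by (intro prod.union_disjoint) auto
    finally have "int_majorized (C * 1) (H (x * p))" "int_majorized (inverse C * 1) (H (x * p))"
      using int_majorized_mult[OF MC int_majorized_1_prod_geom] int_majorized_mult[OF MiC int_majorized_1_prod_geom]
      by simp_all
    then show ?thesis
      using True Ceq cyclotomic_pcompose[OF p x] by simp
  next
    case False
    have "H (x * p) = (\<Prod>d\<in>(*) p ` {d. d dvd x}. geom_fps d) * H x"
      unfolding H_def divisors_mult_prime[OF p] using fin False
      by (intro prod.union_disjoint) (auto dest: dvd_mult_left)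
    then have "int_majorized (C * inverse P) (H (x * p))" "int_majorized (inverse C * P) (H (x * p))"
      using int_majorized_mult[OF MC IH(2)] int_majorized_mult[OF MiC IH(1)] by simp_all
    moreover have "C = fps_of_poly (cyclotomic (x * p)) * P"
      using False Ceq cyclotomic_pcompose[OF p x] by (simp add: P_def fps_of_poly_mult)
    then have "fps_of_poly (cyclotomic (x * p)) = C * inverse P"
      using P0 by (simp add: mult.assoc inverse_mult_eq_1')
    moreover from this have "inverse (fps_of_poly (cyclotomic (x * p))) = inverse C * P"
      using P0 by (simp add: fps_inverse_mult fps_inverse_idempotent)
    ultimately show ?thesis
      by simp
  qed
  then show ?case
    by (simp add: H_def mult.commute)
qed simp

text \<open>The pairs with \<open>i + j < n\<close> lie in the square \<open>i, j < n\<close>, and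
  the remaining terms of the square are nonnegative.\<close>

lemma sum_fps_mult_le:
  fixes f g :: "real fps"
  assumes "\<And>i. fps_nth f i \<ge> 0" "\<And>i. fps_nth g i \<ge> 0"
  shows "(\<Sum>i<n. fps_nth (f * g) i) \<le> (\<Sum>i<n. fps_nth f i) * (\<Sum>i<n. fps_nth g i)"
proof -
  have "(\<Sum>i<n. fps_nth (f * g) i) = (\<Sum>(i, j)\<in>{(i, j). i + j < n}. fps_nth f i * fps_nth g j)"
    by (simp add: sum.triangle_reindex fps_mult_nth atMost_atLeast0)
  also have "\<dots> \<le> (\<Sum>(i, j)\<in>{..<n} \<times> {..<n}. fps_nth f i * fps_nth g j)"
    using assms by (intro sum_mono2) auto
  also have "\<dots> = (\<Sum>i<n. fps_nth f i) * (\<Sum>i<n. fps_nth g i)"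
    by (simp add: sum_product sum.cartesian_product)
  finally show ?thesis .
qed

text \<open>For \<open>d dvd n\<close> there are exactly \<open>n div d\<close> multiples of
  \<open>d\<close> below \<open>n\<close>; cutting off at \<open>n\<close> makes the divergent
  coefficient sums finite without any rounding.\<close>

lemma sum_fps_prod_geom_le:
  assumes n: "n > 0" and A: "finite A" "A \<subseteq> {d. d dvd n}"
  shows "(\<Sum>i<n. fps_nth (\<Prod>d\<in>A. geom_fps d) i) \<le> (\<Prod>d\<in>A. real (n div d))"
  using A
proof (induction A rule: finite_induct)
  case empty
  show ?case
    using n by (simp add: sum.delta fps_one_nth)
next
  case (insert d A)
  have d: "d dvd n" "d > 0"
    using insert.prems n by (auto intro: Nat.gr0I)
  have "{i. i < n \<and> d dvd i} = (*) d ` {..<n div d}"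
    using d by (auto elim!: dvdE)
  then have "card {i. i < n \<and> d dvd i} = n div d"
    using d by (simp add: card_image inj_on_def)
  then have eq: "(\<Sum>i<n. fps_nth (geom_fps d) i) = real (n div d)"
    by (simp add: geom_fps_def sum.If_cases Int_def)
  have nonneg: "fps_nth (geom_fps d) i \<ge> 0" "fps_nth (\<Prod>d\<in>A. geom_fps d) i \<ge> 0" for i
    using int_majorized_nonneg[OF int_majorized_1_prod_geom] by (auto simp: geom_fps_def)
  have "(\<Sum>i<n. fps_nth (\<Prod>d\<in>insert d A. geom_fps d) i) \<le>
      (\<Sum>i<n. fps_nth (geom_fps d) i) * (\<Sum>i<n. fps_nth (\<Prod>d\<in>A. geom_fps d) i)"
    using sum_fps_mult_le[OF nonneg] insert.hyps by simp
  also have "\<dots> \<le> real (n div d) * (\<Prod>d\<in>A. real (n div d))"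
    unfolding eq using insert by (intro mult_left_mono) auto
  finally show ?case
    using insert.hyps by simp
qed

text \<open>The involution \<open>d \<mapsto> n div d\<close> shows that the square of the product
  consists of \<open>num_divisors n\<close> factors \<open>n\<close>.\<close>

lemma prod_codivisors:
  assumes n: "n > 0"
  shows "(\<Prod>d | d dvd n. real (n div d)) = sqrt (real n ^ num_divisors n)"
proof -
  let ?P = "\<Prod>d | d dvd n. real (n div d)"
  have "?P = (\<Prod>d | d dvd n. real d)"
    using n by (intro prod.reindex_bij_witness[of _ "\<lambda>d. n div d" "\<lambda>d. n div d"])
      (auto elim!: dvdE)
  then have "?P ^ 2 = (\<Prod>d | d dvd n. real (n div d)) * (\<Prod>d | d dvd n. real d)"
    by (simp add: power2_eq_square)
  also have "\<dots> = (\<Prod>d | d dvd n. real n)"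
    unfolding prod.distrib[symmetric]
    by (intro prod.cong refl) (auto simp flip: of_nat_mult)
  finally have "?P ^ 2 = real n ^ num_divisors n"
    by (simp add: num_divisors_def)
  then show ?thesis
    by (metis real_sqrt_unique prod_nonneg of_nat_0_le_iff)
qed

lemma cyclotomic_Ints: "n > 0 \<Longrightarrow> coeff (cyclotomic n) i \<in> \<int>"
  using int_majorized_cyclotomic[of n] by (auto simp: int_majorized_def)

text \<open>Truncating the majorant at \<open>n\<close> loses no coefficient because
  \<open>totient n < n\<close>. This fails for \<open>n = 1\<close>, where the length is 2 but the
  bound would be 1.\<close>

lemma cyclotomic_length_le:
  assumes n: "n \<ge> 2"
  shows "(\<Sum>i\<le>totient n. cmod (coeff (cyclotomic n) i)) \<le> sqrt (real n ^ num_divisors n)"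
proof -
  define H where "H = (\<Prod>d | d dvd n. geom_fps d)"
  have M: "int_majorized (fps_of_poly (cyclotomic n)) H"
    using int_majorized_cyclotomic[of n] n by (simp add: H_def)
  have "totient n < n"
    using n by (intro totient_less) auto
  then have "(\<Sum>i\<le>totient n. cmod (coeff (cyclotomic n) i)) \<le> (\<Sum>i<n. fps_nth H i)"
    using M int_majorized_nonneg[OF M]
    by (intro order_trans[OF sum_mono sum_mono2]) (auto simp: int_majorized_def)
  also have "\<dots> \<le> (\<Prod>d | d dvd n. real (n div d))"
    unfolding H_def using n by (intro sum_fps_prod_geom_le) auto
  also have "\<dots> = sqrt (real n ^ num_divisors n)"
    using n by (intro prod_codivisors) auto
  finally show ?thesis .
qed

subsection \<open>The polynomial with roots $2\cos(2\pi k/n)$\<close>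

definition int_poly :: "complex poly \<Rightarrow> bool" where
  "int_poly p \<longleftrightarrow> (\<forall>i. coeff p i \<in> \<int>)"

lemma int_poly_add: "int_poly p \<Longrightarrow> int_poly q \<Longrightarrow> int_poly (p + q)"
  and int_poly_diff: "int_poly p \<Longrightarrow> int_poly q \<Longrightarrow> int_poly (p - q)"
  and int_poly_smult: "a \<in> \<int> \<Longrightarrow> int_poly p \<Longrightarrow> int_poly (smult a p)"
  and int_poly_pCons: "a \<in> \<int> \<Longrightarrow> int_poly p \<Longrightarrow> int_poly (pCons a p)"
  by (auto simp: int_poly_def coeff_pCons split: nat.splits)

lemma int_poly_sum: "(\<And>i. i \<in> A \<Longrightarrow> int_poly (f i)) \<Longrightarrow> int_poly (sum f A)"
  by (auto simp: int_poly_def coeff_sum intro!: Ints_sum)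

lemma int_poly_mult: "int_poly p \<Longrightarrow> int_poly q \<Longrightarrow> int_poly (p * q)"
  by (auto simp: int_poly_def coeff_mult intro!: Ints_sum Ints_mult)

text \<open>Chebyshev polynomials of the first kind in the scaling \<open>2 T(x/2)\<close>.\<close>

fun dickson :: "nat \<Rightarrow> complex poly" where
  "dickson 0 = [:2:]"
| "dickson (Suc 0) = [:0, 1:]"
| "dickson (Suc (Suc j)) = pCons 0 (dickson (Suc j)) - dickson j"

lemma int_poly_dickson: "int_poly (dickson j)"
  by (induction j rule: dickson.induct)
     (auto intro!: int_poly_diff int_poly_pCons simp: int_poly_def coeff_pCons split: nat.splits)

lemma degree_dickson: "degree (dickson j) \<le> j"
  by (induction j rule: dickson.induct)
     (auto intro!: degree_diff_le degree_pCons_le[THEN order_trans])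

lemma poly_dickson: "z \<noteq> 0 \<Longrightarrow> poly (dickson j) (z + 1 / z) = z ^ j + 1 / z ^ j"
  by (induction j rule: dickson.induct) (simp_all add: field_simps power2_eq_square)

text \<open>One exponent from each pair \<open>k\<close>, \<open>n - k\<close>, that is, from each
  pair of conjugate primitive roots of unity when \<open>n > 2\<close>.\<close>

definition half_totatives :: "nat \<Rightarrow> nat set" where
  "half_totatives n = {k \<in> totatives n. 2 * k < n}"

definition psi :: "nat \<Rightarrow> real poly" where
  "psi n = (\<Prod>k\<in>half_totatives n. [:- (2 * cos (2 * pi * real k / real n)), 1:])"

lemma finite_half_totatives [simp]: "finite (half_totatives n)"
  by (simp add: half_totatives_def)

lemma totatives_eq_half_totatives:
  assumes n: "n > 2"
  shows "totatives n = half_totatives n \<union> (\<lambda>k. n - k) ` half_totatives n"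
    and "half_totatives n \<inter> (\<lambda>k. n - k) ` half_totatives n = {}"
proof -
  have "2 * k \<noteq> n" if "coprime k n" for k
  proof
    assume "2 * k = n"
    then have "k dvd n"
      by auto
    with that have "k = 1"
      by (simp add: coprime_absorb_left)
    with \<open>2 * k = n\<close> n show False
      by simp
  qed
  moreover have "coprime (n - k) n" if "coprime k n" "k \<le> n" for k
  proof -
    obtain m where "n = m + k"
      using \<open>k \<le> n\<close> by (metis add.commute le_add_diff_inverse)
    with that gcd_add2[of k m] gcd_add2[of m k] show ?thesis
      by (simp add: coprime_iff_gcd_eq_1 gcd.commute add.commute)
  qed
  moreover have "k \<in> (\<lambda>k. n - k) ` half_totatives n" if "k \<in> totatives n" "\<not> 2 * k \<le> n" for k
  proof (rule image_eqI)
    show "k = n - (n - k)"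
      using that totatives_le by auto
    show "n - k \<in> half_totatives n"
      using that totatives_less[of k n] n calculation(2)[of k]
      by (auto simp: half_totatives_def in_totatives_iff)
  qed
  ultimately show "totatives n = half_totatives n \<union> (\<lambda>k. n - k) ` half_totatives n"
    using n by (force simp: half_totatives_def in_totatives_iff)
  show "half_totatives n \<inter> (\<lambda>k. n - k) ` half_totatives n = {}"
    by (auto simp: half_totatives_def)
qed

lemma inj_on_minus_half_totatives: "inj_on (\<lambda>k. n - k) (half_totatives n)"
  by (auto simp: inj_on_def half_totatives_def)

lemma card_half_totatives: "n > 2 \<Longrightarrow> 2 * card (half_totatives n) = totient n"
  using totatives_eq_half_totatives[of n] inj_on_minus_half_totatives[of n]
  by (simp add: totient_def card_Un_disjoint card_image)

lemma poly_cyclotomic: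
  assumes n: "n > 2"
  shows "poly (cyclotomic n) z =
    (\<Prod>k\<in>half_totatives n. z\<^sup>2 - 2 * complex_of_real (cos (2 * pi * real k / real n)) * z + 1)"
proof -
  define r where "r k = cis (2 * pi * real k / real n)" for k
  have "cyclotomic n = (\<Prod>k\<in>totatives n. [:- r k, 1:])"
    unfolding cyclotomic_def r_def using n
    by (subst primitive_roots_eq) (auto simp: prod.reindex inj_on_cis_totatives)
  then have "poly (cyclotomic n) z = (\<Prod>k\<in>totatives n. z - r k)"
    by (simp add: poly_prod)
  also have "\<dots> = (\<Prod>k\<in>half_totatives n. z - r k) * (\<Prod>k\<in>(\<lambda>k. n - k) ` half_totatives n. z - r k)"
    unfolding totatives_eq_half_totatives(1)[OF n]
    using totatives_eq_half_totatives(2)[OF n] by (intro prod.union_disjoint) auto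
  also have "\<dots> = (\<Prod>k\<in>half_totatives n. (z - r k) * (z - r (n - k)))"
    by (simp add: prod.reindex inj_on_minus_half_totatives prod.distrib)
  also have "\<dots> = (\<Prod>k\<in>half_totatives n. z\<^sup>2 - 2 * complex_of_real (cos (2 * pi * real k / real n)) * z + 1)"
  proof (rule prod.cong[OF refl])
    fix k assume "k \<in> half_totatives n"
    then have k: "k < n"
      by (simp add: half_totatives_def)
    have "2 * pi * real (n - k) / real n = 2 * pi - 2 * pi * real k / real n"
      using k n by (simp add: of_nat_diff field_simps)
    then have "r (n - k) = cnj (r k)"
      unfolding r_def by (simp only: complex_eq_iff) simp
    moreover have "r k * cnj (r k) = 1"
      by (simp add: r_def complex_mult_cnj)
    moreover have "r k + cnj (r k) = 2 * complex_of_real (cos (2 * pi * real k / real n))"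
      by (simp add: complex_add_cnj r_def)
    moreover have "(z - r k) * (z - cnj (r k)) = z\<^sup>2 - (r k + cnj (r k)) * z + r k * cnj (r k)"
      by (simp add: algebra_simps power2_eq_square)
    ultimately show "(z - r k) * (z - r (n - k)) =
        z\<^sup>2 - 2 * complex_of_real (cos (2 * pi * real k / real n)) * z + 1"
      by simp
  qed
  finally show ?thesis .
qed

lemma degree_psi: "degree (psi n) = card (half_totatives n)"
  unfolding psi_def by (subst degree_prod_sum_eq) auto

lemma lead_coeff_psi: "lead_coeff (psi n) = 1"
  by (simp add: psi_def lead_coeff_prod)

lemma poly_psi: "poly (psi n) x = (\<Prod>k\<in>half_totatives n. x - 2 * cos (2 * pi * real k / real n))"
  by (simp add: psi_def poly_prod)

lemma map_poly_of_real_mult: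
  "map_poly complex_of_real (p * q) = map_poly of_real p * map_poly of_real q"
  by (rule poly_eqI) (simp add: coeff_map_poly coeff_mult)

lemma map_poly_of_real_psi:
  "poly (map_poly of_real (psi n)) (z :: complex) =
    (\<Prod>k\<in>half_totatives n. z - 2 * complex_of_real (cos (2 * pi * real k / real n)))"
proof -
  have "map_poly complex_of_real (psi n) =
      (\<Prod>k\<in>half_totatives n. map_poly of_real [:- (2 * cos (2 * pi * real k / real n)), 1:])"
    unfolding psi_def
    by (rule finite_induct[OF finite_half_totatives]) (simp_all del: mult_pCons_left add: map_poly_of_real_mult)
  then show ?thesis
    by (simp add: poly_prod map_poly_pCons)
qed

lemma poly_cyclotomic_eq_psi:
  assumes n: "n > 2" and z: "z \<noteq> 0"
  shows "poly (cyclotomic n) z = z ^ card (half_totatives n) * poly (map_poly of_real (psi n)) (z + 1 / z)"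
proof -
  have "z\<^sup>2 - 2 * c * z + 1 = z * (z + 1 / z - 2 * c)" for c
    using z by (simp add: field_simps power2_eq_square)
  then show ?thesis
    unfolding poly_cyclotomic[OF n] map_poly_of_real_psi by (simp add: prod.distrib)
qed

text \<open>\<open>z\<close> solves \<open>z^2 - x z + 1 = 0\<close>, whose roots have product 1.
  Polynomial identities in \<open>x\<close> can therefore be verified after writing \<open>x\<close>
  as \<open>z + 1 / z\<close>.\<close>

lemma exists_plus_inverse: "\<exists>z::complex. z \<noteq> 0 \<and> x = z + 1 / z"
proof -
  define z where "z = (x + csqrt (x\<^sup>2 - 4)) / 2"
  have "(2 * z - x)\<^sup>2 = x\<^sup>2 - 4"
    by (simp add: z_def diff_divide_distrib add_divide_distrib)
  then have "4 * (z * (x - z)) = 4 * 1"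
    unfolding power2_eq_square by (simp add: algebra_simps)
  then have "z * (x - z) = 1"
    by (simp only: mult_cancel_left) simp
  moreover from this have "z \<noteq> 0"
    by auto
  ultimately have "x = z + 1 / z"
    by (simp add: field_simps)
  with \<open>z \<noteq> 0\<close> show ?thesis
    by blast
qed

text \<open>The relation between \<open>cyclotomic n\<close> and \<open>psi n\<close> is used at
  \<open>z\<close> and at \<open>1 / z\<close>. Adding the two expansions pairs
  \<open>z^(i-h)\<close> with \<open>z^(h-i)\<close>, and each pair is a \<open>dickson\<close>
  value at \<open>x\<close>. This symmetrisation does without the palindromic symmetry of the
  coefficients; its price is the factor 2, which does not affect rationality.\<close>

lemma int_poly_double_psi:
  assumes n: "n > 2"
  shows "int_poly (smult 2 (map_poly of_real (psi n)))"
proof -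
  define h where "h = card (half_totatives n)"
  define P where "P = map_poly complex_of_real (psi n)"
  define a where "a i = coeff (cyclotomic n) i" for i
  define d where "d i = (if i \<le> h then h - i else i - h)" for i :: nat
  have deg: "degree (cyclotomic n) = 2 * h"
    using n card_half_totatives[OF n] by (simp add: degree_cyclotomic h_def)
  have "poly (smult 2 P) x = poly (\<Sum>i\<le>2*h. smult (a i) (dickson (d i))) x" for x
  proof -
    obtain z where z: "z \<noteq> 0" "x = z + 1 / z"
      using exists_plus_inverse by blast
    have eq: "poly (cyclotomic n) z = (\<Sum>i\<le>2*h. a i * z ^ i)" for z
      unfolding poly_altdef deg a_def ..
    have "(\<Sum>i\<le>2*h. a i * z ^ i) = z ^ h * poly P x"
      using poly_cyclotomic_eq_psi[OF n z(1)] unfolding eq P_def h_def z(2) .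
    then have "poly P x = (\<Sum>i\<le>2*h. a i * z ^ i) / z ^ h"
      using z(1) by simp
    then have "poly P x = (\<Sum>i\<le>2*h. a i * (z ^ i / z ^ h))"
      by (simp add: sum_divide_distrib)
    moreover have "(\<Sum>i\<le>2*h. a i * (1 / z) ^ i) = (1 / z) ^ h * poly P x"
      using poly_cyclotomic_eq_psi[OF n, of "1 / z"] z(1)
      unfolding eq P_def h_def z(2) by (simp add: add.commute)
    then have "poly P x = z ^ h * (\<Sum>i\<le>2*h. a i * (1 / z) ^ i)"
      using z(1) by (simp add: power_divide)
    then have "poly P x = (\<Sum>i\<le>2*h. a i * (z ^ h / z ^ i))"
      by (simp add: sum_distrib_left power_divide mult_ac)
    ultimately have "2 * poly P x = (\<Sum>i\<le>2*h. a i * (z ^ i / z ^ h)) + (\<Sum>i\<le>2*h. a i * (z ^ h / z ^ i))"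
      by simp
    also have "\<dots> = (\<Sum>i\<le>2*h. a i * poly (dickson (d i)) x)"
      unfolding sum.distrib[symmetric] distrib_left[symmetric]
    proof (intro sum.cong refl arg_cong2[where f = "(*)"])
      fix i
      have "z ^ i = z ^ h * z ^ (i - h)" if "h \<le> i"
        using that by (simp add: power_add[symmetric])
      moreover have "z ^ h = z ^ i * z ^ (h - i)" if "i \<le> h"
        using that by (simp add: power_add[symmetric])
      ultimately show "z ^ i / z ^ h + z ^ h / z ^ i = poly (dickson (d i)) x"
        using z by (cases "i \<le> h") (auto simp: d_def poly_dickson)
    qed
    finally show ?thesis
      by (simp add: poly_sum)
  qed
  then have "smult 2 P = (\<Sum>i\<le>2*h. smult (a i) (dickson (d i)))"
    by (intro poly_eq_poly_eq_iff[THEN iffD1] ext)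
  moreover have "int_poly (\<Sum>i\<le>2*h. smult (a i) (dickson (d i)))"
    using n cyclotomic_Ints[of n] by (intro int_poly_sum int_poly_smult int_poly_dickson) (auto simp: a_def)
  ultimately show ?thesis
    by (simp add: P_def)
qed

subsection \<open>Minimality\<close>

text \<open>This is \<int>[z], generated additively by signed powers of \<open>z\<close>. Induction
  can then treat one power at a time, as is needed when real parts are rewritten as polynomials in
  \<open>z + 1 / z\<close>.\<close>

inductive_set power_span :: "complex \<Rightarrow> complex set" for z where
  zero: "0 \<in> power_span z"
| add: "x \<in> power_span z \<Longrightarrow> x + z ^ k \<in> power_span z"
| diff: "x \<in> power_span z \<Longrightarrow> x - z ^ k \<in> power_span z"

lemma power_span_power: "z ^ k \<in> power_span z"
  using power_span.add[OF power_span.zero, of z k] by simp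

lemma power_span_add:
  assumes x: "x \<in> power_span z" and y: "y \<in> power_span z"
  shows "x + y \<in> power_span z"
  using y
proof induction
  case (add y k)
  from power_span.add[OF add.IH, of k] show ?case
    by (simp add: add.assoc)
next
  case (diff y k)
  from power_span.diff[OF diff.IH, of k] show ?case
    by (simp add: algebra_simps)
qed (use x in simp)

lemma power_span_diff:
  assumes x: "x \<in> power_span z" and y: "y \<in> power_span z"
  shows "x - y \<in> power_span z"
  using y
proof induction
  case (add y k)
  from power_span.diff[OF add.IH, of k] show ?case
    by (simp add: algebra_simps)
next
  case (diff y k)
  from power_span.add[OF diff.IH, of k] show ?case
    by (simp add: algebra_simps)
qed (use x in simp)

lemma power_span_mult_power:
  assumes y: "y \<in> power_span z"
  shows "y * z ^ j \<in> power_span z"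
  using y
proof induction
  case (add y k)
  from power_span.add[OF add.IH, of "k + j"] show ?case
    by (simp add: algebra_simps power_add)
next
  case (diff y k)
  from power_span.diff[OF diff.IH, of "k + j"] show ?case
    by (simp add: algebra_simps power_add)
qed (simp add: power_span.zero)

lemma power_span_mult:
  assumes x: "x \<in> power_span z" and y: "y \<in> power_span z"
  shows "x * y \<in> power_span z"
  using y
proof induction
  case (add y k)
  from power_span_add[OF add.IH power_span_mult_power[OF x, of k]] show ?case
    by (simp add: algebra_simps)
next
  case (diff y k)
  from power_span_diff[OF diff.IH power_span_mult_power[OF x, of k]] show ?case
    by (simp add: algebra_simps)
qed (simp add: power_span.zero)

lemma power_span_of_nat: "of_nat m \<in> power_span z"
proof (induction m)
  case (Suc m)
  from power_span.add[OF Suc, of 0] show ?case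
    by (simp add: add.commute)
qed (simp add: power_span.zero)

lemma power_span_Ints: "a \<in> \<int> \<Longrightarrow> a \<in> power_span z"
proof (elim Ints_cases)
  fix m assume "a = of_int m"
  then show "a \<in> power_span z"
    using power_span_of_nat power_span_diff[OF power_span.zero power_span_of_nat]
    by (cases m rule: int_cases2) auto
qed

lemma power_span_pow: "x \<in> power_span z \<Longrightarrow> x ^ k \<in> power_span z"
proof (induction k)
  case 0
  show ?case
    using power_span_of_nat[of 1] by simp
qed (simp add: power_span_mult)

lemma power_span_sum: "(\<And>i. i \<in> A \<Longrightarrow> f i \<in> power_span z) \<Longrightarrow> sum f A \<in> power_span z"
  by (induction A rule: infinite_finite_induct) (auto intro: power_span_add power_span.zero)

lemma power_span_poly: "int_poly F \<Longrightarrow> x \<in> power_span z \<Longrightarrow> poly F x \<in> power_span z"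
  unfolding poly_altdef int_poly_def
  by (rule power_span_sum, rule power_span_mult, rule power_span_Ints, simp, rule power_span_pow)

section \<open>Congruences modulo p in \<int>[z] and the Frobenius map\<close>

definition span_cong :: "complex \<Rightarrow> nat \<Rightarrow> complex \<Rightarrow> complex \<Rightarrow> bool" where
  "span_cong z p x y \<longleftrightarrow> (\<exists>r\<in>power_span z. x - y = of_nat p * r)"

lemma span_cong_refl: "span_cong z p x x"
  unfolding span_cong_def using power_span.zero by auto

lemma span_cong_sym: "span_cong z p x y \<Longrightarrow> span_cong z p y x"
  unfolding span_cong_def
proof (elim bexE)
  fix r assume r: "r \<in> power_span z" and "x - y = of_nat p * r"
  then have "y - x = of_nat p * (0 - r)"
    by (simp add: algebra_simps)
  with power_span_diff[OF power_span.zero r] show "\<exists>r\<in>power_span z. y - x = of_nat p * r"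
    by blast
qed

lemma span_cong_add:
  assumes "span_cong z p x y" "span_cong z p x' y'"
  shows "span_cong z p (x + x') (y + y')"
proof -
  from assms obtain r r' where r: "r \<in> power_span z" "r' \<in> power_span z"
    and eq: "x - y = of_nat p * r" "x' - y' = of_nat p * r'"
    unfolding span_cong_def by blast
  have "x + x' - (y + y') = (x - y) + (x' - y')"
    by simp
  also have "\<dots> = of_nat p * (r + r')"
    unfolding eq by (simp add: algebra_simps)
  finally show ?thesis
    unfolding span_cong_def using power_span_add[OF r] by blast
qed

lemma span_cong_trans: "span_cong z p x y \<Longrightarrow> span_cong z p y w \<Longrightarrow> span_cong z p x w"
  using span_cong_add[of z p x y y w] by (simp add: span_cong_def)

lemma span_cong_mult:
  assumes "span_cong z p x y" "span_cong z p x' y'" and xs: "x \<in> power_span z" "y' \<in> power_span z"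
  shows "span_cong z p (x * x') (y * y')"
proof -
  from assms obtain r r' where r: "r \<in> power_span z" "r' \<in> power_span z"
    and eq: "x - y = of_nat p * r" "x' - y' = of_nat p * r'"
    unfolding span_cong_def by blast
  have "x * x' - y * y' = x * (x' - y') + (x - y) * y'"
    by (simp add: algebra_simps)
  also have "\<dots> = of_nat p * (x * r' + r * y')"
    unfolding eq by (simp add: algebra_simps)
  finally show ?thesis
    unfolding span_cong_def using r xs power_span_add power_span_mult by blast
qed

lemma span_cong_poly:
  assumes F: "int_poly F" and x: "x \<in> power_span z" and y: "y \<in> power_span z" and c: "span_cong z p x y"
  shows "span_cong z p (poly F x) (poly F y)"
  using F
proof (induction F)
  case (pCons a F)
  have F: "int_poly F"
    using pCons.prems by (auto simp: int_poly_def coeff_pCons dest: spec[of _ "Suc _"])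
  then show ?case
    using pCons.IH c x y power_span_poly
    by (simp del: mult_pCons_left) (intro span_cong_add span_cong_mult span_cong_refl; blast)
qed (simp add: span_cong_refl)

lemma span_cong_frobenius_add:
  assumes p: "prime p" and x: "x \<in> power_span z" and y: "y \<in> power_span z"
  shows "span_cong z p ((x + y) ^ p) (x ^ p + y ^ p)"
proof -
  have p0: "p > 0"
    using p prime_gt_0_nat by blast
  define f where "f k = of_nat (p choose k) * x ^ k * y ^ (p - k)" for k
  define r where "r = (\<Sum>k\<in>{0<..<p}. of_nat ((p choose k) div p) * x ^ k * y ^ (p - k))"
  have "r \<in> power_span z"
    unfolding r_def by (intro power_span_sum power_span_mult power_span_of_nat power_span_pow x y)
  have "{..p} = insert 0 (insert p {0<..<p})"
    using p0 by auto
  then have "(x + y) ^ p = x ^ p + y ^ p + (\<Sum>k\<in>{0<..<p}. f k)"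
    using p0 unfolding binomial_ring f_def[symmetric] by (simp add: f_def)
  also have "(\<Sum>k\<in>{0<..<p}. f k) = of_nat p * r"
    unfolding r_def sum_distrib_left
  proof (intro sum.cong refl)
    fix k assume "k \<in> {0<..<p}"
    then have "p dvd (p choose k)"
      by (intro dvd_choose_prime p) auto
    then have "(of_nat (p choose k) :: complex) = of_nat p * of_nat ((p choose k) div p)"
      by (metis dvd_mult_div_cancel of_nat_mult)
    then show "f k = of_nat p * (of_nat ((p choose k) div p) * x ^ k * y ^ (p - k))"
      by (simp add: f_def mult.assoc)
  qed
  finally show ?thesis
    unfolding span_cong_def using \<open>r \<in> power_span z\<close> by auto
qed

text \<open>Nonnegative integers follow by induction from the Frobenius congruence for
  \<open>m + 1\<close>. Working inside \<int>[z] keeps Fermat's theorem in the form in which it is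
  multiplied into the Horner steps below.\<close>

lemma span_cong_fermat:
  assumes p: "prime p" and a: "a \<in> \<int>"
  shows "span_cong z p (a ^ p) a"
proof -
  have p0: "p > 0"
    using p prime_gt_0_nat by blast
  have one: "1 \<in> power_span z"
    using power_span_of_nat[of 1] by simp
  have nat: "span_cong z p (of_nat m ^ p) (of_nat m)" for m
  proof (induction m)
    case (Suc m)
    have "span_cong z p ((of_nat m + 1) ^ p) (of_nat m ^ p + 1 ^ p)"
      by (intro span_cong_frobenius_add p power_span_of_nat one)
    moreover have "span_cong z p (of_nat m ^ p + 1 ^ p) (of_nat m + 1)"
      using span_cong_add[OF Suc span_cong_refl[of z p 1]] by simp
    ultimately have "span_cong z p ((of_nat m + 1) ^ p) (of_nat m + 1)"
      by (rule span_cong_trans)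
    then show ?case
      by (simp add: add.commute)
  qed (use p0 in \<open>simp add: span_cong_refl power_0_left\<close>)
  \<comment> \<open>The Frobenius congruence for \<open>m + (- m) = 0\<close> settles the sign
    without separating \<open>p = 2\<close> from odd primes.\<close>
  have neg: "span_cong z p ((- of_nat m) ^ p) (- of_nat m)" for m
  proof -
    have "- of_nat m \<in> power_span z"
      using power_span_Ints[of "- of_nat m" z] by simp
    then have "span_cong z p ((of_nat m + - of_nat m) ^ p) (of_nat m ^ p + (- of_nat m) ^ p)"
      by (intro span_cong_frobenius_add p power_span_of_nat)
    then have "span_cong z p 0 (of_nat m ^ p + (- of_nat m) ^ p)"
      using p0 by (simp add: power_0_left)
    from span_cong_trans[OF this span_cong_add[OF nat span_cong_refl]]
    have "span_cong z p 0 (of_nat m + (- of_nat m) ^ p)" .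
    from span_cong_add[OF this span_cong_refl[of z p "- of_nat m"]]
    have "span_cong z p (- of_nat m) ((- of_nat m) ^ p)"
      by simp
    then show ?thesis
      by (rule span_cong_sym)
  qed
  from a obtain m where m: "a = of_int m"
    by (elim Ints_cases)
  show ?thesis
  proof (cases m rule: int_cases2)
    case (nonneg k)
    with nat[of k] m show ?thesis
      by simp
  next
    case (nonpos k)
    with neg[of k] m show ?thesis
      by simp
  qed
qed

lemma span_cong_frobenius_poly:
  assumes p: "prime p" and x: "x \<in> power_span z" and F: "int_poly F"
  shows "span_cong z p (poly F x ^ p) (poly F (x ^ p))"
  using F
proof (induction F)
  case 0
  show ?case
    using prime_gt_0_nat[OF p] by (simp add: span_cong_refl power_0_left)
next
  case (pCons a F)
  have F: "int_poly F" and a: "a \<in> \<int>"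
    using pCons.prems by (auto simp: int_poly_def coeff_pCons dest: spec[of _ "Suc _"] spec[of _ 0])
  have s: "poly F x \<in> power_span z" "x * poly F x \<in> power_span z" "a \<in> power_span z"
    "x ^ p \<in> power_span z" "poly F (x ^ p) \<in> power_span z"
    using x F a by (auto intro: power_span_poly power_span_mult power_span_Ints power_span_pow)
  have "span_cong z p ((a + x * poly F x) ^ p) (a ^ p + (x * poly F x) ^ p)"
    by (intro span_cong_frobenius_add p s)
  moreover have "span_cong z p (a ^ p + (x * poly F x) ^ p) (a + x ^ p * poly F (x ^ p))"
    unfolding power_mult_distrib
    by (intro span_cong_add span_cong_mult span_cong_refl span_cong_fermat p a pCons.IH F s)
  ultimately have "span_cong z p ((a + x * poly F x) ^ p) (a + x ^ p * poly F (x ^ p))"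
    by (rule span_cong_trans)
  then show ?case
    by simp
qed

text \<open>Pseudo-division: since \<open>F\<close> need not be monic, cancelling the top
  coefficient of \<open>s\<close> against a shift of \<open>F\<close> costs one factor
  \<open>lead_coeff F\<close>. At a root of \<open>F\<close> the subtracted multiple disappears, and
  \<open>k\<close> such steps bring the degree below that of \<open>F\<close>.\<close>

lemma int_poly_reduce:
  assumes F: "int_poly F" and root: "poly F a = 0" and m: "degree F > 0"
    and s: "int_poly s" "degree s < degree F + k"
  shows "\<exists>t. int_poly t \<and> degree t < degree F \<and> lead_coeff F ^ k * poly s a = poly t a"
  using s
proof (induction k arbitrary: s)
  case 0
  then show ?case
    by auto
next
  case (Suc k)
  define s' where "s' = smult (lead_coeff F) s - smult (coeff s (degree F + k)) (monom 1 k * F)"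
  have "int_poly (monom 1 k)"
    by (auto simp: int_poly_def coeff_monom)
  then have 1: "int_poly s'"
    unfolding s'_def using F Suc.prems(1)
    by (intro int_poly_diff int_poly_smult int_poly_mult) (auto simp: int_poly_def)
  have "coeff s' i = 0" if "i \<ge> degree F + k" for i
  proof (cases "i = degree F + k")
    case True
    then show ?thesis
      by (simp add: s'_def coeff_monom_mult)
  next
    case False
    with that Suc.prems(2) have "coeff s i = 0" "coeff F (i - k) = 0"
      by (auto intro: coeff_eq_0)
    then show ?thesis
      using that by (simp add: s'_def coeff_monom_mult)
  qed
  then have 2: "degree s' < degree F + k"
    using m by (metis add_gr_0 le_degree leading_coeff_0_iff degree_0 not_le)
  obtain t where t: "int_poly t" "degree t < degree F" "lead_coeff F ^ k * poly s' a = poly t a"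
    using Suc.IH[OF 1 2] by blast
  have "poly s' a = lead_coeff F * poly s a"
    by (simp add: s'_def root)
  with t show ?case
    by (intro exI[of _ t]) (simp add: mult_ac)
qed

lemma finite_bounded_coeffs:
  fixes s :: "nat \<Rightarrow> complex poly"
  shows "\<exists>A. \<forall>i<n. \<forall>k. cmod (coeff (s i) k) \<le> real A"
proof -
  define B where "B = (\<Sum>i<n. \<Sum>k\<le>degree (s i). cmod (coeff (s i) k))"
  have B0: "B \<ge> 0"
    unfolding B_def by (intro sum_nonneg) auto
  have "cmod (coeff (s i) k) \<le> real (nat \<lceil>B\<rceil>)" if i: "i < n" for i k
  proof (cases "k \<le> degree (s i)")
    case True
    then have "cmod (coeff (s i) k) \<le> (\<Sum>k\<le>degree (s i). cmod (coeff (s i) k))"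
      by (intro member_le_sum) auto
    also have "\<dots> \<le> B"
      unfolding B_def using i
      by (intro member_le_sum[of i _ "\<lambda>i. \<Sum>k\<le>degree (s i). cmod (coeff (s i) k)"] sum_nonneg) auto
    finally show ?thesis
      by linarith
  qed (simp add: coeff_eq_0)
  then show ?thesis
    by blast
qed

section \<open>Landau's argument\<close>

text \<open>\<open>F\<close> is merely a nonzero integer polynomial of least degree at
  \<open>z + 1 / z\<close>. Least degree among integer polynomials is all that the comparison of
  representations needs, so neither monicity nor primitivity is required of it.\<close>

locale cos_root =
  fixes n :: nat and z :: complex and F :: "complex poly"
  assumes n: "n > 0" and z: "z = cis (2 * pi / real n)"
    and F: "int_poly F" "F \<noteq> 0" "poly F (z + 1 / z) = 0"
    and minimal: "\<And>G. int_poly G \<Longrightarrow> G \<noteq> 0 \<Longrightarrow> poly G (z + 1 / z) = 0 \<Longrightarrow> degree F \<le> degree G"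
begin

text \<open>The argument is \<open>2 cos (2 pi j / n)\<close>; the aim is that \<open>v\<close>
  vanishes at every \<open>j > 0\<close> coprime to \<open>n\<close>, which provides the conjugates
  as roots of \<open>F\<close>.\<close>

definition v :: "nat \<Rightarrow> complex" where
  "v j = poly F (z ^ j + 1 / z ^ j)"

lemma z_power_n: "z ^ n = 1"
  using n unfolding z Complex.DeMoivre by simp

lemma z_nonzero: "z \<noteq> 0"
  by (simp add: z)

lemma cnj_z: "cnj (z ^ k) = 1 / z ^ k"
  unfolding z Complex.DeMoivre by (simp add: cis_cnj cis_inverse divide_inverse)

lemma z_power_mod: "z ^ (j mod n) = z ^ j"
proof -
  have "z ^ j = z ^ (n * (j div n) + j mod n)"
    by simp
  also have "\<dots> = z ^ (j mod n)"
    unfolding power_add power_mult z_power_n by simp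
  finally show ?thesis ..
qed

lemma v_mod: "v (j mod n) = v j"
  by (simp add: v_def z_power_mod)

lemma inverse_z_in_span: "1 / z ^ k \<in> power_span z"
proof -
  have "z ^ k * z ^ ((n - 1) * k) = (z ^ n) ^ k"
    using n by (simp add: power_mult[symmetric] power_add[symmetric] algebra_simps)
  then have "1 / z ^ k = z ^ ((n - 1) * k)"
    using z_nonzero by (simp add: z_power_n field_simps)
  then show ?thesis
    using power_span_power by metis
qed

lemma sum_in_span: "z ^ k + 1 / z ^ k \<in> power_span z"
  by (intro power_span_add power_span_power inverse_z_in_span)

lemma v_in_span: "v j \<in> power_span z"
  unfolding v_def by (intro power_span_poly F sum_in_span)

lemma v_real: "cnj (v j) = v j"
proof -
  have "cnj (poly F x) = poly F (cnj x)" for x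
  proof -
    have "cnj (coeff F i) = coeff F i" for i
      using F(1) by (metis Ints_cases complex_cnj_of_int int_poly_def)
    then show ?thesis
      by (simp add: poly_altdef)
  qed
  moreover have "cnj (z ^ j + 1 / z ^ j) = z ^ j + 1 / z ^ j"
    unfolding complex_cnj_add complex_cnj_divide complex_cnj_one cnj_z by simp
  ultimately show ?thesis
    by (simp add: v_def)
qed

lemma degree_F: "degree F > 0"
proof (rule ccontr)
  assume "\<not> degree F > 0"
  then obtain c where "F = [:c:]"
    using degree_eq_zeroE by blast
  with F show False
    by simp
qed

text \<open>\<open>z^k\<close> plus its conjugate is a \<open>dickson\<close> polynomial at
  \<open>z + 1 / z\<close>, and \<open>z^n = 1\<close> allows the exponent to be reduced below
  \<open>n\<close>. Hence the single factor \<open>lead_coeff F ^ n\<close> serves for every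
  \<open>r\<close>, a uniformity that the comparison of coefficients modulo \<open>p\<close> depends
  on.\<close>

lemma span_real_reduce:
  assumes "r \<in> power_span z"
  shows "\<exists>t. int_poly t \<and> degree t < degree F \<and>
    lead_coeff F ^ n * (r + cnj r) = poly t (z + 1 / z)"
  using assms
proof induction
  case zero
  show ?case
    using degree_F by (intro exI[of _ 0]) (auto simp: int_poly_def)
next
  case (add x k)
  have "degree (dickson (k mod n)) < degree F + n"
    using degree_dickson[of "k mod n"] n degree_F by (meson le_less_trans mod_less_divisor trans_less_add2)
  from int_poly_reduce[OF F(1,3) degree_F int_poly_dickson this]
  obtain s where s: "int_poly s" "degree s < degree F"
    "lead_coeff F ^ n * poly (dickson (k mod n)) (z + 1 / z) = poly s (z + 1 / z)"
    by blast
  from add.IH obtain t where t: "int_poly t" "degree t < degree F"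
    "lead_coeff F ^ n * (x + cnj x) = poly t (z + 1 / z)"
    by blast
  have "poly (dickson (k mod n)) (z + 1 / z) = z ^ k + cnj (z ^ k)"
    unfolding poly_dickson[OF z_nonzero] z_power_mod cnj_z ..
  with s(3) t(3) have "lead_coeff F ^ n * (x + z ^ k + cnj (x + z ^ k)) = poly (t + s) (z + 1 / z)"
    by (simp add: algebra_simps)
  moreover have "int_poly (t + s)" "degree (t + s) < degree F"
    using s t by (auto intro: int_poly_add degree_add_less)
  ultimately show ?case
    by blast
next
  case (diff x k)
  have "degree (dickson (k mod n)) < degree F + n"
    using degree_dickson[of "k mod n"] n degree_F by (meson le_less_trans mod_less_divisor trans_less_add2)
  from int_poly_reduce[OF F(1,3) degree_F int_poly_dickson this]
  obtain s where s: "int_poly s" "degree s < degree F"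
    "lead_coeff F ^ n * poly (dickson (k mod n)) (z + 1 / z) = poly s (z + 1 / z)"
    by blast
  from diff.IH obtain t where t: "int_poly t" "degree t < degree F"
    "lead_coeff F ^ n * (x + cnj x) = poly t (z + 1 / z)"
    by blast
  have "poly (dickson (k mod n)) (z + 1 / z) = z ^ k + cnj (z ^ k)"
    unfolding poly_dickson[OF z_nonzero] z_power_mod cnj_z ..
  with s(3) t(3) have "lead_coeff F ^ n * (x - z ^ k + cnj (x - z ^ k)) = poly (t - s) (z + 1 / z)"
    by (simp add: algebra_simps)
  moreover have "int_poly (t - s)" "degree (t - s) < degree F"
    using s t by (auto intro: int_poly_diff degree_diff_less)
  ultimately show ?case
    by blast
qed

text \<open>With \<open>u = z^j + 1 / z^j\<close>, the congruences
  \<open>F(u)^p \<equiv> F(u^p) \<equiv> F(z^(jp) + 1 / z^(jp))\<close> apply Frobenius once to the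
  polynomial and once to the sum; the leftmost term vanishes.\<close>

lemma v_frobenius:
  assumes p: "prime p" and v: "v j = 0"
  shows "\<exists>r\<in>power_span z. v (j * p) = of_nat p * r"
proof -
  have p0: "p > 0"
    using p prime_gt_0_nat by blast
  let ?u = "z ^ j + 1 / z ^ j"
  have "span_cong z p (?u ^ p) ((z ^ j) ^ p + (1 / z ^ j) ^ p)"
    by (intro span_cong_frobenius_add p power_span_power inverse_z_in_span)
  then have "span_cong z p (?u ^ p) (z ^ (j * p) + 1 / z ^ (j * p))"
    by (simp add: power_mult power_divide)
  then have "span_cong z p (poly F (?u ^ p)) (v (j * p))"
    unfolding v_def by (intro span_cong_poly F power_span_pow sum_in_span)
  moreover have "span_cong z p (poly F ?u ^ p) (poly F (?u ^ p))"
    by (intro span_cong_frobenius_poly p F sum_in_span)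
  ultimately have "span_cong z p (poly F ?u ^ p) (v (j * p))"
    by (rule span_cong_trans[rotated])
  then have "span_cong z p (v (j * p)) 0"
    using v p0 span_cong_sym[of z p 0] by (simp add: v_def power_0_left)
  then show ?thesis
    by (simp add: span_cong_def)
qed

text \<open>Landau's argument: \<open>v j = 0\<close> forces \<open>v (j p) \<equiv> 0\<close> modulo \<open>p\<close>, and \<open>v\<close> takes finitely many
  values, only the zero one of which is divisible by a large \<open>p\<close>.\<close>

lemma v_large_prime:
  "\<exists>A. \<forall>p j. prime p \<longrightarrow> p > A \<longrightarrow> v j = 0 \<longrightarrow> v (j * p) = 0"
proof -
  let ?c = "lead_coeff F ^ n"
  have "\<forall>i. \<exists>t. int_poly t \<and> degree t < degree F \<and> ?c * (v i + cnj (v i)) = poly t (z + 1 / z)"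
    using span_real_reduce[OF v_in_span] by blast
  then obtain s where s: "\<And>i. int_poly (s i)" "\<And>i. degree (s i) < degree F"
    "\<And>i. ?c * (2 * v i) = poly (s i) (z + 1 / z)"
    unfolding v_real mult_2[symmetric] by metis
  obtain A where A: "\<And>i k. i < n \<Longrightarrow> cmod (coeff (s i) k) \<le> real A"
    using finite_bounded_coeffs by blast
  have "v (j * p) = 0" if p: "prime p" "p > A" and v: "v j = 0" for p j
  proof -
    obtain r where r: "r \<in> power_span z" "v (j * p) = of_nat p * r"
      using v_frobenius[OF p(1) v] by blast
    obtain t where t: "int_poly t" "degree t < degree F" "?c * (r + cnj r) = poly t (z + 1 / z)"
      using span_real_reduce[OF r(1)] by blast
    define i where "i = j * p mod n"
    have i: "i < n" "v i = v (j * p)"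
      using n by (auto simp: i_def v_mod)
    have "2 * v i = v i + cnj (v i)"
      unfolding v_real by simp
    also have "\<dots> = of_nat p * (r + cnj r)"
      unfolding i(2) r(2) by (simp add: algebra_simps)
    finally have "poly (s i) (z + 1 / z) = ?c * (of_nat p * (r + cnj r))"
      by (simp add: s(3)[symmetric])
    also have "\<dots> = of_nat p * poly t (z + 1 / z)"
      unfolding t(3)[symmetric] by (simp add: mult_ac)
    finally have root: "poly (s i - smult (of_nat p) t) (z + 1 / z) = 0"
      by simp
    \<comment> \<open>Both polynomials have degree below that of \<open>F\<close>, so by minimality
      their agreement at \<open>z + 1 / z\<close> is equality of polynomials. Divisibility by
      \<open>p\<close> in \<int>[z] thereby becomes divisibility of integer coefficients.\<close>
    have "int_poly (s i - smult (of_nat p) t)" "degree (s i - smult (of_nat p) t) < degree F"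
      using s t by (auto intro!: int_poly_diff int_poly_smult degree_diff_less
          intro: le_less_trans[OF degree_smult_le])
    then have eq: "s i = smult (of_nat p) t"
      using minimal[of "s i - smult (of_nat p) t"] root by auto
    \<comment> \<open>The coefficient is \<open>p\<close> times an integer and at most
      \<open>A < p\<close> in absolute value; \<open>A\<close> does not depend on \<open>j\<close>
      or \<open>p\<close> because only the indices \<open>i < n\<close> occur.\<close>
    have "coeff (s i) k = 0" for k
    proof -
      obtain a where a: "coeff t k = of_int a"
        using t(1) by (auto simp: int_poly_def elim: Ints_cases)
      then have "real p * \<bar>real_of_int a\<bar> \<le> real A"
        using A[OF i(1), of k] by (simp add: eq norm_mult)
      moreover have "real A < real p"
        using p by simp
      ultimately have "\<bar>real_of_int a\<bar> < 1"
        by (smt (verit, best) mult_le_cancel_left1 of_nat_0_le_iff)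
      then have "a = 0"
        by linarith
      with a show ?thesis
        by (simp add: eq)
    qed
    then have "s i = 0"
      by (intro poly_eqI) simp
    with s(3)[of i] i F(2) show ?thesis
      by simp
  qed
  then show ?thesis
    by blast
qed

text \<open>From \<open>v 1 = 0\<close>, which is the assumption on \<open>F\<close>, the prime
  factors of \<open>k\<close> are multiplied in one at a time, each of them above the
  threshold.\<close>

lemma v_rough:
  assumes A: "\<And>p j. prime p \<Longrightarrow> p > A \<Longrightarrow> v j = 0 \<Longrightarrow> v (j * p) = 0"
  shows "k > 0 \<Longrightarrow> (\<And>p. prime p \<Longrightarrow> p dvd k \<Longrightarrow> p > A) \<Longrightarrow> v k = 0"
proof (induction k rule: prime_divisors_induct)
  case (unit k)
  then show ?case
    using F(3) by (simp add: v_def)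
next
  case (factor p k)
  then have "v k = 0"
    by auto
  moreover have "p > A"
    using factor by auto
  ultimately show ?case
    using A[of p k] factor.hyps by (simp add: mult.commute)
qed simp

lemma v_totative:
  assumes k: "k > 0" "coprime k n"
  shows "v k = 0"
proof -
  obtain A where A: "\<And>p j. prime p \<Longrightarrow> p > A \<Longrightarrow> v j = 0 \<Longrightarrow> v (j * p) = 0"
    using v_large_prime by blast
  \<comment> \<open>\<open>k + n Q\<close> is congruent to \<open>k\<close> modulo \<open>n\<close> and has no prime factor up to \<open>A\<close>.\<close>
  define Q where "Q = \<Prod>{p. prime p \<and> p \<le> A \<and> \<not> p dvd k}"
  have fin: "finite {p. prime p \<and> p \<le> A \<and> \<not> p dvd k}"
    by (rule finite_subset[of _ "{..A}"]) auto
  have rough: "p > A" if p: "prime p" "p dvd k + n * Q" for p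
  proof (rule ccontr)
    assume "\<not> p > A"
    show False
    proof (cases "p dvd k")
      case True
      with p have "p dvd n * Q"
        using dvd_add_right_iff[of p k "n * Q"] by simp
      moreover have "\<not> p dvd n"
        using True k(2) p(1) coprime_common_divisor_nat[of k n p] by auto
      ultimately have "p dvd Q"
        using p(1) by (simp add: prime_dvd_mult_iff)
      then obtain q where "q \<in> {p. prime p \<and> p \<le> A \<and> \<not> p dvd k}" "p dvd q"
        using p(1) fin unfolding Q_def by (auto simp: prime_dvd_prod_iff)
      with True p(1) show False
        using primes_dvd_imp_eq[of p q] by auto
    next
      case False
      then have "p dvd Q"
        unfolding Q_def using p(1) \<open>\<not> p > A\<close> by (intro dvd_prodI[OF fin]) simp
      then have "p dvd n * Q"
        by simp
      with p(2) False show False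
        using dvd_add_left_iff[of p "n * Q" k] by simp
    qed
  qed
  have "v (k + n * Q) = 0"
    by (rule v_rough[OF A _ rough]) (use k in simp_all)
  then show ?thesis
    using v_mod[of k] v_mod[of "k + n * Q"] by simp
qed

end

lemma inj_on_cos_half_totatives:
  "inj_on (\<lambda>k. 2 * cos (2 * pi * real k / real n)) (half_totatives n)"
proof (rule inj_onI)
  fix j k assume jk: "j \<in> half_totatives n" "k \<in> half_totatives n"
    and eq: "2 * cos (2 * pi * real j / real n) = 2 * cos (2 * pi * real k / real n)"
  have "2 * pi * real i / real n \<in> {0..pi}" if "i \<in> half_totatives n" for i
  proof -
    from that have i: "2 * i < n"
      by (simp add: half_totatives_def)
    then have "2 * real i \<le> real n"
      by linarith
    then have "pi * (2 * real i) \<le> pi * real n"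
      by (intro mult_left_mono) auto
    with i show ?thesis
      by (simp add: field_simps)
  qed
  note bounds = this[OF jk(1)] this[OF jk(2)]
  have "2 * pi * real j / real n = 2 * pi * real k / real n"
    by (rule cos_inj_pi) (use bounds eq in simp_all)
  then have "real j / real n = real k / real n"
    by simp
  with jk show "j = k"
    by (auto simp: half_totatives_def)
qed

text \<open>A competitor \<open>F\<close> of least degree has all the numbers
  \<open>2 cos (2 pi k / n)\<close>, \<open>k\<close> in \<open>half_totatives n\<close>, as roots,
  and these are distinct because cosine is injective on \<open>[0, pi]\<close>.\<close>

lemma degree_ge_half_totatives:
  assumes n: "n > 2" and G: "int_poly G" "G \<noteq> 0" "poly G (2 * complex_of_real (cos (2 * pi / real n))) = 0"
  shows "card (half_totatives n) \<le> degree G"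
proof -
  define z where "z = cis (2 * pi / real n)"
  have zk: "z ^ k + 1 / z ^ k = 2 * complex_of_real (cos (2 * pi * real k / real n))" for k
    unfolding z_def Complex.DeMoivre by (simp add: divide_inverse cis_inverse complex_eq_iff mult_ac)
  have z1: "z + 1 / z = 2 * complex_of_real (cos (2 * pi / real n))"
    using zk[of 1] by simp
  define P where "P F \<longleftrightarrow> int_poly F \<and> F \<noteq> 0 \<and> poly F (z + 1 / z) = 0" for F
  have PG: "P G"
    using G by (simp add: P_def z1)
  define F where "F = (ARG_MIN degree F. P F)"
  have PF: "P F" and min: "\<And>H. P H \<Longrightarrow> degree F \<le> degree H"
    using arg_min_nat_lemma[of P G degree] PG by (auto simp: F_def)
  interpret cos_root n z F
    using n PF min by unfold_locales (auto simp: z_def P_def)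
  have "card (half_totatives n) = card ((\<lambda>x. complex_of_real x) ` (\<lambda>k. 2 * cos (2 * pi * real k / real n)) ` half_totatives n)"
    by (subst card_image, simp add: inj_on_def) (rule card_image[OF inj_on_cos_half_totatives, symmetric])
  also have "\<dots> \<le> card {x. poly F x = 0}"
  proof (rule card_mono)
    show "finite {x. poly F x = 0}"
      using F(2) by (rule poly_roots_finite)
    have "poly F (complex_of_real (2 * cos (2 * pi * real k / real n))) = 0" if "k \<in> half_totatives n" for k
    proof -
      from that have "v k = 0"
        by (intro v_totative) (auto simp: half_totatives_def in_totatives_iff)
      then show ?thesis
        by (simp add: v_def zk)
    qed
    then show "(\<lambda>x. complex_of_real x) ` (\<lambda>k. 2 * cos (2 * pi * real k / real n)) ` half_totatives n \<subseteq> {x. poly F x = 0}"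
      by blast
  qed
  also have "\<dots> \<le> degree F"
    using F(2) by (rule card_poly_roots_bound)
  also have "\<dots> \<le> degree G"
    using min PG .
  finally show ?thesis .
qed

section \<open>From integer to rational polynomials\<close>

lemma obtain_denominator:
  fixes q :: "rat poly"
  obtains N :: nat where "N > 0" "int_poly (map_poly of_rat (smult (of_nat N) q))"
proof
  define d where "d i = nat (snd (quotient_of (coeff q i)))" for i
  define N where "N = (\<Prod>i\<le>degree q. d i)"
  have d0: "d i > 0" for i
    using quotient_of_denom_pos'[of "coeff q i"] by (simp add: d_def)
  then show "N > 0"
    by (simp add: N_def)
  have "of_nat N * coeff q i \<in> \<int>" for i
  proof (cases "i \<le> degree q")
    case True
    then have "d i dvd N"
      unfolding N_def by (intro dvd_prodI) auto
    then obtain m where m: "N = d i * m" ..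
    have "coeff q i = of_int (fst (quotient_of (coeff q i))) / of_nat (d i)"
      using quotient_of_div[of "coeff q i"] quotient_of_denom_pos'[of "coeff q i"]
      by (cases "quotient_of (coeff q i)") (simp add: d_def)
    then have "of_nat (d i) * coeff q i = of_int (fst (quotient_of (coeff q i)))"
      using d0[of i] by (simp add: field_simps)
    then have "of_nat N * coeff q i = of_int (int m * fst (quotient_of (coeff q i)))"
      unfolding m by (simp add: mult_ac)
    then show ?thesis
      by (metis Ints_of_int)
  qed (simp add: coeff_eq_0)
  then show "int_poly (map_poly of_rat (smult (of_nat N) q))"
    unfolding int_poly_def by (metis Ints_cases Ints_of_int coeff_map_poly coeff_smult of_rat_0 of_rat_of_int_eq)
qed

lemma poly_map_poly_of_rat_complex:
  "poly (map_poly of_rat q) (complex_of_real x) = complex_of_real (poly (map_poly of_rat q) x)"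
proof -
  have "(of_rat r :: complex) = of_real (of_rat r)" for r
    by (cases r) (simp add: of_rat_rat)
  then show ?thesis
    by (simp add: poly_altdef coeff_map_poly degree_map_poly)
qed

text \<open>Clearing denominators turns a rational competitor into an integer polynomial of the same
  degree, to which the count of roots applies.\<close>

lemma is_min_poly_rat_psi:
  assumes n: "n > 2" and P: "map_poly of_rat P = psi n"
  shows "is_min_poly_rat (2 * cos (2 * pi / real n)) P"
  unfolding is_min_poly_rat_def
proof (intro conjI allI impI)
  have degP: "degree P = card (half_totatives n)"
    using degree_psi[of n] unfolding P[symmetric] by (simp add: degree_map_poly)
  have "of_rat (lead_coeff P) = (1 :: real)"
    using lead_coeff_psi[of n] unfolding P[symmetric] by (simp add: degree_map_poly coeff_map_poly)
  then show "lead_coeff P = 1"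
    by (simp only: of_rat_eq_1_iff)
  have "1 \<in> half_totatives n"
    using n by (simp add: half_totatives_def in_totatives_iff)
  then show "poly (map_poly of_rat P) (2 * cos (2 * pi / real n)) = 0"
    unfolding P poly_psi by (intro prod_zero bexI[of _ 1]) auto
  fix q assume q: "q \<noteq> 0 \<and> poly (map_poly of_rat q) (2 * cos (2 * pi / real n)) = 0"
  obtain N where N: "N > 0" "int_poly (map_poly of_rat (smult (of_nat N) q))"
    by (rule obtain_denominator)
  have "card (half_totatives n) \<le> degree (map_poly (of_rat :: rat \<Rightarrow> complex) (smult (of_nat N) q))"
  proof (rule degree_ge_half_totatives[OF n N(2)])
    show "map_poly of_rat (smult (of_nat N) q) \<noteq> (0 :: complex poly)"
      using q N(1) by (simp add: map_poly_eq_0_iff)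
    have "poly (map_poly of_rat (smult (of_nat N) q)) (2 * cos (2 * pi / real n)) = 0"
      using q by (simp add: map_poly_of_rat_smult)
    then show "poly (map_poly of_rat (smult (of_nat N) q)) (2 * complex_of_real (cos (2 * pi / real n))) = 0"
      using poly_map_poly_of_rat_complex[of "smult (of_nat N) q" "2 * cos (2 * pi / real n)"] by simp
  qed
  with N(1) show "degree P \<le> degree q"
    by (simp add: degree_map_poly degP)
qed

lemma psi_rational:
  assumes n: "n > 2"
  shows "\<exists>P. map_poly of_rat P = psi n"
proof -
  have "coeff (psi n) i \<in> \<rat>" for i
  proof -
    have "2 * complex_of_real (coeff (psi n) i) \<in> \<int>"
      using int_poly_double_psi[OF n] by (simp add: int_poly_def coeff_map_poly)
    then obtain m where "2 * complex_of_real (coeff (psi n) i) = of_int m"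
      by (elim Ints_cases)
    then have "coeff (psi n) i = of_int m / 2"
      by (simp add: complex_eq_iff)
    then show ?thesis
      by (simp only: Rats_divide Rats_of_int Rats_number_of)
  qed
  then have "map_poly of_rat (map_poly (inv (of_rat :: rat \<Rightarrow> real)) (psi n)) = psi n"
    using inv_f_f[of "of_rat :: rat \<Rightarrow> real" 0]
    by (intro poly_eqI) (simp add: coeff_map_poly inj_def f_inv_into_f Rats_def)
  then show ?thesis
    by blast
qed

lemma Psi_eq_homogenize_psi:
  assumes n: "n > 2"
  shows "Psi n = homogenize (psi n)"
proof -
  obtain P where P: "map_poly of_rat P = psi n"
    using psi_rational[OF n] by blast
  note min = is_min_poly_rat_psi[OF n P]
  then have "min_poly_rat (2 * cos (2 * pi / real n)) = P"
    unfolding min_poly_rat_def by (intro the_equality) (auto intro: is_min_poly_rat_unique)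
  with P show ?thesis
    by (simp add: Psi_def)
qed

subsection \<open>Reduction of the area to one-dimensional integrals\<close>

text \<open>The substitution rule for absolutely integrable functions transfers integrability in
  both directions. For nonnegative Borel functions a failure of integrability means that both sides
  are infinite, so the area need not be known to be finite beforehand.\<close>

lemma nn_integral_change_of_variables:
  fixes f g g' :: "real \<Rightarrow> real"
  assumes S: "S \<in> sets borel" and gS: "g ` S \<in> sets borel"
    and der: "\<And>x. x \<in> S \<Longrightarrow> (g has_field_derivative g' x) (at x within S)"
    and inj: "inj_on g S"
    and f: "f \<in> borel_measurable borel" and g: "g \<in> borel_measurable borel" and g': "g' \<in> borel_measurable borel"
    and nonneg: "\<And>x. 0 \<le> f x"
  shows "(\<integral>\<^sup>+x. ennreal (f x) * indicator (g ` S) x \<partial>lborel) =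
    (\<integral>\<^sup>+x. ennreal (\<bar>g' x\<bar> * f (g x)) * indicator S x \<partial>lborel)"
proof -
  have abs_int: "h absolutely_integrable_on A" 
    if "(\<integral>\<^sup>+x. ennreal (h x) * indicator A x \<partial>lborel) < \<infinity>" "h \<in> borel_measurable borel" "A \<in> sets borel"
      "\<And>x. 0 \<le> h x" for h :: "real \<Rightarrow> real" and A
  proof -
    have [measurable]: "h \<in> borel_measurable borel" "A \<in> sets borel"
      by fact+
    have "(\<integral>\<^sup>+x. ennreal (indicator A x *\<^sub>R h x) \<partial>lborel) = (\<integral>\<^sup>+x. ennreal (h x) * indicator A x \<partial>lborel)"
      by (intro nn_integral_cong) (simp split: split_indicator)
    with that have "integrable lborel (\<lambda>x. indicator A x *\<^sub>R h x)"
      by (intro integrableI_nonneg) auto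
    then show ?thesis
      unfolding set_integrable_def by (simp add: integrable_completion)
  qed
  have eq: "(\<integral>\<^sup>+x. ennreal (h x) * indicator A x \<partial>lborel) = ennreal (integral A h)"
    if "h absolutely_integrable_on A" "\<And>x. 0 \<le> h x" for h :: "real \<Rightarrow> real" and A
    using that by (intro nn_integral_has_integral_lebesgue' integrable_integral)
      (auto intro: set_lebesgue_integral_eq_integral(1))
  note cov = has_absolute_integral_change_of_variables_1'[of S g g' f, OF _ der inj]
  have SL: "S \<in> sets lebesgue"
    using S by auto
  let ?h = "\<lambda>x. \<bar>g' x\<bar> * f (g x)"
  have h: "?h \<in> borel_measurable borel"
    using f g g' by measurable
  show ?thesis
  proof (cases "f absolutely_integrable_on g ` S")
    case True
    then have "?h absolutely_integrable_on S \<and> integral S ?h = integral (g ` S) f"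
      using cov[OF SL] by blast
    then show ?thesis
      using eq[OF True] eq[where h = ?h and A = S] nonneg by simp
  next
    case False
    then have "\<not> ?h absolutely_integrable_on S"
      using cov[OF SL] by blast
    then have "\<not> (\<integral>\<^sup>+x. ennreal (?h x) * indicator S x \<partial>lborel) < \<infinity>"
      using abs_int[where h = ?h and A = S] S h nonneg by auto
    moreover have "\<not> (\<integral>\<^sup>+x. ennreal (f x) * indicator (g ` S) x \<partial>lborel) < \<infinity>"
      using False abs_int[where h = f and A = "g ` S"] gS f nonneg by auto
    ultimately show ?thesis
      by (simp add: less_top[symmetric])
  qed
qed

lemma nn_integral_abs_cbox:
  assumes "r \<ge> 0"
  shows "(\<integral>\<^sup>+y. ennreal \<bar>y\<bar> * indicator {-r..r} y \<partial>lborel) = ennreal (r\<^sup>2)"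
proof (rule nn_integral_has_integral_lebesgue')
  have "((\<lambda>y. - y) has_integral (- (0\<^sup>2 / 2) - - ((-r)\<^sup>2 / 2))) {-r..0}"
    using assms by (intro fundamental_theorem_of_calculus)
      (auto intro!: derivative_eq_intros simp flip: has_real_derivative_iff_has_vector_derivative)
  moreover have "((\<lambda>y. y) has_integral (r\<^sup>2 / 2 - 0\<^sup>2 / 2)) {0..r}"
    using assms by (intro fundamental_theorem_of_calculus)
      (auto intro!: derivative_eq_intros simp flip: has_real_derivative_iff_has_vector_derivative)
  ultimately have "((\<lambda>y. \<bar>y\<bar>) has_integral (r\<^sup>2 / 2)) {-r..0}" "((\<lambda>y. \<bar>y\<bar>) has_integral (r\<^sup>2 / 2)) {0..r}"
    by (auto elim!: has_integral_eq[rotated])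
  from has_integral_combine[OF _ _ this] assms
  show "(abs has_integral r\<^sup>2) {-r..r}"
    by simp
qed simp

text \<open>On the slice at height \<open>y \<noteq> 0\<close> the substitution
  \<open>x = y t\<close> gives \<open>|y| dt\<close> and the condition
  \<open>|y|^h |f(t)| <= 1\<close>. After exchanging the integrals, \<open>y\<close> runs for fixed
  \<open>t\<close> over \<open>[-r, r]\<close> with \<open>r = |f(t)| powr (-1/h)\<close>, and
  \<open>|y|\<close> integrates to \<open>r^2\<close>.\<close>

lemma area_homogenize:
  assumes d: "degree f > 0"
  shows "form_area (homogenize f) =
    (\<integral>\<^sup>+t. ennreal (\<bar>poly f t\<bar> powr (- 2 / real (degree f))) \<partial>lborel)"
proof -
  let ?h = "degree f"
  let ?E = "{(x, y). \<bar>homogenize f x y\<bar> \<le> 1}"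
  have [measurable]: "(\<lambda>z. homogenize f (fst z) (snd z)) \<in> borel_measurable (borel \<Otimes>\<^sub>M borel)"
    unfolding homogenize_def by measurable
  have poly_meas [measurable]: "poly f \<in> borel_measurable borel"
    by (intro borel_measurable_continuous_onI continuous_intros)
  have "?E = {z \<in> space (borel \<Otimes>\<^sub>M borel). \<bar>homogenize f (fst z) (snd z)\<bar> \<le> 1}"
    by (auto simp: space_pair_measure)
  also have "\<dots> \<in> sets (borel \<Otimes>\<^sub>M borel)"
    by measurable
  finally have E: "?E \<in> sets (borel \<Otimes>\<^sub>M borel)" .
  let ?I = "\<lambda>y t. ennreal \<bar>y\<bar> * indicator {t. \<bar>y\<bar> ^ ?h * \<bar>poly f t\<bar> \<le> 1} t"
  have slice: "emeasure lborel ((\<lambda>x. (x, y)) -` ?E) = (\<integral>\<^sup>+t. ?I y t \<partial>lborel)" if y: "y \<noteq> 0" for y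
  proof -
    have hy: "(\<lambda>x. homogenize f x y) \<in> borel_measurable borel"
      unfolding homogenize_def by measurable
    then have S: "{x. \<bar>homogenize f x y\<bar> \<le> 1} \<in> sets borel"
      by measurable
    have "emeasure lborel ((\<lambda>x. (x, y)) -` ?E) = (\<integral>\<^sup>+x. indicator {x. \<bar>homogenize f x y\<bar> \<le> 1} x \<partial>lborel)"
      using S by (simp add: vimage_def)
    also have "\<dots> = \<bar>y\<bar> * (\<integral>\<^sup>+t. indicator {x. \<bar>homogenize f x y\<bar> \<le> 1} (0 + y * t) \<partial>lborel)"
      using S y by (intro nn_integral_real_affine) auto
    also have "(\<integral>\<^sup>+t. indicator {x. \<bar>homogenize f x y\<bar> \<le> 1} (0 + y * t) \<partial>lborel) =
        (\<integral>\<^sup>+t. indicator {t. \<bar>y\<bar> ^ ?h * \<bar>poly f t\<bar> \<le> 1} t \<partial>lborel)"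
      using y by (intro nn_integral_cong)
        (simp add: homogenize_altdef abs_mult power_abs split: split_indicator)
    also have "\<bar>y\<bar> * \<dots> = (\<integral>\<^sup>+t. ?I y t \<partial>lborel)"
      by (intro nn_integral_cmult[symmetric]) measurable
    finally show ?thesis .
  qed
  have inner: "(\<integral>\<^sup>+y. ?I y t \<partial>lborel) = ennreal (\<bar>poly f t\<bar> powr (- 2 / real ?h))" if t: "poly f t \<noteq> 0" for t
  proof -
    define r where "r = \<bar>poly f t\<bar> powr (- 1 / real ?h)"
    have r1: "r > 0"
      using t by (simp add: r_def)
    have "r ^ ?h = r powr real ?h"
      using r1 by (simp add: powr_realpow)
    also have "\<dots> = \<bar>poly f t\<bar> powr (- 1)"
      unfolding r_def powr_powr using d by simp
    finally have r2: "r ^ ?h = 1 / \<bar>poly f t\<bar>"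
      using t by (simp add: powr_minus_divide)
    have "r\<^sup>2 = r powr 2"
      using r1 by simp
    also have "\<dots> = \<bar>poly f t\<bar> powr (- 2 / real ?h)"
      unfolding r_def powr_powr by simp
    finally have r3: "r\<^sup>2 = \<bar>poly f t\<bar> powr (- 2 / real ?h)" .
    note r = r1 r2 r3
    have "\<bar>y\<bar> ^ ?h * \<bar>poly f t\<bar> \<le> 1 \<longleftrightarrow> y \<in> {-r..r}" for y
    proof -
      have "\<bar>y\<bar> ^ ?h * \<bar>poly f t\<bar> \<le> 1 \<longleftrightarrow> \<bar>y\<bar> ^ ?h \<le> r ^ ?h"
        using t by (simp add: r(2) field_simps)
      also have "\<dots> \<longleftrightarrow> \<bar>y\<bar> \<le> r"
        using r(1) d by (intro power_mono_iff) auto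
      finally show ?thesis
        by auto
    qed
    then have "(\<integral>\<^sup>+y. ?I y t \<partial>lborel) = (\<integral>\<^sup>+y. ennreal \<bar>y\<bar> * indicator {-r..r} y \<partial>lborel)"
      by (intro nn_integral_cong) (simp split: split_indicator)
    with nn_integral_abs_cbox[of r] r show ?thesis
      by simp
  qed
  have "form_area (homogenize f) = emeasure lborel ?E"
  proof -
    have "?E \<in> sets lborel"
      using E unfolding borel_prod by simp
    then show ?thesis
      by (simp add: form_area_def)
  qed
  also have "\<dots> = emeasure (lborel \<Otimes>\<^sub>M lborel) ?E"
    by (simp add: lborel_prod)
  also have "\<dots> = (\<integral>\<^sup>+y. emeasure lborel ((\<lambda>x. (x, y)) -` ?E) \<partial>lborel)"
    using E by (intro lborel_pair.emeasure_pair_measure_alt2) simp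
  also have "\<dots> = (\<integral>\<^sup>+y. \<integral>\<^sup>+t. ?I y t \<partial>lborel \<partial>lborel)"
    using AE_lborel_singleton[of 0] slice by (intro nn_integral_cong_AE) auto
  also have "\<dots> = (\<integral>\<^sup>+t. \<integral>\<^sup>+y. ?I y t \<partial>lborel \<partial>lborel)"
  proof (rule lborel_pair.Fubini'[symmetric])
    have "(\<lambda>(y, t). ?I y t) = (\<lambda>z. ennreal \<bar>fst z\<bar> * indicator {z. \<bar>fst z\<bar> ^ ?h * \<bar>poly f (snd z)\<bar> \<le> 1} z)"
      by (auto split: split_indicator)
    also have "\<dots> \<in> borel_measurable (lborel \<Otimes>\<^sub>M lborel)"
    proof -
      have "{z \<in> space (lborel \<Otimes>\<^sub>M lborel). \<bar>fst z\<bar> ^ ?h * \<bar>poly f (snd z)\<bar> \<le> 1} \<in> sets (lborel \<Otimes>\<^sub>M lborel)"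
        by measurable
      then show ?thesis
        by (simp add: space_pair_measure)
    qed
    finally show "(\<lambda>(y, t). ?I y t) \<in> borel_measurable (lborel \<Otimes>\<^sub>M lborel)" .
  qed
  also have "\<dots> = (\<integral>\<^sup>+t. ennreal (\<bar>poly f t\<bar> powr (- 2 / real ?h)) \<partial>lborel)"
  proof (rule nn_integral_cong_AE)
    \<comment> \<open>At a zero of \<open>f\<close> the inner integral is infinite while
      \<open>0 powr _\<close> is 0, so the finitely many zeros are discarded as a null set.\<close>
    have "f \<noteq> 0"
      using d by auto
    then have "{t. poly f t = 0} \<in> null_sets lborel"
      by (intro finite_imp_null_set_lborel poly_roots_finite)
    from AE_not_in[OF this] show "AE t in lborel. (\<integral>\<^sup>+y. ?I y t \<partial>lborel) = ennreal (\<bar>poly f t\<bar> powr (- 2 / real ?h))"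
      using inner by (auto elim: eventually_mono)
  qed
  finally show ?thesis .
qed

lemma nn_set_integral_cong:
  fixes f g :: "_ \<Rightarrow> ennreal"
  shows "(\<And>x. x \<in> S \<Longrightarrow> f x = g x) \<Longrightarrow>
    (\<integral>\<^sup>+x. f x * indicator S x \<partial>M) = (\<integral>\<^sup>+x. g x * indicator S x \<partial>M)"
  by (intro nn_integral_cong) (auto split: split_indicator)

section \<open>Substitutions carrying the line to the unit disc\<close>

lemma image_plus_inverse: "(\<lambda>w::real. w + 1 / w) ` {0<..<1} = {2<..}"
proof (intro equalityI subsetI)
  fix t :: real assume "t \<in> {2<..}"
  then have t: "t > 2"
    by simp
  define q where "q = sqrt (t\<^sup>2 - 4)"
  have t4: "t\<^sup>2 > 4"
    using power_strict_mono[OF t, of 2] by simp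
  then have q: "q\<^sup>2 = t\<^sup>2 - 4" "q > 0"
    by (simp_all add: q_def)
  have "q < t"
    using q t by (intro power2_less_imp_less[of q t]) auto
  have "t - 2 < q"
  proof (rule power2_less_imp_less)
    have "(t - 2)\<^sup>2 = t\<^sup>2 - 4 * t + 4"
      by (simp add: power2_eq_square algebra_simps)
    with t show "(t - 2)\<^sup>2 < q\<^sup>2"
      unfolding q(1) by simp
  qed (use q in simp)
  \<comment> \<open>The smaller root of \<open>w^2 - t w + 1\<close>; the inequalities
    \<open>t - 2 < q < t\<close> place it in \<open>(0, 1)\<close>.\<close>
  define w where "w = (t - q) / 2"
  have w: "0 < w" "w < 1"
    using \<open>q < t\<close> \<open>t - 2 < q\<close> by (simp_all add: w_def)
  have "t - w = (t + q) / 2"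
    by (simp add: w_def field_simps)
  then have "w * (t - w) = (t\<^sup>2 - q\<^sup>2) / 4"
    unfolding \<open>t - w = (t + q) / 2\<close> by (simp add: w_def power2_eq_square algebra_simps)
  then have "w * (t - w) = 1"
    using q(1) by simp
  then have "t = w + 1 / w"
    using w by (simp add: field_simps)
  with w show "t \<in> (\<lambda>w::real. w + 1 / w) ` {0<..<1}"
    by auto
next
  fix t :: real assume "t \<in> (\<lambda>w. w + 1 / w) ` {0<..<1}"
  then obtain w where w: "0 < w" "w < 1" "t = w + 1 / w"
    by auto
  have "(1 - w)\<^sup>2 > 0"
    using w by simp
  then have "2 * w < w * w + 1"
    by (simp add: power2_eq_square algebra_simps)
  also have "w * w + 1 = t * w"
    using w by (simp add: field_simps)
  finally show "t \<in> {2<..}"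
    using w(1) by simp
qed

lemma inj_on_plus_inverse: "inj_on (\<lambda>w::real. w + 1 / w) {0<..<1}"
proof (rule inj_onI)
  fix u w :: real assume uw: "u \<in> {0<..<1}" "w \<in> {0<..<1}" and eq: "u + 1 / u = w + 1 / w"
  have "(u - w) * (u * w - 1) = 0"
    using uw eq by (simp add: field_simps)
  moreover have "u * w < 1 * 1"
    using uw by (intro mult_strict_mono) auto
  ultimately show "u = w"
    by simp
qed

lemma image_double_cos: "(\<lambda>s. 2 * cos s) ` {0<..<pi} = {-2<..<2}"
proof (intro equalityI subsetI)
  fix t :: real assume t: "t \<in> {-2<..<2}"
  show "t \<in> (\<lambda>s. 2 * cos s) ` {0<..<pi}"
  proof (rule image_eqI)
    show "t = 2 * cos (arccos (t / 2))"
      using t by (subst cos_arccos) auto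
    show "arccos (t / 2) \<in> {0<..<pi}"
      using t arccos_lt_bounded[of "t / 2"] by auto
  qed
next
  fix t :: real assume "t \<in> (\<lambda>s. 2 * cos s) ` {0<..<pi}"
  then obtain s where s: "0 < s" "s < pi" "t = 2 * cos s"
    by auto
  have "cos s < cos 0" "cos pi < cos s"
    using s by (auto intro!: cos_monotone_0_pi simp del: cos_zero cos_pi)
  with s show "t \<in> {-2<..<2}"
    by simp
qed

lemma inj_on_double_cos: "inj_on (\<lambda>s. 2 * cos s) {0<..<pi}"
proof (rule inj_onI)
  fix s t assume st: "s \<in> {0<..<pi}" "t \<in> {0<..<pi}" and eq: "2 * cos s = 2 * cos t"
  show "s = t"
    by (rule cos_inj_pi) (use st eq in simp_all)
qed

lemma nn_integral_outer:
  fixes f :: "real \<Rightarrow> real"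
  assumes f [measurable]: "f \<in> borel_measurable borel" and nonneg: "\<And>x. 0 \<le> f x"
  shows "(\<integral>\<^sup>+t. ennreal (f t) * indicator {2<..} t \<partial>lborel) =
      (\<integral>\<^sup>+w. ennreal ((1 / w\<^sup>2 - 1) * f (w + 1 / w)) * indicator {0<..<1} w \<partial>lborel)"
    and "(\<integral>\<^sup>+t. ennreal (f t) * indicator {..<-2} t \<partial>lborel) =
      (\<integral>\<^sup>+w. ennreal ((1 / w\<^sup>2 - 1) * f (- (w + 1 / w))) * indicator {0<..<1} w \<partial>lborel)"
proof -
  have sq: "\<bar>1 / w\<^sup>2 - 1\<bar> = 1 / w\<^sup>2 - 1" "\<bar>1 - 1 / w\<^sup>2\<bar> = 1 / w\<^sup>2 - 1" if "w \<in> {0<..<1}" for w :: real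
  proof -
    have "w\<^sup>2 \<le> 1" "w\<^sup>2 > 0"
      using that by (auto intro: power_le_one)
    then have "1 / w\<^sup>2 \<ge> 1"
      by simp
    then show "\<bar>1 / w\<^sup>2 - 1\<bar> = 1 / w\<^sup>2 - 1" "\<bar>1 - 1 / w\<^sup>2\<bar> = 1 / w\<^sup>2 - 1"
      by linarith+
  qed
  have "(\<integral>\<^sup>+t. ennreal (f t) * indicator ((\<lambda>w. w + 1 / w) ` {0<..<1}) t \<partial>lborel) =
      (\<integral>\<^sup>+w. ennreal (\<bar>1 - 1 / w\<^sup>2\<bar> * f (w + 1 / w)) * indicator {0<..<1} w \<partial>lborel)"
  proof (rule nn_integral_change_of_variables)
    show "((\<lambda>w. w + 1 / w) has_field_derivative (1 - 1 / x\<^sup>2)) (at x within {0<..<1})"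
      if "x \<in> {0<..<1}" for x :: real
      using that by (auto intro!: derivative_eq_intros simp: power2_eq_square)
  qed (auto simp: image_plus_inverse inj_on_plus_inverse nonneg)
  also have "\<dots> = (\<integral>\<^sup>+w. ennreal ((1 / w\<^sup>2 - 1) * f (w + 1 / w)) * indicator {0<..<1} w \<partial>lborel)"
    by (intro nn_set_integral_cong) (simp only: sq)
  finally show "(\<integral>\<^sup>+t. ennreal (f t) * indicator {2<..} t \<partial>lborel) =
      (\<integral>\<^sup>+w. ennreal ((1 / w\<^sup>2 - 1) * f (w + 1 / w)) * indicator {0<..<1} w \<partial>lborel)"
    by (simp only: image_plus_inverse)
  have im: "(\<lambda>w::real. - (w + 1 / w)) ` {0<..<1} = {..<-2}"
  proof -
    have "(\<lambda>w::real. - (w + 1 / w)) ` {0<..<1} = uminus ` {2<..}"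
      unfolding image_plus_inverse[symmetric] image_image ..
    then show ?thesis
      by simp
  qed
  have "(\<integral>\<^sup>+t. ennreal (f t) * indicator ((\<lambda>w. - (w + 1 / w)) ` {0<..<1}) t \<partial>lborel) =
      (\<integral>\<^sup>+w. ennreal (\<bar>1 / w\<^sup>2 - 1\<bar> * f (- (w + 1 / w))) * indicator {0<..<1} w \<partial>lborel)"
  proof (rule nn_integral_change_of_variables)
    show "((\<lambda>w. - (w + 1 / w)) has_field_derivative (1 / x\<^sup>2 - 1)) (at x within {0<..<1})"
      if "x \<in> {0<..<1}" for x :: real
      using that by (auto intro!: derivative_eq_intros simp: power2_eq_square)
    show "inj_on (\<lambda>w::real. - (w + 1 / w)) {0<..<1}"
      using inj_on_plus_inverse unfolding inj_on_def neg_equal_iff_equal .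
    show "(\<lambda>w::real. - (w + 1 / w)) ` {0<..<1} \<in> sets borel"
      unfolding im by simp
  qed (auto simp: nonneg)
  also have "\<dots> = (\<integral>\<^sup>+w. ennreal ((1 / w\<^sup>2 - 1) * f (- (w + 1 / w))) * indicator {0<..<1} w \<partial>lborel)"
    by (intro nn_set_integral_cong) (simp only: sq)
  finally show "(\<integral>\<^sup>+t. ennreal (f t) * indicator {..<-2} t \<partial>lborel) =
      (\<integral>\<^sup>+w. ennreal ((1 / w\<^sup>2 - 1) * f (- (w + 1 / w))) * indicator {0<..<1} w \<partial>lborel)"
    by (simp only: im)
qed

lemma nn_integral_inner:
  fixes f :: "real \<Rightarrow> real"
  assumes f [measurable]: "f \<in> borel_measurable borel" and nonneg: "\<And>x. 0 \<le> f x"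
  shows "(\<integral>\<^sup>+t. ennreal (f t) * indicator {-2<..<2} t \<partial>lborel) =
      (\<integral>\<^sup>+s. ennreal (2 * sin s * f (2 * cos s)) * indicator {0<..<pi} s \<partial>lborel)"
proof -
  have "(\<integral>\<^sup>+t. ennreal (f t) * indicator ((\<lambda>s. 2 * cos s) ` {0<..<pi}) t \<partial>lborel) =
      (\<integral>\<^sup>+s. ennreal (\<bar>- 2 * sin s\<bar> * f (2 * cos s)) * indicator {0<..<pi} s \<partial>lborel)"
  proof (rule nn_integral_change_of_variables)
    show "((\<lambda>s. 2 * cos s) has_field_derivative (- 2 * sin x)) (at x within {0<..<pi})" for x
      by (auto intro!: derivative_eq_intros)
  qed (auto simp: image_double_cos inj_on_double_cos nonneg)
  also have "\<dots> = (\<integral>\<^sup>+s. ennreal (2 * sin s * f (2 * cos s)) * indicator {0<..<pi} s \<partial>lborel)"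
  proof (intro nn_set_integral_cong)
    fix s assume "s \<in> {0<..<pi}"
    then have "\<bar>- 2 * sin s\<bar> = 2 * sin s"
      using sin_gt_zero[of s] by simp
    then show "ennreal (\<bar>- 2 * sin s\<bar> * f (2 * cos s)) = ennreal (2 * sin s * f (2 * cos s))"
      by (simp only:)
  qed
  finally show ?thesis
    by (simp only: image_double_cos)
qed

lemma nn_integral_split:
  fixes f :: "real \<Rightarrow> real"
  assumes f [measurable]: "f \<in> borel_measurable borel"
  shows "(\<integral>\<^sup>+t. ennreal (f t) \<partial>lborel) =
    (\<integral>\<^sup>+t. ennreal (f t) * indicator {2<..} t \<partial>lborel) +
    (\<integral>\<^sup>+t. ennreal (f t) * indicator {..<-2} t \<partial>lborel) +
    (\<integral>\<^sup>+t. ennreal (f t) * indicator {-2<..<2} t \<partial>lborel)"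
proof -
  have "(\<integral>\<^sup>+t. ennreal (f t) \<partial>lborel) = (\<integral>\<^sup>+t. ennreal (f t) * indicator {2<..} t +
      ennreal (f t) * indicator {..<-2} t + ennreal (f t) * indicator {-2<..<2} t \<partial>lborel)"
  proof (rule nn_integral_cong_AE)
    show "AE t in lborel. ennreal (f t) = ennreal (f t) * indicator {2<..} t +
        ennreal (f t) * indicator {..<-2} t + ennreal (f t) * indicator {-2<..<2} t"
      using AE_lborel_singleton[of 2] AE_lborel_singleton[of "-2"]
      by eventually_elim (auto split: split_indicator)
  qed
  then show ?thesis
    by (simp add: nn_integral_add)
qed

definition cyc_abs :: "nat \<Rightarrow> complex \<Rightarrow> real" where
  "cyc_abs n z = cmod (poly (cyclotomic n) z)"

lemma cyc_abs_measurable [measurable]: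
  "(\<lambda>x. cyc_abs n (complex_of_real x)) \<in> borel_measurable borel"
  "(\<lambda>x. cyc_abs n (- complex_of_real x)) \<in> borel_measurable borel"
  "(\<lambda>x. cyc_abs n (cis x)) \<in> borel_measurable borel"
  unfolding cyc_abs_def by (intro borel_measurable_continuous_onI continuous_intros)+

lemma poly_map_poly_of_real: "poly (map_poly of_real p) (complex_of_real x) = complex_of_real (poly p x)"
  by (simp add: poly_altdef coeff_map_poly degree_map_poly)

lemma abs_psi:
  assumes n: "n > 2"
  shows "w \<noteq> 0 \<Longrightarrow> \<bar>poly (psi n) (w + 1 / w)\<bar> =
      cyc_abs n (complex_of_real w) / \<bar>w\<bar> ^ card (half_totatives n)"
    and "\<bar>poly (psi n) (2 * cos s)\<bar> = cyc_abs n (cis s)"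
proof -
  assume w: "w \<noteq> 0"
  have "poly (cyclotomic n) (of_real w) = of_real (w ^ card (half_totatives n) * poly (psi n) (w + 1 / w))"
    using poly_cyclotomic_eq_psi[OF n, of "of_real w"] poly_map_poly_of_real[of "psi n" "w + 1 / w"] w
    by simp
  then have "cyc_abs n (complex_of_real w) = \<bar>w\<bar> ^ card (half_totatives n) * \<bar>poly (psi n) (w + 1 / w)\<bar>"
    unfolding cyc_abs_def by (simp only: norm_of_real abs_mult power_abs)
  with w show "\<bar>poly (psi n) (w + 1 / w)\<bar> = cyc_abs n (complex_of_real w) / \<bar>w\<bar> ^ card (half_totatives n)"
    by simp
next
  have "cis s + 1 / cis s = complex_of_real (2 * cos s)"
    by (simp add: divide_inverse cis_inverse complex_eq_iff)
  then have "poly (cyclotomic n) (cis s) = cis s ^ card (half_totatives n) * of_real (poly (psi n) (2 * cos s))"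
    using poly_cyclotomic_eq_psi[OF n, of "cis s"] poly_map_poly_of_real[of "psi n" "2 * cos s"] by simp
  then show "\<bar>poly (psi n) (2 * cos s)\<bar> = cyc_abs n (cis s)"
    by (simp add: cyc_abs_def norm_mult norm_power)
qed

text \<open>Since \<open>h * a = 2\<close>, the factor \<open>w^h\<close> between
  \<open>cyclotomic n\<close> and \<open>psi n\<close> contributes exactly \<open>w^2\<close>, which
  turns the Jacobian \<open>1 / w^2 - 1\<close> into \<open>1 - w^2\<close>. On the unit circle that
  factor has modulus 1.\<close>

lemma form_area_Psi:
  assumes n: "n > 2"
  defines "a \<equiv> 4 / real (totient n)"
  shows "form_area (Psi n) =
    (\<integral>\<^sup>+w. ennreal ((1 - w\<^sup>2) * cyc_abs n (complex_of_real w) powr (- a)) * indicator {0<..<1} w \<partial>lborel) +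
    (\<integral>\<^sup>+w. ennreal ((1 - w\<^sup>2) * cyc_abs n (- complex_of_real w) powr (- a)) * indicator {0<..<1} w \<partial>lborel) +
    (\<integral>\<^sup>+s. ennreal (2 * sin s * cyc_abs n (cis s) powr (- a)) * indicator {0<..<pi} s \<partial>lborel)"
proof -
  define h where "h = card (half_totatives n)"
  have h2: "2 * h = totient n"
    using card_half_totatives[OF n] by (simp add: h_def)
  have h: "h > 0"
    using h2 n by (metis gr0I mult_0_right not_less0 totient_0_iff)
  have a: "a = 2 / real h"
    unfolding a_def h2[symmetric] by simp
  define f where "f t = \<bar>poly (psi n) t\<bar> powr (- a)" for t
  have [measurable]: "poly (psi n) \<in> borel_measurable borel"
    by (intro borel_measurable_continuous_onI continuous_intros)
  have f [measurable]: "f \<in> borel_measurable borel" and nonneg: "\<And>t. 0 \<le> f t"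
    unfolding f_def by measurable
  have "form_area (Psi n) = (\<integral>\<^sup>+t. ennreal (f t) \<partial>lborel)"
    using area_homogenize[of "psi n"] h unfolding Psi_eq_homogenize_psi[OF n] f_def a
    by (simp add: degree_psi h_def)
  moreover have w: "(1 / w\<^sup>2 - 1) * f (w + 1 / w) = (1 - w\<^sup>2) * cyc_abs n (complex_of_real w) powr (- a)"
    if "w \<noteq> 0" for w
  proof -
    have "(\<bar>w\<bar> ^ h) powr (- a) = \<bar>w\<bar> powr (- 2)"
      using that h by (simp add: powr_realpow[symmetric] powr_powr a)
    also have "\<dots> = 1 / w\<^sup>2"
      using that by (simp add: powr_minus_divide)
    finally have "f (w + 1 / w) = cyc_abs n (complex_of_real w) powr (- a) * w\<^sup>2"
      unfolding f_def abs_psi(1)[OF n that] h_def[symmetric]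
      by (simp add: powr_divide cyc_abs_def)
    with that show ?thesis
      by (simp add: field_simps)
  qed
  ultimately have "form_area (Psi n) =
    (\<integral>\<^sup>+w. ennreal ((1 / w\<^sup>2 - 1) * f (w + 1 / w)) * indicator {0<..<1} w \<partial>lborel) +
    (\<integral>\<^sup>+w. ennreal ((1 / w\<^sup>2 - 1) * f (- (w + 1 / w))) * indicator {0<..<1} w \<partial>lborel) +
    (\<integral>\<^sup>+s. ennreal (2 * sin s * f (2 * cos s)) * indicator {0<..<pi} s \<partial>lborel)"
    using nn_integral_split[OF f] nn_integral_outer[OF f nonneg] nn_integral_inner[OF f nonneg] by simp
  also have "(\<integral>\<^sup>+w. ennreal ((1 / w\<^sup>2 - 1) * f (w + 1 / w)) * indicator {0<..<1} w \<partial>lborel) =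
    (\<integral>\<^sup>+w. ennreal ((1 - w\<^sup>2) * cyc_abs n (complex_of_real w) powr (- a)) * indicator {0<..<1} w \<partial>lborel)"
    by (intro nn_set_integral_cong) (simp add: w)
  also have "(\<integral>\<^sup>+w. ennreal ((1 / w\<^sup>2 - 1) * f (- (w + 1 / w))) * indicator {0<..<1} w \<partial>lborel) =
    (\<integral>\<^sup>+w. ennreal ((1 - w\<^sup>2) * cyc_abs n (- complex_of_real w) powr (- a)) * indicator {0<..<1} w \<partial>lborel)"
  proof (intro nn_set_integral_cong)
    fix w :: real assume "w \<in> {0<..<1}"
    with w[of "- w"] show "ennreal ((1 / w\<^sup>2 - 1) * f (- (w + 1 / w))) =
        ennreal ((1 - w\<^sup>2) * cyc_abs n (- complex_of_real w) powr (- a))"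
      by simp
  qed
  also have "(\<integral>\<^sup>+s. ennreal (2 * sin s * f (2 * cos s)) * indicator {0<..<pi} s \<partial>lborel) =
    (\<integral>\<^sup>+s. ennreal (2 * sin s * cyc_abs n (cis s) powr (- a)) * indicator {0<..<pi} s \<partial>lborel)"
    unfolding f_def abs_psi(2)[OF n] ..
  finally show ?thesis .
qed

subsection \<open>Estimates\<close>

lemma num_divisors_mono: "n > 0 \<Longrightarrow> d dvd n \<Longrightarrow> num_divisors d \<le> num_divisors n"
  unfolding num_divisors_def by (intro card_mono) (auto intro: dvd_trans)

lemma num_divisors_pos: "n > 0 \<Longrightarrow> num_divisors n > 0"
  unfolding num_divisors_def by (subst card_gt_0_iff) auto

lemma cyc_abs_le_length:
  assumes n: "n > 0" and z: "cmod z \<le> 1"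
  shows "cyc_abs n z \<le> (\<Sum>i\<le>totient n. cmod (coeff (cyclotomic n) i))"
proof -
  have "cyc_abs n z \<le> (\<Sum>i\<le>totient n. cmod (coeff (cyclotomic n) i * z ^ i))"
    unfolding cyc_abs_def poly_altdef degree_cyclotomic[OF n] by (rule norm_sum)
  also have "\<dots> \<le> (\<Sum>i\<le>totient n. cmod (coeff (cyclotomic n) i))"
    using z by (intro sum_mono) (simp add: norm_mult norm_power mult_left_le power_le_one)
  finally show ?thesis .
qed

text \<open>The leading coefficient is 1, so already the leading term shrinks strictly inside the
  open disc. The strict inequality in the final lower bound rests on this.\<close>

lemma cyc_abs_less_length:
  assumes n: "n > 0" and z: "cmod z < 1"
  shows "cyc_abs n z < (\<Sum>i\<le>totient n. cmod (coeff (cyclotomic n) i))"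
proof -
  have "cyc_abs n z \<le> (\<Sum>i\<le>totient n. cmod (coeff (cyclotomic n) i * z ^ i))"
    unfolding cyc_abs_def poly_altdef degree_cyclotomic[OF n] by (rule norm_sum)
  also have "\<dots> < (\<Sum>i\<le>totient n. cmod (coeff (cyclotomic n) i))"
  proof (rule sum_strict_mono_ex1)
    show "\<forall>i\<in>{..totient n}. cmod (coeff (cyclotomic n) i * z ^ i) \<le> cmod (coeff (cyclotomic n) i)"
      using z by (simp add: norm_mult norm_power mult_left_le power_le_one)
    have "cmod z ^ totient n < 1"
      using z n by (simp add: power_less_one_iff)
    moreover have "coeff (cyclotomic n) (totient n) = 1"
      using lead_coeff_cyclotomic[of n] by (simp add: degree_cyclotomic[OF n])
    ultimately show "\<exists>i\<in>{..totient n}. cmod (coeff (cyclotomic n) i * z ^ i) < cmod (coeff (cyclotomic n) i)"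
      by (intro bexI[of _ "totient n"]) (simp_all add: norm_mult norm_power)
  qed simp
  finally show ?thesis .
qed

lemma prod_cyc_abs: "n > 0 \<Longrightarrow> (\<Prod>d | d dvd n. cyc_abs d z) = cmod (1 - z ^ n)"
proof -
  assume n: "n > 0"
  have "(\<Prod>d | d dvd n. cyc_abs d z) = cmod (poly (\<Prod>d | d dvd n. cyclotomic d) z)"
    by (simp add: cyc_abs_def poly_prod prod_norm)
  also have "\<dots> = cmod (1 - z ^ n)"
    unfolding prod_cyclotomic[OF n] by (simp add: poly_monom norm_minus_commute)
  finally show ?thesis .
qed

text \<open>In the factorisation of \<open>1 - z^n\<close> over the divisors, every factor other
  than the one for \<open>n\<close> is bounded by the length estimate for \<open>n\<close>. The
  divisor 1 escapes that estimate and is bounded by 2, for which \<open>sqrt n >= 2\<close>, that is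
  \<open>n \<ge> 4\<close>, is needed. The exponent \<open>num_divisors n\<close>, one more than the
  number of these factors, leads to the stated square.\<close>

lemma cyc_abs_ge:
  assumes n: "n \<ge> 4" and z: "cmod z \<le> 1"
  shows "cmod (1 - z ^ n) \<le> cyc_abs n z * sqrt (real n ^ num_divisors n) ^ num_divisors n"
proof -
  let ?M = "sqrt (real n ^ num_divisors n)"
  have n0: "n > 0"
    using n by simp
  have "real 4 ^ 1 \<le> real n ^ 1"
    using n by simp
  also have "\<dots> \<le> real n ^ num_divisors n"
    using n num_divisors_pos[OF n0] by (intro power_increasing) auto
  finally have "sqrt 4 \<le> ?M"
    by (intro real_sqrt_le_mono) simp
  then have M: "2 \<le> ?M"
    by simp
  have le: "cyc_abs d z \<le> ?M" if d: "d dvd n" for d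
  proof (cases "d \<ge> 2")
    case True
    have "d \<le> n"
      using d n0 by (rule dvd_imp_le)
    have "cyc_abs d z \<le> sqrt (real d ^ num_divisors d)"
      using cyc_abs_le_length[of d z] cyclotomic_length_le[OF True] True z by simp
    also have "real d ^ num_divisors d \<le> real n ^ num_divisors d"
      using \<open>d \<le> n\<close> by (intro power_mono) auto
    also have "\<dots> \<le> real n ^ num_divisors n"
      using num_divisors_mono[OF n0 d] n by (intro power_increasing) auto
    finally show ?thesis
      by simp
  next
    case False
    moreover have "d > 0"
      using d n0 by (rule dvd_pos_nat[rotated])
    ultimately have "d = 1"
      by simp
    have "cmod (z - 1) \<le> cmod z + cmod 1"
      by (rule norm_triangle_ineq4)
    with z have "cmod (z - 1) \<le> 2"
      by simp
    then have "cyc_abs d z \<le> 2"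
      unfolding \<open>d = 1\<close> cyc_abs_def cyclotomic_1 by (simp add: algebra_simps)
    with M show ?thesis
      by linarith
  qed
  have fin: "finite {d. d dvd n}"
    using n0 by simp
  have "cmod (1 - z ^ n) = cyc_abs n z * (\<Prod>d\<in>{d. d dvd n} - {n}. cyc_abs d z)"
    unfolding prod_cyc_abs[OF n0, symmetric] using fin by (intro prod.remove) auto
  also have "(\<Prod>d\<in>{d. d dvd n} - {n}. cyc_abs d z) \<le> ?M ^ card ({d. d dvd n} - {n})"
    unfolding prod_constant[symmetric] using le by (intro prod_mono) (auto simp: cyc_abs_def)
  also have "\<dots> \<le> ?M ^ num_divisors n"
  proof (rule power_increasing)
    show "card ({d. d dvd n} - {n}) \<le> num_divisors n"
      unfolding num_divisors_def using fin by (intro card_mono) auto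
    show "1 \<le> ?M"
      using M by linarith
  qed
  finally show ?thesis
    by (simp add: cyc_abs_def mult_left_mono)
qed

lemma sqrt_power_eq_exp: "n > 0 \<Longrightarrow> sqrt (real n ^ d) = exp (real d * ln (real n) / 2)"
proof -
  assume n: "n > 0"
  have "exp (real d * ln (real n) / 2) ^ 2 = exp (real d * ln (real n))"
    by (simp add: exp_double[symmetric])
  also have "\<dots> = real n ^ d"
    using n by (simp add: exp_of_nat_mult)
  finally show ?thesis
    by (intro real_sqrt_unique) auto
qed

lemma powr_minus_antimono:
  fixes x y a :: real
  assumes "0 < x" "x \<le> y" "a \<ge> 0"
  shows "y powr (- a) \<le> x powr (- a)"
  using assms by (intro powr_mono2') auto

text \<open>Positivity of \<open>cyc_abs n z\<close> excludes the junk value \<open>0 powr _ = 0\<close>, which would break the lower bound.\<close>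

lemma cyc_abs_powr_ge:
  assumes n: "n \<ge> 2" and z: "cmod z \<le> 1" and nz: "cyc_abs n z > 0"
  shows "exp (- (2 * real (num_divisors n) * ln (real n) / real (totient n))) \<le>
    cyc_abs n z powr (- (4 / real (totient n)))"
proof -
  have n0: "n > 0"
    using n by simp
  have "cyc_abs n z \<le> exp (real (num_divisors n) * ln (real n) / 2)"
    using cyc_abs_le_length[OF n0 z] cyclotomic_length_le[OF n] unfolding sqrt_power_eq_exp[OF n0] by linarith
  then have less: "exp (real (num_divisors n) * ln (real n) / 2) powr (- (4 / real (totient n))) \<le>
      cyc_abs n z powr (- (4 / real (totient n)))"
    using nz by (intro powr_minus_antimono) auto
  have "exp (real (num_divisors n) * ln (real n) / 2) powr (- (4 / real (totient n))) =
      exp (- (2 * real (num_divisors n) * ln (real n) / real (totient n)))"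
    by (simp add: powr_def)
  with less show ?thesis
    by (simp only:)
qed

lemma cyc_abs_powr_gt:
  assumes n: "n \<ge> 2" and z: "cmod z < 1" and nz: "cyc_abs n z > 0"
  shows "exp (- (2 * real (num_divisors n) * ln (real n) / real (totient n))) <
    cyc_abs n z powr (- (4 / real (totient n)))"
proof -
  have n0: "n > 0"
    using n by simp
  have "cyc_abs n z < exp (real (num_divisors n) * ln (real n) / 2)"
    using cyc_abs_less_length[OF n0 z] cyclotomic_length_le[OF n] unfolding sqrt_power_eq_exp[OF n0] by linarith
  then have less: "exp (real (num_divisors n) * ln (real n) / 2) powr (- (4 / real (totient n))) <
      cyc_abs n z powr (- (4 / real (totient n)))"
    using nz n0 by (intro powr_less_mono2_neg) auto
  have "exp (real (num_divisors n) * ln (real n) / 2) powr (- (4 / real (totient n))) =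
      exp (- (2 * real (num_divisors n) * ln (real n) / real (totient n)))"
    by (simp add: powr_def)
  with less show ?thesis
    by (simp only:)
qed

text \<open>The lower bound \<open>c\<close> is left open to serve two places:
  \<open>1 - w^n\<close> on the radii and \<open>2 |sin (n s / 2)|\<close> on the circle. Its
  positivity keeps the roots of unity, where \<open>powr\<close> would give 0, out of the
  estimate.\<close>

lemma cyc_abs_powr_le:
  assumes n: "n \<ge> 4" and z: "cmod z \<le> 1" and c: "0 < c" "c \<le> cmod (1 - z ^ n)"
  shows "cyc_abs n z powr (- (4 / real (totient n))) \<le>
    exp (2 * real (num_divisors n) ^ 2 * ln (real n) / real (totient n)) * c powr (- (4 / real (totient n)))"
proof -
  let ?D = "real (num_divisors n)" and ?a = "4 / real (totient n)"
  have n0: "n > 0"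
    using n by simp
  define E where "E = exp (?D * ln (real n) / 2) ^ num_divisors n"
  have E: "E > 0"
    by (simp add: E_def)
  have "c \<le> cyc_abs n z * E"
    using cyc_abs_ge[OF n z] c unfolding sqrt_power_eq_exp[OF n0] E_def by linarith
  then have "c / E \<le> cyc_abs n z"
    using E by (simp add: field_simps)
  then have "cyc_abs n z powr (- ?a) \<le> (c / E) powr (- ?a)"
    using c(1) E by (intro powr_minus_antimono) auto
  also have "\<dots> = E powr ?a * c powr (- ?a)"
    using c(1) E by (simp add: powr_divide powr_minus field_simps)
  also have "E powr ?a = exp (2 * ?D ^ 2 * ln (real n) / real (totient n))"
    unfolding E_def by (simp add: exp_of_nat_mult[symmetric] powr_def power2_eq_square field_simps)
  finally show ?thesis .
qed

lemma cyc_abs_pos: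
  assumes "n > 0" "z ^ n \<noteq> 1"
  shows "cyc_abs n z > 0"
proof -
  have "(\<Prod>d | d dvd n. cyc_abs d z) \<noteq> 0"
    unfolding prod_cyc_abs[OF assms(1)] using assms(2) by simp
  then have "cyc_abs n z \<noteq> 0"
    using assms(1) by (auto simp: prod_zero_iff)
  then show ?thesis
    by (simp add: cyc_abs_def)
qed

lemma cmod_1_minus_cis_power: "cmod (1 - cis s ^ n) = 2 * \<bar>sin (real n * s / 2)\<bar>"
proof -
  have "cis s ^ n = exp (\<i> * complex_of_real (real n * s))"
    unfolding Complex.DeMoivre by (rule cis_conv_exp)
  then show ?thesis
    using dist_exp_i_1[of "real n * s"] by (simp add: norm_minus_commute)
qed

lemma AE_sin_nonzero:
  assumes c: "c \<noteq> (0 :: real)"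
  shows "AE s in lborel. sin (c * s) \<noteq> 0"
proof -
  have "{s. sin (c * s) = 0} \<subseteq> range (\<lambda>i::int. of_int i * pi / c)"
  proof
    fix s assume "s \<in> {s. sin (c * s) = 0}"
    then obtain i :: int where "c * s = of_int i * pi"
      by (auto simp: sin_zero_iff_int2)
    with c have "s = of_int i * pi / c"
      by (simp add: field_simps)
    then show "s \<in> range (\<lambda>i::int. of_int i * pi / c)"
      by blast
  qed
  then have "countable {s. sin (c * s) = 0}"
    by (rule countable_subset) simp
  from AE_not_in[OF countable_imp_null_set_lborel[OF this]] show ?thesis
    by simp
qed

section \<open>Beta integrals\<close>

lemma Beta_real_nonneg: "x > 0 \<Longrightarrow> y > 0 \<Longrightarrow> Beta x y \<ge> (0 :: real)"
  by (rule has_integral_nonneg[OF has_integral_Beta_real]) auto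

text \<open>Substituting \<open>u = w^n\<close> leaves \<open>u powr ((k + 1)/n - 1)\<close> and the
  factor \<open>1/n\<close>. The cases \<open>k = 0\<close> and \<open>k = 2\<close> produce the
  arguments \<open>1/n\<close> and \<open>3/n\<close> of the final bound from the weight
  \<open>1 - w^2\<close>.\<close>

lemma nn_integral_power_geom:
  assumes n: "n > 0" and a: "a < 1"
  shows "(\<integral>\<^sup>+w. ennreal (w ^ k * (1 - w ^ n) powr (- a)) * indicator {0<..<1} w \<partial>lborel) =
    ennreal (1 / real n * Beta (real (Suc k) / real n) (1 - a))"
proof -
  define c where "c = real (Suc k) / real n"
  have c: "c > 0"
    using n by (simp add: c_def)
  define f where "f u = 1 / real n * (u powr (c - 1) * (1 - u) powr (- a))" for u :: real
  have "((\<lambda>u. u powr (c - 1) * (1 - u) powr (- a)) has_integral Beta c (1 - a)) {0<..<1}"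
    using has_integral_Beta_real[of c "1 - a"] c a by (simp add: has_integral_Icc_iff_Ioo)
  then have "(f has_integral 1 / real n * Beta c (1 - a)) {0<..<1}"
    unfolding f_def by (rule has_integral_mult_right)
  then have *: "(\<integral>\<^sup>+u. ennreal (f u) * indicator {0<..<1} u \<partial>lborel) = ennreal (1 / real n * Beta c (1 - a))"
    by (rule nn_integral_has_integral_lebesgue'[rotated]) (simp add: f_def)
  have im: "{0<..<1} = (\<lambda>w::real. w ^ n) ` {0<..<1}"
  proof (intro equalityI subsetI)
    fix u :: real assume u: "u \<in> {0<..<1}"
    show "u \<in> (\<lambda>w. w ^ n) ` {0<..<1}"
      using u n by (intro image_eqI[of _ _ "root n u"]) auto
  next
    fix u :: real assume "u \<in> (\<lambda>w. w ^ n) ` {0<..<1}"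
    then show "u \<in> {0<..<1}"
      using n by (auto simp: power_less_one_iff)
  qed
  have "(\<integral>\<^sup>+u. ennreal (f u) * indicator ((\<lambda>w. w ^ n) ` {0<..<1}) u \<partial>lborel) =
      (\<integral>\<^sup>+w. ennreal (\<bar>real n * w ^ (n - 1)\<bar> * f (w ^ n)) * indicator {0<..<1} w \<partial>lborel)"
  proof (rule nn_integral_change_of_variables)
    show "((\<lambda>w. w ^ n) has_field_derivative real n * x ^ (n - 1)) (at x within {0<..<1})" for x :: real
      by (auto intro!: derivative_eq_intros)
    show "inj_on (\<lambda>w::real. w ^ n) {0<..<1}"
      using n by (auto intro!: inj_onI dest: power_eq_imp_eq_base)
    show "f \<in> borel_measurable borel"
      unfolding f_def by measurable
  qed (simp_all add: im[symmetric] f_def)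
  also have "\<dots> = (\<integral>\<^sup>+w. ennreal (w ^ k * (1 - w ^ n) powr (- a)) * indicator {0<..<1} w \<partial>lborel)"
  proof (rule nn_set_integral_cong)
    fix w :: real assume w: "w \<in> {0<..<1}"
    have "w ^ (n - 1) * (w ^ n) powr (c - 1) = w powr real (n - 1) * (w powr real n) powr (c - 1)"
      using w by (simp add: powr_realpow)
    also have "\<dots> = w powr (real (n - 1) + real n * (c - 1))"
      by (simp add: powr_powr powr_add)
    also have "real (n - 1) + real n * (c - 1) = real k"
      using n by (simp add: c_def of_nat_diff field_simps)
    finally have "w ^ (n - 1) * (w ^ n) powr (c - 1) = w ^ k"
      using w by (simp add: powr_realpow)
    moreover have "\<bar>real n * w ^ (n - 1)\<bar> * f (w ^ n) =
        (w ^ (n - 1) * (w ^ n) powr (c - 1)) * (1 - w ^ n) powr (- a)"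
      using n w by (simp add: f_def abs_mult)
    ultimately show "ennreal (\<bar>real n * w ^ (n - 1)\<bar> * f (w ^ n)) = ennreal (w ^ k * (1 - w ^ n) powr (- a))"
      by simp
  qed
  finally show ?thesis
    unfolding im[symmetric] * by (simp only: c_def)
qed

text \<open>Subtraction on \<open>ennreal\<close> truncates, so the integral with weight
  \<open>w^2\<close> is added to both sides and cancelled afterwards, which its finiteness permits.
  Monotonicity of Beta in the first argument gives \<open>d \<ge> 0\<close>.\<close>

lemma nn_integral_outer_bound:
  assumes n: "n > 0" and a: "a < 1"
  defines "d \<equiv> 1 / real n * Beta (1 / real n) (1 - a) - 1 / real n * Beta (3 / real n) (1 - a)"
  shows "(\<integral>\<^sup>+w. ennreal ((1 - w\<^sup>2) * (1 - w ^ n) powr (- a)) * indicator {0<..<1} w \<partial>lborel) = ennreal d"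
    and "d \<ge> 0"
proof -
  let ?I = "\<integral>\<^sup>+w. ennreal ((1 - w\<^sup>2) * (1 - w ^ n) powr (- a)) * indicator {0<..<1} w \<partial>lborel"
  let ?x = "1 / real n * Beta (1 / real n) (1 - a)" and ?y = "1 / real n * Beta (3 / real n) (1 - a)"
  have "Beta (3 / real n) (1 - a) \<le> Beta (1 / real n) (1 - a)"
    using n a by (intro Beta_real_mono) (auto simp: divide_right_mono)
  then show d: "d \<ge> 0"
    unfolding d_def by (simp add: divide_right_mono)
  have "Beta (3 / real n) (1 - a) \<ge> 0"
    using n a by (intro Beta_real_nonneg) auto
  then have y: "?y \<ge> 0"
    by simp
  have "?I + ennreal ?y = (\<integral>\<^sup>+w. ennreal ((1 - w\<^sup>2) * (1 - w ^ n) powr (- a)) * indicator {0<..<1} w +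
      ennreal (w ^ 2 * (1 - w ^ n) powr (- a)) * indicator {0<..<1} w \<partial>lborel)"
    using nn_integral_power_geom[OF n a, of 2] by (subst nn_integral_add) auto
  also have "\<dots> = (\<integral>\<^sup>+w. ennreal (w ^ 0 * (1 - w ^ n) powr (- a)) * indicator {0<..<1} w \<partial>lborel)"
  proof (intro nn_integral_cong)
    fix w :: real
    have "ennreal ((1 - w\<^sup>2) * (1 - w ^ n) powr (- a)) + ennreal (w ^ 2 * (1 - w ^ n) powr (- a)) =
        ennreal (w ^ 0 * (1 - w ^ n) powr (- a))" if "w \<in> {0<..<1}"
    proof -
      have "w\<^sup>2 \<le> 1"
        using that by (auto intro: power_le_one)
      then show ?thesis
        by (subst ennreal_plus[symmetric]) (simp_all add: algebra_simps mult_left_le_one_le)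
    qed
    then show "ennreal ((1 - w\<^sup>2) * (1 - w ^ n) powr (- a)) * indicator {0<..<1} w +
        ennreal (w ^ 2 * (1 - w ^ n) powr (- a)) * indicator {0<..<1} w =
        ennreal (w ^ 0 * (1 - w ^ n) powr (- a)) * indicator {0<..<1} w"
      by (cases "w \<in> {0<..<1}") (simp_all only: indicator_simps mult_1_right, simp)
  qed
  also have "\<dots> = ennreal ?x"
    using nn_integral_power_geom[OF n a, of 0] by simp
  also have "\<dots> = ennreal d + ennreal ?y"
    using d y by (subst ennreal_plus[symmetric]) (auto simp: d_def)
  finally have "ennreal ?y + ?I = ennreal ?y + ennreal d"
    by (simp only: add.commute)
  then show "?I = ennreal d"
    by (simp only: ennreal_add_left_cancel) simp
qed

lemma sin_cos_bounds_first_quadrant: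
  fixes u :: real
  assumes "u \<in> {0<..<pi/2}"
  shows "0 < sin u" "0 < cos u" "cos u < 1"
proof -
  show s: "0 < sin u" and c: "0 < cos u"
    using assms sin_gt_zero2[of u] cos_gt_zero[of u] by auto
  have "(sin u)\<^sup>2 + (cos u)\<^sup>2 = 1"
    by simp
  moreover have "(sin u)\<^sup>2 > 0"
    using s by simp
  ultimately have "(cos u)\<^sup>2 < 1\<^sup>2"
    unfolding one_power2 by linarith
  then show "cos u < 1"
    by (rule power2_less_imp_less) simp
qed

lemma image_cos_squared: "(\<lambda>u. (cos u)\<^sup>2) ` {0<..<pi/2} = {0<..<1}"
proof (intro equalityI subsetI)
  fix t :: real assume t: "t \<in> {0<..<1}"
  then have q: "0 < sqrt t" "sqrt t < 1"
    by auto
  then have q': "- 1 \<le> sqrt t" "sqrt t \<le> 1"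
    by linarith+
  show "t \<in> (\<lambda>u. (cos u)\<^sup>2) ` {0<..<pi/2}"
  proof (rule image_eqI)
    show "t = (cos (arccos (sqrt t)))\<^sup>2"
      unfolding cos_arccos[OF q'] using t by simp
    have "arccos (sqrt t) < arccos 0" "arccos 1 < arccos (sqrt t)"
      using q q' by (intro arccos_less_arccos; simp)+
    then show "arccos (sqrt t) \<in> {0<..<pi/2}"
      by simp
  qed
next
  fix t :: real assume "t \<in> (\<lambda>u. (cos u)\<^sup>2) ` {0<..<pi/2}"
  then obtain u where u: "u \<in> {0<..<pi/2}" "t = (cos u)\<^sup>2"
    by blast
  from sin_cos_bounds_first_quadrant[OF u(1)] show "t \<in> {0<..<1}"
    using power_less_one_iff[of "cos u" 2] by (simp add: u(2))
qed

lemma inj_on_cos_squared: "inj_on (\<lambda>u. (cos u)\<^sup>2) {0<..<pi/2}"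
proof (rule inj_onI)
  fix x y assume xy: "x \<in> {0<..<pi/2}" "y \<in> {0<..<pi/2}" and eq: "(cos x)\<^sup>2 = (cos y)\<^sup>2"
  have "cos x \<ge> 0" "cos y \<ge> 0"
    using xy[THEN sin_cos_bounds_first_quadrant(2)] by simp_all
  with eq have "cos x = cos y"
    by (rule power2_eq_imp_eq)
  show "x = y"
    by (rule cos_inj_pi) (use xy \<open>cos x = cos y\<close> in simp_all)
qed

lemma cos_squared_substitution:
  assumes "u \<in> {0<..<pi/2}"
  shows "\<bar>- (2 * cos u * sin u)\<bar> * (1 / 2 * ((cos u)\<^sup>2 powr (1 / 2 - 1) *
    (1 - (cos u)\<^sup>2) powr (1 / 2 - a / 2 - 1))) = \<bar>sin u\<bar> powr (- a)"
proof -
  note u = sin_cos_bounds_first_quadrant[OF assms]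
  have c2: "(cos u)\<^sup>2 = cos u powr 2" and s2: "1 - (cos u)\<^sup>2 = sin u powr 2"
    using u sin_squared_eq[of u] by simp_all
  have "(cos u)\<^sup>2 powr (1 / 2 - 1) = cos u powr (2 * (1 / 2 - 1))"
    unfolding c2 powr_powr ..
  also have "\<dots> = cos u powr (- 1)"
    by simp
  finally have 1: "(cos u)\<^sup>2 powr (1 / 2 - 1) = 1 / cos u"
    using u by (simp add: powr_minus_divide)
  have "(1 - (cos u)\<^sup>2) powr (1 / 2 - a / 2 - 1) = sin u powr (2 * (1 / 2 - a / 2 - 1))"
    unfolding s2 powr_powr ..
  also have "2 * (1 / 2 - a / 2 - 1) = - a - 1"
    by (simp add: field_simps)
  also have "sin u powr (- a - 1) = sin u powr (- a) / sin u"
    using u by (simp add: powr_diff)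
  finally have 2: "(1 - (cos u)\<^sup>2) powr (1 / 2 - a / 2 - 1) = sin u powr (- a) / sin u" .
  show ?thesis
    unfolding 1 2 using u by (simp add: abs_mult)
qed

text \<open>Under \<open>t = (cos u)^2\<close> the factor \<open>t powr (-1/2)\<close> cancels the
  cosine of the Jacobian, and the power of \<open>1 - t = (sin u)^2\<close> combines with its sine
  to \<open>sin u powr (-a)\<close>.\<close>

lemma nn_integral_sin_powr_quarter:
  assumes a: "0 \<le> a" "a < 1"
  shows "(\<integral>\<^sup>+u. ennreal (\<bar>sin u\<bar> powr (- a)) * indicator {0<..<pi/2} u \<partial>lborel) =
    ennreal (1 / 2 * Beta (1 / 2) (1 / 2 - a / 2))"
proof -
  define f where "f t = 1 / 2 * (t powr (1 / 2 - 1) * (1 - t) powr (1 / 2 - a / 2 - 1))" for t :: real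
  have "((\<lambda>t. t powr (1 / 2 - 1) * (1 - t) powr (1 / 2 - a / 2 - 1)) has_integral
      Beta (1 / 2) (1 / 2 - a / 2)) {0<..<1}"
    using has_integral_Beta_real[of "1 / 2" "1 / 2 - a / 2"] a by (simp add: has_integral_Icc_iff_Ioo)
  then have "(f has_integral 1 / 2 * Beta (1 / 2) (1 / 2 - a / 2)) {0<..<1}"
    unfolding f_def by (rule has_integral_mult_right)
  then have "ennreal (1 / 2 * Beta (1 / 2) (1 / 2 - a / 2)) =
      (\<integral>\<^sup>+t. ennreal (f t) * indicator {0<..<1} t \<partial>lborel)"
    by (rule nn_integral_has_integral_lebesgue'[rotated, symmetric]) (simp add: f_def)
  also have "\<dots> = (\<integral>\<^sup>+t. ennreal (f t) * indicator ((\<lambda>u. (cos u)\<^sup>2) ` {0<..<pi/2}) t \<partial>lborel)"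
    unfolding image_cos_squared ..
  also have "\<dots> = (\<integral>\<^sup>+u. ennreal (\<bar>- (2 * cos u * sin u)\<bar> * f ((cos u)\<^sup>2)) * indicator {0<..<pi/2} u \<partial>lborel)"
  proof (rule nn_integral_change_of_variables)
    show "((\<lambda>u. (cos u)\<^sup>2) has_field_derivative - (2 * cos x * sin x)) (at x within {0<..<pi/2})" for x
      by (auto intro!: derivative_eq_intros)
    show "f \<in> borel_measurable borel"
      unfolding f_def by measurable
    show "(\<lambda>u. (cos u)\<^sup>2) ` {0<..<pi/2} \<in> sets borel"
      unfolding image_cos_squared by simp
  qed (simp_all add: inj_on_cos_squared f_def)
  also have "\<dots> = (\<integral>\<^sup>+u. ennreal (\<bar>sin u\<bar> powr (- a)) * indicator {0<..<pi/2} u \<partial>lborel)"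
    unfolding f_def by (rule nn_set_integral_cong) (simp only: cos_squared_substitution)
  finally show ?thesis ..
qed

lemma abs_sin_add_pi_half_multiple:
  "even j \<Longrightarrow> \<bar>sin (real j * (pi / 2) + v)\<bar> = \<bar>sin v\<bar>"
proof (elim evenE)
  fix m assume "j = 2 * m"
  then have "real j * (pi / 2) + v = v + real m * pi"
    by simp
  then show ?thesis
    by (simp add: sin_add sin_npi cos_npi abs_mult)
qed

text \<open>On an even quarter period \<open>|sin|\<close> is a translate of its first quarter; on
  an odd one it is a reflection, taken at the right end point, which is a multiple of
  \<open>pi\<close>.\<close>

lemma nn_integral_sin_powr_piece:
  assumes a: "0 \<le> a" "a < 1"
  shows "(\<integral>\<^sup>+u. ennreal (\<bar>sin u\<bar> powr (- a)) * indicator {real j * (pi / 2)<..<real (Suc j) * (pi / 2)} u \<partial>lborel) =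
    ennreal (1 / 2 * Beta (1 / 2) (1 / 2 - a / 2))"
proof (cases "even j")
  case True
  have "(\<integral>\<^sup>+u. ennreal (\<bar>sin u\<bar> powr (- a)) * indicator {real j * (pi / 2)<..<real (Suc j) * (pi / 2)} u \<partial>lborel) =
      \<bar>1::real\<bar> * (\<integral>\<^sup>+v. ennreal (\<bar>sin (real j * (pi / 2) + 1 * v)\<bar> powr (- a)) *
        indicator {real j * (pi / 2)<..<real (Suc j) * (pi / 2)} (real j * (pi / 2) + 1 * v) \<partial>lborel)"
    by (rule nn_integral_real_affine) auto
  also have "\<dots> = (\<integral>\<^sup>+v. ennreal (\<bar>sin v\<bar> powr (- a)) * indicator {0<..<pi/2} v \<partial>lborel)"
    using abs_sin_add_pi_half_multiple[OF True]
    by (simp, intro nn_integral_cong) (auto split: split_indicator simp: field_simps)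
  finally show ?thesis
    using nn_integral_sin_powr_quarter[OF a] by simp
next
  case False
  then have ev: "even (Suc j)"
    by simp
  have "(\<integral>\<^sup>+u. ennreal (\<bar>sin u\<bar> powr (- a)) * indicator {real j * (pi / 2)<..<real (Suc j) * (pi / 2)} u \<partial>lborel) =
      \<bar>- 1::real\<bar> * (\<integral>\<^sup>+v. ennreal (\<bar>sin (real (Suc j) * (pi / 2) + - 1 * v)\<bar> powr (- a)) *
        indicator {real j * (pi / 2)<..<real (Suc j) * (pi / 2)} (real (Suc j) * (pi / 2) + - 1 * v) \<partial>lborel)"
    by (rule nn_integral_real_affine) auto
  also have "\<dots> = (\<integral>\<^sup>+v. ennreal (\<bar>sin v\<bar> powr (- a)) * indicator {0<..<pi/2} v \<partial>lborel)"
  proof -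
    have "\<bar>sin (real (Suc j) * (pi / 2) + - 1 * v)\<bar> = \<bar>sin v\<bar>" for v
      using abs_sin_add_pi_half_multiple[OF ev, of "- v"] by simp
    moreover have "(indicator {real j * (pi / 2)<..<real (Suc j) * (pi / 2)} (real (Suc j) * (pi / 2) + - 1 * v) :: ennreal) =
        indicator {0<..<pi/2} v" for v
      by (auto split: split_indicator simp: field_simps)
    ultimately show ?thesis
      by simp
  qed
  finally show ?thesis
    using nn_integral_sin_powr_quarter[OF a] by simp
qed

lemma nn_integral_sin_powr_multiple:
  assumes a: "0 \<le> a" "a < 1"
  shows "(\<integral>\<^sup>+u. ennreal (\<bar>sin u\<bar> powr (- a)) * indicator {0<..<real n * (pi / 2)} u \<partial>lborel) =
    of_nat n * ennreal (1 / 2 * Beta (1 / 2) (1 / 2 - a / 2))"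
proof (induction n)
  case (Suc n)
  let ?f = "\<lambda>u. ennreal (\<bar>sin u\<bar> powr (- a))"
  have lt: "real n * (pi / 2) < real (Suc n) * (pi / 2)" "0 \<le> real n * (pi / 2)"
    by (auto simp: field_simps)
  have "(\<integral>\<^sup>+u. ?f u * indicator {0<..<real (Suc n) * (pi / 2)} u \<partial>lborel) =
      (\<integral>\<^sup>+u. ?f u * indicator {0<..<real n * (pi / 2)} u +
        ?f u * indicator {real n * (pi / 2)<..<real (Suc n) * (pi / 2)} u \<partial>lborel)"
  proof (rule nn_integral_cong_AE)
    show "AE u in lborel. ?f u * indicator {0<..<real (Suc n) * (pi / 2)} u =
        ?f u * indicator {0<..<real n * (pi / 2)} u +
        ?f u * indicator {real n * (pi / 2)<..<real (Suc n) * (pi / 2)} u"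
      using AE_lborel_singleton[of "real n * (pi / 2)"]
    proof eventually_elim
      case (elim u)
      have "x * indicator {0<..<B} u = x * indicator {0<..<A} u + x * indicator {A<..<B} u"
        if "0 \<le> A" "A < B" "u \<noteq> A" for A B :: real and x :: ennreal
        using that by (auto split: split_indicator)
      with lt elim show ?case
        by blast
    qed
  qed
  also have "\<dots> = of_nat n * ennreal (1 / 2 * Beta (1 / 2) (1 / 2 - a / 2)) +
      ennreal (1 / 2 * Beta (1 / 2) (1 / 2 - a / 2))"
    using nn_integral_sin_powr_piece[OF a] Suc by (subst nn_integral_add) auto
  finally show ?case
    by (simp add: distrib_right add.commute)
qed simp

text \<open>The map \<open>s \<mapsto> n s / 2\<close> spreads \<open>(0, pi)\<close> over
  \<open>n\<close> quarter periods, and the Jacobian \<open>n / 2\<close> cancels their number; the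
  value is therefore independent of \<open>n\<close>.\<close>

lemma nn_integral_sin_powr:
  assumes a: "0 \<le> a" "a < 1" and n: "n > 0"
  shows "(\<integral>\<^sup>+s. ennreal (\<bar>sin (real n * s / 2)\<bar> powr (- a)) * indicator {0<..<pi} s \<partial>lborel) =
    ennreal (Beta (1 / 2) (1 / 2 - a / 2))"
proof -
  let ?I = "\<integral>\<^sup>+s. ennreal (\<bar>sin (real n * s / 2)\<bar> powr (- a)) * indicator {0<..<pi} s \<partial>lborel"
  let ?B = "Beta (1 / 2) (1 / 2 - a / 2)"
  have B: "?B \<ge> 0"
    using a by (simp add: Beta_def Gamma_real_pos less_imp_le)
  have "(\<integral>\<^sup>+u. ennreal (\<bar>sin u\<bar> powr (- a)) * indicator {0<..<real n * (pi / 2)} u \<partial>lborel) =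
      \<bar>real n / 2\<bar> * (\<integral>\<^sup>+s. ennreal (\<bar>sin (0 + real n / 2 * s)\<bar> powr (- a)) *
        indicator {0<..<real n * (pi / 2)} (0 + real n / 2 * s) \<partial>lborel)"
    using n by (intro nn_integral_real_affine) auto
  also have "(\<lambda>s. indicator {0<..<real n * (pi / 2)} (0 + real n / 2 * s) :: ennreal) = indicator {0<..<pi}"
  proof
    fix s
    have "real n / 2 * s < real n / 2 * pi \<longleftrightarrow> s < pi" "real n / 2 * 0 < real n / 2 * s \<longleftrightarrow> 0 < s"
      using n by (intro mult_less_cancel_left_pos; simp)+
    then show "indicator {0<..<real n * (pi / 2)} (0 + real n / 2 * s) = (indicator {0<..<pi} s :: ennreal)"
      by (simp add: indicator_def)
  qed
  finally have "ennreal (real n / 2) * ?I = of_nat n * ennreal (1 / 2 * ?B)"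
    unfolding nn_integral_sin_powr_multiple[OF a] by (simp add: fun_eq_iff)
  also have "\<dots> = ennreal (real n / 2) * ennreal ?B"
    using B by (simp add: ennreal_of_nat_eq_real_of_nat ennreal_mult[symmetric] field_simps)
  finally show ?thesis
    using n by (simp add: ennreal_mult_cancel_left)
qed

section \<open>Lower bound for the area\<close>

lemma nn_set_integral_mono_AE:
  fixes f g :: "_ \<Rightarrow> ennreal"
  assumes "AE x in M. x \<in> S \<longrightarrow> f x \<le> g x"
  shows "(\<integral>\<^sup>+x. f x * indicator S x \<partial>M) \<le> (\<integral>\<^sup>+x. g x * indicator S x \<partial>M)"
  using assms by (intro nn_integral_mono_AE) (auto elim!: eventually_mono split: split_indicator)

lemma nn_integral_1_minus_sq:
  "(\<integral>\<^sup>+w. ennreal (1 - w\<^sup>2) * indicator {0<..<1::real} w \<partial>lborel) = ennreal (2 / 3)"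
proof (rule nn_integral_has_integral_lebesgue')
  have "((\<lambda>w::real. 1 - w\<^sup>2) has_integral ((1 - 1 ^ 3 / 3) - (0 - 0 ^ 3 / 3))) {0..1}"
    by (intro fundamental_theorem_of_calculus)
      (auto intro!: derivative_eq_intros simp flip: has_real_derivative_iff_has_vector_derivative)
  then show "((\<lambda>w::real. 1 - w\<^sup>2) has_integral 2 / 3) {0<..<1}"
    by (simp add: has_integral_Icc_iff_Ioo)
qed (simp add: power_le_one)

lemma nn_integral_sin:
  "(\<integral>\<^sup>+s. ennreal (2 * sin s) * indicator {0<..<pi} s \<partial>lborel) = ennreal 4"
proof (rule nn_integral_has_integral_lebesgue')
  have "((\<lambda>s. 2 * sin s) has_integral (- 2 * cos pi - - 2 * cos 0)) {0..pi}"
    by (intro fundamental_theorem_of_calculus)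
      (auto intro!: derivative_eq_intros simp flip: has_real_derivative_iff_has_vector_derivative)
  then show "((\<lambda>s. 2 * sin s) has_integral 4) {0<..<pi}"
    by (simp add: has_integral_Icc_iff_Ioo)
qed (simp add: sin_ge_zero)

lemma nn_integral_1_minus_sin:
  "(\<integral>\<^sup>+s. ennreal (2 * (1 - sin s)) * indicator {0<..<pi} s \<partial>lborel) = ennreal (2 * pi - 4)"
proof (rule nn_integral_has_integral_lebesgue')
  have "((\<lambda>s. 2 * (1 - sin s)) has_integral (2 * (pi + cos pi) - 2 * (0 + cos 0))) {0..pi}"
    by (intro fundamental_theorem_of_calculus)
      (auto intro!: derivative_eq_intros simp flip: has_real_derivative_iff_has_vector_derivative)
  then show "((\<lambda>s. 2 * (1 - sin s)) has_integral 2 * pi - 4) {0<..<pi}"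
    by (simp add: has_integral_Icc_iff_Ioo algebra_simps)
qed simp

lemma cis_power_eq_1_imp_sin: "cis s ^ n = 1 \<Longrightarrow> sin (real n / 2 * s) = 0"
  using cmod_1_minus_cis_power[of s n] by (simp add: mult.commute)

lemma power_neq_1_in_disc: "cmod z < 1 \<Longrightarrow> n > 0 \<Longrightarrow> z ^ n \<noteq> 1"
  by (metis less_irrefl norm_one norm_power power_less_one_iff norm_ge_zero)

text \<open>\<open>g\<close> covers the positive and the negative radius at once. The comparison of
  integrands is strict at every point of an interval of positive measure, and the smaller integral
  is finite, so strictness passes to the integrals.\<close>

lemma outer_integral_gt:
  assumes n: "n \<ge> 4" and g: "\<And>w. g w = cyc_abs n (complex_of_real w) \<or> g w = cyc_abs n (- complex_of_real w)"
    and meas [measurable]: "g \<in> borel_measurable borel"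
  shows "ennreal (2 / 3 * exp (- (2 * real (num_divisors n) * ln (real n) / real (totient n)))) <
    (\<integral>\<^sup>+w. ennreal ((1 - w\<^sup>2) * g w powr (- (4 / real (totient n)))) * indicator {0<..<1} w \<partial>lborel)"
proof -
  let ?e = "exp (- (2 * real (num_divisors n) * ln (real n) / real (totient n)))"
  let ?f = "\<lambda>w. ennreal ((1 - w\<^sup>2) * ?e) * indicator {0<..<1} w"
  let ?g = "\<lambda>w. ennreal ((1 - w\<^sup>2) * g w powr (- (4 / real (totient n)))) * indicator {0<..<1} w"
  have less: "ennreal ((1 - w\<^sup>2) * ?e) < ennreal ((1 - w\<^sup>2) * g w powr (- (4 / real (totient n))))"
    if w: "w \<in> {0<..<1}" for w
  proof -
    obtain z where z: "g w = cyc_abs n z" "cmod z < 1"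
      using g[of w] w by (metis abs_of_pos greaterThanLessThan_iff norm_minus_cancel norm_of_real)
    have "?e < g w powr (- (4 / real (totient n)))"
      unfolding z(1) using n z(2) by (intro cyc_abs_powr_gt cyc_abs_pos power_neq_1_in_disc) auto
    moreover have "1 - w\<^sup>2 > 0"
      using w by (simp add: power_less_one_iff)
    ultimately show ?thesis
      by (intro ennreal_lessI mult_strict_left_mono mult_pos_pos) (auto intro: less_trans[OF exp_gt_zero])
  qed
  have "(\<integral>\<^sup>+w. ?f w \<partial>lborel) = (\<integral>\<^sup>+w. ennreal ?e * (ennreal (1 - w\<^sup>2) * indicator {0<..<1} w) \<partial>lborel)"
    by (intro nn_integral_cong) (simp only: ennreal_mult''[OF exp_ge_zero] ac_simps)
  also have "\<dots> = ennreal ?e * ennreal (2 / 3)"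
    by (subst nn_integral_cmult) (auto simp: nn_integral_1_minus_sq)
  also have "\<dots> = ennreal (2 / 3 * ?e)"
    by (simp only: ennreal_mult''[OF exp_ge_zero] ac_simps)
  finally have val: "(\<integral>\<^sup>+w. ?f w \<partial>lborel) = ennreal (2 / 3 * ?e)" .
  have "(\<integral>\<^sup>+w. ?f w \<partial>lborel) < (\<integral>\<^sup>+w. ?g w \<partial>lborel)"
  proof (rule nn_integral_less)
    show "(\<integral>\<^sup>+w. ?f w \<partial>lborel) \<noteq> \<infinity>"
      unfolding val by simp
    show "AE w in lborel. ?f w \<le> ?g w"
      using less by (intro AE_I2) (auto split: split_indicator intro: less_imp_le)
    show "\<not> (AE w in lborel. ?g w \<le> ?f w)"
    proof
      assume "AE w in lborel. ?g w \<le> ?f w"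
      then have "AE w in lborel. w \<notin> {0<..<1::real}"
      proof eventually_elim
        case (elim w)
        show ?case
        proof
          assume w: "w \<in> {0<..<1}"
          with elim have "\<not> ennreal ((1 - w\<^sup>2) * ?e) < ennreal ((1 - w\<^sup>2) * g w powr (- (4 / real (totient n))))"
            by (simp only: indicator_simps mult_1_right not_less)
          with less[OF w] show False
            by contradiction
        qed
      qed
      then have "emeasure lborel {0<..<1::real} = 0"
        by (subst (asm) AE_iff_measurable[where N = "{0<..<1}"]) auto
      then show False
        by simp
    qed
  qed measurable
  then show ?thesis
    unfolding val .
qed

text \<open>The comparison holds off the \<open>n\<close>-th roots of unity only, hence almost
  everywhere. Strictness is not asked for on the circle, since the radii supply it.\<close>

lemma inner_integral_ge:
  assumes n: "n \<ge> 4"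
  shows "ennreal (4 * exp (- (2 * real (num_divisors n) * ln (real n) / real (totient n)))) \<le>
    (\<integral>\<^sup>+s. ennreal (2 * sin s * cyc_abs n (cis s) powr (- (4 / real (totient n)))) * indicator {0<..<pi} s \<partial>lborel)"
proof -
  let ?e = "exp (- (2 * real (num_divisors n) * ln (real n) / real (totient n)))"
  have "ennreal (4 * ?e) = ennreal ?e * (\<integral>\<^sup>+s. ennreal (2 * sin s) * indicator {0<..<pi} s \<partial>lborel)"
    unfolding nn_integral_sin by (simp add: ennreal_mult' mult.commute)
  also have "\<dots> = (\<integral>\<^sup>+s. ennreal ?e * (ennreal (2 * sin s) * indicator {0<..<pi} s) \<partial>lborel)"
    by (rule nn_integral_cmult[symmetric]) measurable
  also have "\<dots> = (\<integral>\<^sup>+s. (ennreal ?e * ennreal (2 * sin s)) * indicator {0<..<pi} s \<partial>lborel)"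
    by (simp only: mult.assoc)
  also have "\<dots> \<le> (\<integral>\<^sup>+s. ennreal (2 * sin s * cyc_abs n (cis s) powr (- (4 / real (totient n)))) * indicator {0<..<pi} s \<partial>lborel)"
  proof (rule nn_set_integral_mono_AE)
    have "AE s in lborel. sin (real n / 2 * s) \<noteq> 0"
      using n by (intro AE_sin_nonzero) simp
    then show "AE s in lborel. s \<in> {0<..<pi} \<longrightarrow> ennreal ?e * ennreal (2 * sin s) \<le>
        ennreal (2 * sin s * cyc_abs n (cis s) powr (- (4 / real (totient n))))"
    proof eventually_elim
      case (elim s)
      then have "cis s ^ n \<noteq> 1"
        using cis_power_eq_1_imp_sin by blast
      then have "?e \<le> cyc_abs n (cis s) powr (- (4 / real (totient n)))"
        using n by (intro cyc_abs_powr_ge cyc_abs_pos) auto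
      then have "s \<in> {0<..<pi} \<Longrightarrow> ?e * (2 * sin s) \<le> cyc_abs n (cis s) powr (- (4 / real (totient n))) * (2 * sin s)"
        using sin_gt_zero[of s] by (intro mult_right_mono) auto
      then have "s \<in> {0<..<pi} \<Longrightarrow> ennreal (?e * (2 * sin s)) \<le> ennreal (2 * sin s * cyc_abs n (cis s) powr (- (4 / real (totient n))))"
        by (intro ennreal_leI) (simp only: mult_ac)
      then show ?case
        unfolding ennreal_mult'[OF exp_ge_zero] by blast
    qed
  qed
  finally show ?thesis .
qed

text \<open>16/3 splits as 4 + 2/3 + 2/3, the integrals of \<open>2 sin s\<close> over
  \<open>(0, pi)\<close> and of \<open>1 - w^2\<close> over the two radii.\<close>

lemma form_area_gt:
  assumes n: "n \<ge> 4"
  shows "ennreal (16 / 3 * exp (- (2 * real (num_divisors n) * ln (real n) / real (totient n)))) < form_area (Psi n)"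
proof -
  let ?e = "exp (- (2 * real (num_divisors n) * ln (real n) / real (totient n)))"
  have n2: "n > 2"
    using n by simp
  define I1 where "I1 = (\<integral>\<^sup>+w. ennreal ((1 - w\<^sup>2) * cyc_abs n (complex_of_real w) powr (- (4 / real (totient n)))) * indicator {0<..<1} w \<partial>lborel)"
  define I2 where "I2 = (\<integral>\<^sup>+w. ennreal ((1 - w\<^sup>2) * cyc_abs n (- complex_of_real w) powr (- (4 / real (totient n)))) * indicator {0<..<1} w \<partial>lborel)"
  define I3 where "I3 = (\<integral>\<^sup>+s. ennreal (2 * sin s * cyc_abs n (cis s) powr (- (4 / real (totient n)))) * indicator {0<..<pi} s \<partial>lborel)"
  have 1: "ennreal (2 / 3 * ?e) < I1" "ennreal (2 / 3 * ?e) < I2"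
    unfolding I1_def I2_def by (rule outer_integral_gt[OF n]; simp)+
  have 3: "ennreal (4 * ?e) \<le> I3"
    unfolding I3_def by (rule inner_integral_ge[OF n])
  have "16 / 3 * ?e = 4 * ?e + 2 / 3 * ?e + 2 / 3 * ?e"
    by simp
  then have "ennreal (16 / 3 * ?e) = (ennreal (4 * ?e) + ennreal (2 / 3 * ?e)) + ennreal (2 / 3 * ?e)"
    by (simp only: ennreal_plus[symmetric] add_nonneg_nonneg mult_nonneg_nonneg exp_ge_zero)
  also have "\<dots> < (ennreal (4 * ?e) + ennreal (2 / 3 * ?e)) + I1"
    using 1(1) by (simp add: ennreal_add_left_cancel_less)
  also have "\<dots> \<le> (I3 + I2) + I1"
    using 1(2) 3 by (intro add_mono) auto
  also have "\<dots> = form_area (Psi n)"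
    unfolding form_area_Psi[OF n2] I1_def I2_def I3_def by (simp only: ac_simps)
  finally show ?thesis .
qed

section \<open>Upper bound for the area\<close>

text \<open>By the triangle inequality \<open>|1 - z^n| >= 1 - w^n\<close> whenever
  \<open>|z| = w\<close>, so the same majorant serves both radii regardless of the parity of
  \<open>n\<close>.\<close>

lemma outer_integral_le:
  assumes n: "n \<ge> 4" and t: "totient n \<ge> 6" and g: "\<And>w. g w = cyc_abs n (complex_of_real w) \<or> g w = cyc_abs n (- complex_of_real w)"
  defines "a \<equiv> 4 / real (totient n)"
  shows "(\<integral>\<^sup>+w. ennreal ((1 - w\<^sup>2) * g w powr (- a)) * indicator {0<..<1} w \<partial>lborel) \<le>
    ennreal (exp (2 * real (num_divisors n) ^ 2 * ln (real n) / real (totient n)) *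
      (1 / real n * Beta (1 / real n) (1 - a) - 1 / real n * Beta (3 / real n) (1 - a)))"
proof -
  let ?E = "exp (2 * real (num_divisors n) ^ 2 * ln (real n) / real (totient n))"
  have n0: "n > 0" and a: "a < 1"
    using n t by (auto simp: a_def field_simps)
  have "(\<integral>\<^sup>+w. ennreal ((1 - w\<^sup>2) * g w powr (- a)) * indicator {0<..<1} w \<partial>lborel) \<le>
      (\<integral>\<^sup>+w. (ennreal ?E * ennreal ((1 - w\<^sup>2) * (1 - w ^ n) powr (- a))) * indicator {0<..<1} w \<partial>lborel)"
  proof (rule nn_set_integral_mono_AE, rule AE_I2, rule impI)
    fix w :: real assume w: "w \<in> {0<..<1}"
    obtain z where z: "g w = cyc_abs n z" "cmod z = w"
      using g[of w] w by (metis abs_of_pos greaterThanLessThan_iff norm_minus_cancel norm_of_real)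
    have pos: "0 < 1 - w ^ n"
      using w n0 by (simp add: power_less_one_iff)
    have "1 - w ^ n = cmod 1 - cmod (z ^ n)"
      by (simp add: norm_power z(2))
    also have "\<dots> \<le> cmod (1 - z ^ n)"
      by (rule norm_triangle_ineq2)
    finally have "g w powr (- a) \<le> ?E * (1 - w ^ n) powr (- a)"
      unfolding z(1) a_def using n w z(2) pos by (intro cyc_abs_powr_le) auto
    moreover have "1 - w\<^sup>2 \<ge> 0"
      using w by (simp add: power_le_one)
    ultimately have "(1 - w\<^sup>2) * g w powr (- a) \<le> (1 - w\<^sup>2) * (?E * (1 - w ^ n) powr (- a))"
      by (intro mult_left_mono)
    then have "ennreal ((1 - w\<^sup>2) * g w powr (- a)) \<le> ennreal (?E * ((1 - w\<^sup>2) * (1 - w ^ n) powr (- a)))"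
      by (intro ennreal_leI) (simp only: mult.left_commute)
    then show "ennreal ((1 - w\<^sup>2) * g w powr (- a)) \<le> ennreal ?E * ennreal ((1 - w\<^sup>2) * (1 - w ^ n) powr (- a))"
      by (simp add: ennreal_mult')
  qed
  also have "\<dots> = ennreal ?E * (\<integral>\<^sup>+w. ennreal ((1 - w\<^sup>2) * (1 - w ^ n) powr (- a)) * indicator {0<..<1} w \<partial>lborel)"
    unfolding mult.assoc by (rule nn_integral_cmult) measurable
  finally show ?thesis
    unfolding nn_integral_outer_bound(1)[OF n0 a] by (simp add: ennreal_mult')
qed

text \<open>Writing \<open>G\<close> for the power of \<open>|sin (n s / 2)|\<close>, which is at
  least 1 almost everywhere, \<open>sin s * G = G - (1 - sin s) G <= G - (1 - sin s)\<close>. This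
  separates the weight \<open>sin s\<close> from the oscillating factor: \<open>2 G\<close>
  integrates to \<open>2 B\<close>, and \<open>2 (1 - sin s)\<close> to
  \<open>2 pi - 4\<close>.\<close>

lemma nn_integral_sin_weighted_le:
  assumes n: "n > 0" and a: "0 \<le> a" "a < 1"
  shows "(\<integral>\<^sup>+s. ennreal (2 * sin s * \<bar>sin (real n * s / 2)\<bar> powr (- a)) * indicator {0<..<pi} s \<partial>lborel) \<le>
    ennreal (2 * Beta (1 / 2) (1 / 2 - a / 2) - (2 * pi - 4))"
proof -
  let ?B = "Beta (1 / 2) (1 / 2 - a / 2)"
  let ?G = "\<lambda>s. \<bar>sin (real n * s / 2)\<bar> powr (- a)"
  let ?X = "\<integral>\<^sup>+s. ennreal (2 * sin s * ?G s) * indicator {0<..<pi} s \<partial>lborel"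
  have "?X + ennreal (2 * pi - 4) = (\<integral>\<^sup>+s. ennreal (2 * sin s * ?G s) * indicator {0<..<pi} s +
      ennreal (2 * (1 - sin s)) * indicator {0<..<pi} s \<partial>lborel)"
    unfolding nn_integral_1_minus_sin[symmetric] by (rule nn_integral_add[symmetric]) measurable
  also have "\<dots> = (\<integral>\<^sup>+s. (ennreal (2 * sin s * ?G s) + ennreal (2 * (1 - sin s))) * indicator {0<..<pi} s \<partial>lborel)"
    by (simp only: distrib_right)
  also have "\<dots> \<le> (\<integral>\<^sup>+s. (ennreal 2 * ennreal (?G s)) * indicator {0<..<pi} s \<partial>lborel)"
  proof (rule nn_set_integral_mono_AE)
    have "AE s in lborel. sin (real n / 2 * s) \<noteq> 0"
      using n by (intro AE_sin_nonzero) simp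
    then show "AE s in lborel. s \<in> {0<..<pi} \<longrightarrow>
        ennreal (2 * sin s * ?G s) + ennreal (2 * (1 - sin s)) \<le> ennreal 2 * ennreal (?G s)"
    proof (eventually_elim, intro impI)
      fix s assume nz: "sin (real n / 2 * s) \<noteq> 0" and s: "s \<in> {0<..<pi}"
      have "0 < \<bar>sin (real n * s / 2)\<bar>" "\<bar>sin (real n * s / 2)\<bar> \<le> 1"
        using nz by (simp_all add: mult.commute)
      then have "1 powr (- a) \<le> ?G s"
        using a by (intro powr_minus_antimono) auto
      then have G: "1 \<le> ?G s"
        by simp
      have s1: "0 \<le> sin s" "sin s \<le> 1"
        using s by (auto intro: sin_ge_zero)
      then have "0 \<le> (1 - sin s) * (?G s - 1)"
        using G by (intro mult_nonneg_nonneg) auto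
      then have "2 * sin s * ?G s + 2 * (1 - sin s) \<le> 2 * ?G s"
        by (simp add: algebra_simps)
      then have "ennreal (2 * sin s * ?G s + 2 * (1 - sin s)) \<le> ennreal (2 * ?G s)"
        by (rule ennreal_leI)
      then show "ennreal (2 * sin s * ?G s) + ennreal (2 * (1 - sin s)) \<le> ennreal 2 * ennreal (?G s)"
        using s1 by (subst ennreal_plus[symmetric]) (simp_all add: ennreal_mult')
    qed
  qed
  also have "\<dots> = ennreal 2 * (\<integral>\<^sup>+s. ennreal (?G s) * indicator {0<..<pi} s \<partial>lborel)"
    unfolding mult.assoc by (rule nn_integral_cmult) measurable
  also have "\<dots> = ennreal (2 * ?B)"
    unfolding nn_integral_sin_powr[OF a n] by (simp add: ennreal_mult')
  finally have "?X + ennreal (2 * pi - 4) \<le> ennreal (2 * ?B)" .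
  then have "?X + ennreal (2 * pi - 4) - ennreal (2 * pi - 4) \<le> ennreal (2 * ?B) - ennreal (2 * pi - 4)"
    by (rule ennreal_minus_mono) simp
  also have "?X + ennreal (2 * pi - 4) - ennreal (2 * pi - 4) = ?X"
    by (rule ennreal_add_diff_cancel_right) simp
  also have "ennreal (2 * ?B) - ennreal (2 * pi - 4) = ennreal (2 * ?B - (2 * pi - 4))"
    using pi_gt3 by (intro ennreal_minus) simp
  finally show ?thesis .
qed

lemma inner_integral_le:
  assumes n: "n \<ge> 4" and t: "totient n \<ge> 6"
  defines "a \<equiv> 4 / real (totient n)"
  shows "(\<integral>\<^sup>+s. ennreal (2 * sin s * cyc_abs n (cis s) powr (- a)) * indicator {0<..<pi} s \<partial>lborel) \<le>
    ennreal (exp (2 * real (num_divisors n) ^ 2 * ln (real n) / real (totient n)) *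
      (2 powr (- a) * (2 * Beta (1 / 2) (1 / 2 - a / 2) - (2 * pi - 4))))"
proof -
  let ?E = "exp (2 * real (num_divisors n) ^ 2 * ln (real n) / real (totient n))"
  let ?G = "\<lambda>s. \<bar>sin (real n * s / 2)\<bar> powr (- a)"
  have n0: "n > 0" and a: "0 \<le> a" "a < 1"
    using n t by (auto simp: a_def field_simps)
  have "(\<integral>\<^sup>+s. ennreal (2 * sin s * cyc_abs n (cis s) powr (- a)) * indicator {0<..<pi} s \<partial>lborel) \<le>
      (\<integral>\<^sup>+s. (ennreal (?E * 2 powr (- a)) * ennreal (2 * sin s * ?G s)) * indicator {0<..<pi} s \<partial>lborel)"
  proof (rule nn_set_integral_mono_AE)
    have "AE s in lborel. sin (real n / 2 * s) \<noteq> 0"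
      using n by (intro AE_sin_nonzero) simp
    then show "AE s in lborel. s \<in> {0<..<pi} \<longrightarrow>
        ennreal (2 * sin s * cyc_abs n (cis s) powr (- a)) \<le> ennreal (?E * 2 powr (- a)) * ennreal (2 * sin s * ?G s)"
    proof (eventually_elim, intro impI)
      fix s assume nz: "sin (real n / 2 * s) \<noteq> 0" and s: "s \<in> {0<..<pi}"
      have "cyc_abs n (cis s) powr (- a) \<le> ?E * (2 * \<bar>sin (real n * s / 2)\<bar>) powr (- a)"
        unfolding a_def using n nz by (intro cyc_abs_powr_le) (simp_all add: cmod_1_minus_cis_power mult.commute)
      also have "\<dots> = ?E * 2 powr (- a) * ?G s"
        by (simp add: powr_mult)
      finally have "2 * sin s * cyc_abs n (cis s) powr (- a) \<le> 2 * sin s * (?E * 2 powr (- a) * ?G s)"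
        using s by (intro mult_left_mono) (auto intro: sin_ge_zero)
      then have "ennreal (2 * sin s * cyc_abs n (cis s) powr (- a)) \<le> ennreal (?E * 2 powr (- a) * (2 * sin s * ?G s))"
        by (intro ennreal_leI) (simp only: mult_ac)
      then show "ennreal (2 * sin s * cyc_abs n (cis s) powr (- a)) \<le> ennreal (?E * 2 powr (- a)) * ennreal (2 * sin s * ?G s)"
        by (simp add: ennreal_mult')
    qed
  qed
  also have "\<dots> = ennreal (?E * 2 powr (- a)) * (\<integral>\<^sup>+s. ennreal (2 * sin s * ?G s) * indicator {0<..<pi} s \<partial>lborel)"
    unfolding mult.assoc[of _ _ "indicator _ _"] by (rule nn_integral_cmult) measurable
  also have "\<dots> \<le> ennreal (?E * 2 powr (- a)) * ennreal (2 * Beta (1 / 2) (1 / 2 - a / 2) - (2 * pi - 4))"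
    by (intro mult_left_mono nn_integral_sin_weighted_le n0 a) simp
  finally show ?thesis
    by (simp add: ennreal_mult'[symmetric] mult.assoc)
qed

lemma Beta_half_ge_pi: "0 \<le> a \<Longrightarrow> a < 1 \<Longrightarrow> pi \<le> Beta (1 / 2) (1 / 2 - a / 2 :: real)"
proof -
  assume a: "0 \<le> a" "a < 1"
  have "Beta (1 / 2) (1 / 2 :: real) = pi"
    by (simp add: Beta_def Gamma_one_half_real)
  moreover have "Beta (1 / 2) (1 / 2 :: real) \<le> Beta (1 / 2) (1 / 2 - a / 2)"
    using a by (intro Beta_real_mono) auto
  ultimately show ?thesis
    by simp
qed

text \<open>Cubing reduces the claim to \<open>4 <= 512/125\<close>. The exponent 2/3 is
  \<open>4 / totient n\<close> at \<open>totient n = 6\<close>.\<close>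

lemma two_powr_le: "a \<le> 2 / 3 \<Longrightarrow> 2 powr a \<le> (8 / 5 :: real)"
proof -
  assume "a \<le> 2 / 3"
  then have "2 powr a \<le> 2 powr (2 / 3 :: real)"
    by simp
  also have "\<dots> \<le> 8 / 5"
  proof (rule power_le_imp_le_base[where n = 2])
    have "(2 powr (2 / 3 :: real)) ^ Suc 2 = 2 powr (2 / 3 * 3)"
      by (subst powr_powr[symmetric]) (simp add: powr_numeral eval_nat_numeral)
    also have "\<dots> = 4"
      by simp
    finally show "(2 powr (2 / 3 :: real)) ^ Suc 2 \<le> (8 / 5) ^ Suc 2"
      by (simp add: eval_nat_numeral)
  qed simp
  finally show ?thesis .
qed

text \<open>With \<open>q = 2 powr a\<close> and \<open>c = 2 pi - 4\<close>, \<open>q\<close> times the difference of the two sides is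
  \<open>2 d q (q - 1) + (q - 1) (2 B - c (q + 1))\<close>.\<close>

lemma upper_bound_arith:
  fixes a B d E :: real
  assumes a: "0 < a" "a \<le> 2 / 3" and B: "pi \<le> B" and d: "0 \<le> d" and E: "0 < E"
  shows "E * d + E * d + E * (2 powr (- a) * (2 * B - (2 * pi - 4))) <
    2 powr a * E * (16 / 3 + 2 powr (1 - a) * B - 2 * pi + (2 * d - 4 / 3))"
proof -
  define q where "q = 2 powr a"
  define c where "c = 2 * pi - 4"
  have q: "1 < q" "q \<le> 8 / 5"
    using a two_powr_le[of a] by (simp_all add: q_def)
  have pow: "2 powr (- a) = 1 / q" "2 powr (1 - a) = 2 / q"
    by (simp_all add: q_def powr_minus_divide powr_diff)
  have c: "0 \<le> c" "c \<le> 5 / 2"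
    using pi_gt3 pi_less_4 pi_approx by (simp_all add: c_def)
  have "c * (q + 1) \<le> c * (13 / 5)"
    using q c by (intro mult_left_mono) auto
  \<comment> \<open>Numerically, \<open>(2 pi - 4) * 13/5\<close> is about 5.94, and
    \<open>2 B\<close> is at least \<open>2 pi\<close>, about 6.28.\<close>
  also have "\<dots> < 2 * B"
    using B pi_approx by (simp add: c_def)
  finally have "0 < (q - 1) * (2 * B - c * (q + 1))"
    using q by simp
  also have "\<dots> \<le> (q - 1) * (2 * B - c * (q + 1)) + 2 * d * q * (q - 1)"
    using q d by simp
  also have "\<dots> = q * (q * (4 + 2 / q * B - 2 * pi + 2 * d) - (2 * d + 1 / q * (2 * B - c)))"
    using q by (simp add: c_def field_simps)
  finally have "0 < q * (4 + 2 / q * B - 2 * pi + 2 * d) - (2 * d + 1 / q * (2 * B - c))"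
    using q by (simp add: zero_less_mult_iff)
  then have "E * (2 * d + 1 / q * (2 * B - c)) < E * (q * (4 + 2 / q * B - 2 * pi + 2 * d))"
    using E by (intro mult_strict_left_mono) auto
  then show ?thesis
    unfolding pow q_def[symmetric] c_def[symmetric] using q by (simp add: algebra_simps)
qed

definition area_upper :: "nat \<Rightarrow> real" where
  "area_upper n = 2 powr (4 / real (totient n))
          * exp (2 * real (num_divisors n) ^ 2 * ln (real n) / real (totient n))
          * (16 / 3
             + 2 powr (1 - 4 / real (totient n)) * Beta (1 / 2) (1 / 2 - 2 / real (totient n))
             - 2 * pi
             + (2 / real n * Beta (1 / real n) (1 - 4 / real (totient n)) - 2)
             - (2 / real n * Beta (3 / real n) (1 - 4 / real (totient n)) - 2 / 3))"

text \<open>The three estimates add up to \<open>E (2 d + 2 powr (-a) (2 B - (2 pi - 4)))\<close>,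
  whereas the stated bound carries an additional factor \<open>2 powr a > 1\<close>. Strictness
  comes from this arithmetic gap, so non-strict integral estimates suffice.\<close>

lemma form_area_less:
  assumes t: "totient n \<ge> 6"
  shows "form_area (Psi n) < ennreal (area_upper n)"
proof -
  have n: "n \<ge> 4"
    using t totient_le[of n] by linarith
  have n2: "n > 2" and n0: "n > 0"
    using n by simp_all
  define a where "a = 4 / real (totient n)"
  define E where "E = exp (2 * real (num_divisors n) ^ 2 * ln (real n) / real (totient n))"
  define d where "d = 1 / real n * Beta (1 / real n) (1 - a) - 1 / real n * Beta (3 / real n) (1 - a)"
  define B where "B = Beta (1 / 2) (1 / 2 - a / 2)"
  have t6: "6 \<le> real (totient n)"
    using t by simp
  then have "a \<le> 4 / 6"
    unfolding a_def using n0 by (intro divide_left_mono) auto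
  moreover have "0 < a"
    using n0 by (simp add: a_def)
  ultimately have a: "0 < a" "a \<le> 2 / 3" "a < 1"
    by simp_all
  have d: "d \<ge> 0"
    unfolding d_def using n0 a by (intro nn_integral_outer_bound(2))
  have B: "pi \<le> B"
    unfolding B_def using a by (intro Beta_half_ge_pi) auto
  have E: "E > 0"
    by (simp add: E_def)
  have i: "0 \<le> 2 powr (- a) * (2 * B - (2 * pi - 4))"
    using B by simp
  have nn: "0 \<le> E * d" "0 \<le> E * (2 powr (- a) * (2 * B - (2 * pi - 4)))"
    using mult_nonneg_nonneg[OF less_imp_le[OF E] d] mult_nonneg_nonneg[OF less_imp_le[OF E] i] .
  have "form_area (Psi n) \<le> ennreal (E * d) + ennreal (E * d) + ennreal (E * (2 powr (- a) * (2 * B - (2 * pi - 4))))"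
    unfolding form_area_Psi[OF n2] E_def d_def B_def a_def
    by (intro add_mono outer_integral_le inner_integral_le n t) auto
  also have "\<dots> = ennreal (E * d + E * d + E * (2 powr (- a) * (2 * B - (2 * pi - 4))))"
    using nn by (simp only: ennreal_plus add_nonneg_nonneg)
  also have "\<dots> < ennreal (2 powr a * E * (16 / 3 + 2 powr (1 - a) * B - 2 * pi + (2 * d - 4 / 3)))"
  proof (rule ennreal_lessI)
    show less: "E * d + E * d + E * (2 powr (- a) * (2 * B - (2 * pi - 4))) <
        2 powr a * E * (16 / 3 + 2 powr (1 - a) * B - 2 * pi + (2 * d - 4 / 3))"
      by (rule upper_bound_arith) fact+
    have "0 \<le> E * d + E * d + E * (2 powr (- a) * (2 * B - (2 * pi - 4)))"
      using nn by (intro add_nonneg_nonneg)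
    with less show "0 < 2 powr a * E * (16 / 3 + 2 powr (1 - a) * B - 2 * pi + (2 * d - 4 / 3))"
      by linarith
  qed
  also have "2 powr a * E * (16 / 3 + 2 powr (1 - a) * B - 2 * pi + (2 * d - 4 / 3)) = area_upper n"
    unfolding area_upper_def E_def[symmetric] a_def[symmetric]
    by (rule arg_cong[where f = "\<lambda>x. 2 powr a * E * x"])
      (simp add: d_def B_def a_def algebra_simps)
  finally show ?thesis .
qed

subsection \<open>The limit\<close>

lemma num_divisors_prime_power_mult_le:
  assumes p: "prime p" and m: "m > 0"
  shows "num_divisors (p ^ k * m) \<le> Suc k * num_divisors m"
proof -
  have "{d. d dvd p ^ k * m} \<subseteq> (\<lambda>(i, e). p ^ i * e) ` ({..k} \<times> {e. e dvd m})"
  proof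
    fix d assume "d \<in> {d. d dvd p ^ k * m}"
    then obtain b c where "d = b * c" "b dvd p ^ k" "c dvd m"
      using division_decomp by blast
    moreover obtain i where "i \<le> k" "b = p ^ i"
      using \<open>b dvd p ^ k\<close> divides_primepow_nat[OF p] by blast
    ultimately show "d \<in> (\<lambda>(i, e). p ^ i * e) ` ({..k} \<times> {e. e dvd m})"
      by auto
  qed
  then have "num_divisors (p ^ k * m) \<le> card ({..k} \<times> {e. e dvd m})"
    unfolding num_divisors_def using m by (intro surj_card_le) auto
  then show ?thesis
    by (simp add: num_divisors_def card_cartesian_product)
qed

lemma Suc_le_two_power: "Suc k \<le> 2 ^ k"
  by (induction k) auto

text \<open>\<open>C\<close> is the loss allowed at each small prime; 2 is the smallest base that
  occurs. The leading 2 compensates for \<open>totient (p ^ k)\<close> being possibly only half of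
  \<open>p ^ k\<close>.\<close>

lemma sq_le_sqrt_power_bound:
  obtains C :: real where "C \<ge> 1" "\<And>k. 2 * real (Suc k) ^ 2 \<le> C * sqrt 2 ^ k"
proof -
  have "(\<lambda>k::nat. 2 * real (Suc k) ^ 2 / sqrt 2 ^ k) \<longlonglongrightarrow> 0"
    by real_asymp
  then have "Bseq (\<lambda>k::nat. 2 * real (Suc k) ^ 2 / sqrt 2 ^ k)"
    by (intro convergent_imp_Bseq convergentI)
  then obtain C where C: "C > 0" "\<And>k. norm (2 * real (Suc k) ^ 2 / sqrt 2 ^ k) \<le> C"
    by (auto elim: BseqE)
  show ?thesis
  proof (rule that[of "max 1 C"])
    fix k
    have "2 * real (Suc k) ^ 2 / sqrt 2 ^ k \<le> max 1 C"
      using C(2)[of k] by (simp del: of_nat_Suc)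
    then show "2 * real (Suc k) ^ 2 \<le> max 1 C * sqrt 2 ^ k"
      by (simp add: divide_le_eq del: of_nat_Suc)
  qed simp
qed

text \<open>From \<open>p \<ge> 64\<close> on, \<open>sqrt p >= 8\<close>, and \<open>8^k\<close>
  already dominates \<open>2 (k + 1)^2\<close>, so such primes contribute no constant. Only finitely
  many primes pay the factor \<open>C\<close>, which keeps the product over all prime factors
  bounded.\<close>

lemma prime_power_divisor_bound:
  assumes p: "prime p" and k: "k > 0" and C: "C \<ge> 1" "\<And>k. 2 * real (Suc k) ^ 2 \<le> C * sqrt 2 ^ k"
  shows "real (Suc k) ^ 2 * sqrt (real (p ^ k)) \<le> real (totient (p ^ k)) * (if p < 64 then C else 1)"
proof -
  let ?w = "if p < 64 then C else 1"
  have p2: "p \<ge> 2"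
    using p by (rule prime_ge_2_nat)
  have *: "2 * real (Suc k) ^ 2 \<le> ?w * sqrt (real p) ^ k"
  proof (cases "p < 64")
    case True
    have "2 * real (Suc k) ^ 2 \<le> C * sqrt 2 ^ k"
      by (rule C)
    also have "\<dots> \<le> C * sqrt (real p) ^ k"
      using C(1) p2 by (intro mult_left_mono power_mono) auto
    finally show ?thesis
      using True by simp
  next
    case False
    \<comment> \<open>Both \<open>2 <= 2^k\<close> and \<open>k + 1 <= 2^k\<close> are used;
      together they give \<open>2^k * 4^k = 8^k\<close>, the source of the threshold
      \<open>64 = 8^2\<close>.\<close>
    have "2 * real (Suc k) ^ 2 \<le> 2 ^ k * (2 ^ k) ^ 2"
    proof (intro mult_mono power_mono)
      show "(2 :: real) \<le> 2 ^ k"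
        using k self_le_power[of "2 :: real" k] by simp
      have "real (Suc k) \<le> real (2 ^ k)"
        using Suc_le_two_power by (simp only: of_nat_le_iff)
      then show "real (Suc k) \<le> 2 ^ k"
        by simp
    qed auto
    also have "\<dots> = 8 ^ k"
      by (simp add: power2_eq_square power_mult_distrib[symmetric])
    also have "\<dots> \<le> sqrt (real p) ^ k"
    proof (rule power_mono)
      have "sqrt 64 \<le> sqrt (real p)"
        using False by (intro real_sqrt_le_mono) simp
      then show "8 \<le> sqrt (real p)"
        by simp
    qed simp
    finally show ?thesis
      using False by simp
  qed
  have sq: "sqrt (real p) ^ k * sqrt (real p) ^ k = real p ^ k"
    by (simp add: power_mult_distrib[symmetric])
  have "real p ^ k \<le> 2 * (real p ^ (k - 1) * (real p - 1))"
  proof -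
    have "real p ^ k = real p ^ (k - 1) * real p"
      using k by (simp add: power_eq_if)
    also have "\<dots> \<le> real p ^ (k - 1) * (2 * (real p - 1))"
      using p2 by (intro mult_left_mono) auto
    finally show ?thesis
      by (simp only: mult_ac)
  qed
  also have "real p ^ (k - 1) * (real p - 1) = real (totient (p ^ k))"
    using p k p2 by (simp add: totient_prime_power of_nat_diff)
  finally have tot: "real p ^ k \<le> 2 * real (totient (p ^ k))" .
  have "2 * (real (Suc k) ^ 2 * sqrt (real (p ^ k))) = 2 * real (Suc k) ^ 2 * sqrt (real p) ^ k"
    by (simp add: real_sqrt_power)
  also have "\<dots> \<le> ?w * sqrt (real p) ^ k * sqrt (real p) ^ k"
    using * by (intro mult_right_mono) auto
  also have "\<dots> = ?w * real p ^ k"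
    by (simp only: mult.assoc sq)
  also have "\<dots> \<le> ?w * (2 * real (totient (p ^ k)))"
    using tot C(1) by (intro mult_left_mono) auto
  finally show ?thesis
    by (simp add: mult_ac)
qed

text \<open>One full prime power is split off at a time: square root and totient are multiplicative
  over the coprime parts, and submultiplicativity of the divisor count goes in the right
  direction.\<close>

lemma divisor_bound_aux:
  assumes C: "C \<ge> 1" "\<And>k. 2 * real (Suc k) ^ 2 \<le> C * sqrt 2 ^ k"
  shows "n > 0 \<Longrightarrow> real (num_divisors n) ^ 2 * sqrt (real n) \<le>
    real (totient n) * (\<Prod>p\<in>prime_factors n. if p < 64 then C else 1)"
proof (induction n rule: less_induct)
  case (less n)
  show ?case
  proof (cases "n = 1")
    case True
    then show ?thesis
      by (simp add: num_divisors_def)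
  next
    case False
    then obtain p where p: "prime p" "p dvd n"
      using prime_factor_nat by blast
    define k where "k = multiplicity p n"
    obtain m where m: "n = p ^ k * m" "\<not> p dvd m"
      using multiplicity_decompose'[of n p] p less.prems unfolding k_def
      by (metis not_prime_unit not_gr_zero)
    have k: "k > 0"
      using p less.prems by (simp add: k_def prime_multiplicity_gt_zero_iff)
    have m0: "m > 0"
      using m less.prems by (cases m) auto
    have p1: "1 < p ^ k"
      using p(1) k by (intro one_less_power prime_gt_1_nat)
    then have "m < n"
      using m0 unfolding m(1) by simp
    have cop: "coprime (p ^ k) m"
      using m(2) p(1) by (simp add: prime_imp_coprime)
    have pf: "prime_factors n = insert p (prime_factors m)" "p \<notin> prime_factors m"
    proof -
      have "prime_factors n = prime_factors (p ^ k) \<union> prime_factors m"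
        unfolding m(1) using p1 m0 prime_gt_0_nat[OF p(1)] by (intro prime_factors_product) auto
      also have "prime_factors (p ^ k) = {p}"
        using p(1) k by (simp add: prime_factors_power prime_prime_factors)
      finally show "prime_factors n = insert p (prime_factors m)"
        by simp
      show "p \<notin> prime_factors m"
        using m(2) by auto
    qed
    have "real (num_divisors n) \<le> real (Suc k * num_divisors m)"
      unfolding m(1) of_nat_le_iff using p(1) m0 by (rule num_divisors_prime_power_mult_le)
    then have "real (num_divisors n) ^ 2 * sqrt (real n) \<le> real (Suc k * num_divisors m) ^ 2 * sqrt (real n)"
      by (intro mult_right_mono power_mono) auto
    also have "\<dots> = (real (Suc k) ^ 2 * sqrt (real (p ^ k))) * (real (num_divisors m) ^ 2 * sqrt (real m))"
      unfolding m(1) of_nat_mult by (simp only: real_sqrt_mult power_mult_distrib mult_ac)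
    also have "\<dots> \<le> (real (totient (p ^ k)) * (if p < 64 then C else 1)) *
        (real (totient m) * (\<Prod>p\<in>prime_factors m. if p < 64 then C else 1))"
      by (rule mult_mono[OF prime_power_divisor_bound[OF p(1) k C] less.IH[OF \<open>m < n\<close> m0]])
        (use C(1) in auto)
    also have "\<dots> = real (totient n) * (\<Prod>p\<in>prime_factors n. if p < 64 then C else 1)"
    proof -
      have "totient n = totient (p ^ k) * totient m"
        unfolding m(1) by (rule totient_mult_coprime[OF cop])
      then show ?thesis
        unfolding pf(1) prod.insert[OF finite_set_mset pf(2)] by (simp only: of_nat_mult mult_ac)
    qed
    finally show ?thesis .
  qed
qed

lemma divisor_bound:
  obtains K :: real where "K > 0"
    "\<And>n. n > 0 \<Longrightarrow> real (num_divisors n) ^ 2 / real (totient n) \<le> K / sqrt (real n)"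
proof -
  obtain C :: real where C: "C \<ge> 1" "\<And>k. 2 * real (Suc k) ^ 2 \<le> C * sqrt 2 ^ k"
    using sq_le_sqrt_power_bound by blast
  \<comment> \<open>A crude count: at most 64 prime factors can lie below 64, each costing one
    \<open>C\<close>.\<close>
  show ?thesis
  proof (rule that[of "C ^ 64"])
    show "C ^ 64 > 0"
      using C(1) by simp
    fix n :: nat assume n: "n > 0"
    have "(\<Prod>p\<in>prime_factors n. if p < 64 then C else 1) = (\<Prod>p\<in>prime_factors n \<inter> {..<64}. C)"
      by (subst prod.inter_restrict) (auto intro: prod.cong)
    also have "\<dots> = C ^ card (prime_factors n \<inter> {..<64})"
      by simp
    also have "\<dots> \<le> C ^ 64"
      using C(1) card_mono[of "{..<64::nat}" "prime_factors n \<inter> {..<64}"]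
      by (intro power_increasing) auto
    finally have "real (totient n) * (\<Prod>p\<in>prime_factors n. if p < 64 then C else 1) \<le> real (totient n) * C ^ 64"
      by (intro mult_left_mono) auto
    with divisor_bound_aux[OF C n]
    have "real (num_divisors n) ^ 2 * sqrt (real n) \<le> real (totient n) * C ^ 64"
      by linarith
    then show "real (num_divisors n) ^ 2 / real (totient n) \<le> C ^ 64 / sqrt (real n)"
      using n by (simp add: field_simps)
  qed
qed

text \<open>All three follow from the bound \<open>K / sqrt n\<close> for
  \<open>d(n)^2 / totient n\<close>: because \<open>d(n) \<ge> 1\<close>, the other two numerators
  are at most the corresponding ones with \<open>d(n)^2\<close>.\<close>

lemma tendsto_divisor_ln:
  "(\<lambda>n. real (num_divisors n) ^ 2 * ln (real n) / real (totient n)) \<longlonglongrightarrow> 0"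
  "(\<lambda>n. real (num_divisors n) * ln (real n) / real (totient n)) \<longlonglongrightarrow> 0"
  "(\<lambda>n. 1 / real (totient n)) \<longlonglongrightarrow> 0"
proof -
  obtain K :: real where K: "K > 0"
    "\<And>n. n > 0 \<Longrightarrow> real (num_divisors n) ^ 2 / real (totient n) \<le> K / sqrt (real n)"
    using divisor_bound by blast
  have D1: "1 \<le> real (num_divisors n)" if "n > 0" for n
    using num_divisors_pos[OF that] by simp
  have lim1: "(\<lambda>n::nat. K / sqrt (real n) * ln (real n)) \<longlonglongrightarrow> 0"
    by real_asymp
  have lim2: "(\<lambda>n::nat. K / sqrt (real n)) \<longlonglongrightarrow> 0"
    by real_asymp
  have le1: "real (num_divisors n) ^ 2 * ln (real n) / real (totient n) \<le> K / sqrt (real n) * ln (real n)"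
    if "n > 0" for n
    using mult_right_mono[OF K(2)[OF that], of "ln (real n)"] that by simp
  have le2: "real (num_divisors n) * ln (real n) / real (totient n) \<le>
      real (num_divisors n) ^ 2 * ln (real n) / real (totient n)" if "n > 0" for n
  proof -
    have "real (num_divisors n) ^ 1 \<le> real (num_divisors n) ^ 2"
      using D1[OF that] by (intro power_increasing) auto
    then show ?thesis
      using that by (intro divide_right_mono mult_right_mono) auto
  qed
  have le3: "1 / real (totient n) \<le> K / sqrt (real n)" if "n > 0" for n
  proof -
    have "1 ^ 2 \<le> real (num_divisors n) ^ 2"
      using D1[OF that] by (intro power_mono) auto
    then have "1 / real (totient n) \<le> real (num_divisors n) ^ 2 / real (totient n)"
      by (intro divide_right_mono) auto
    with K(2)[OF that] show ?thesis
      by linarith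
  qed
  note ev = eventually_gt_at_top[of "0::nat"]
  show 1: "(\<lambda>n. real (num_divisors n) ^ 2 * ln (real n) / real (totient n)) \<longlonglongrightarrow> 0"
  proof (rule tendsto_sandwich[OF _ _ tendsto_const lim1])
    show "\<forall>\<^sub>F n in sequentially. 0 \<le> real (num_divisors n) ^ 2 * ln (real n) / real (totient n)"
      using ev by eventually_elim simp
    show "\<forall>\<^sub>F n in sequentially. real (num_divisors n) ^ 2 * ln (real n) / real (totient n) \<le> K / sqrt (real n) * ln (real n)"
      using ev by eventually_elim (rule le1)
  qed
  show "(\<lambda>n. real (num_divisors n) * ln (real n) / real (totient n)) \<longlonglongrightarrow> 0"
  proof (rule tendsto_sandwich[OF _ _ tendsto_const 1])
    show "\<forall>\<^sub>F n in sequentially. 0 \<le> real (num_divisors n) * ln (real n) / real (totient n)"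
      using ev by eventually_elim simp
    show "\<forall>\<^sub>F n in sequentially. real (num_divisors n) * ln (real n) / real (totient n) \<le>
        real (num_divisors n) ^ 2 * ln (real n) / real (totient n)"
      using ev by eventually_elim (rule le2)
  qed
  show "(\<lambda>n. 1 / real (totient n)) \<longlonglongrightarrow> 0"
  proof (rule tendsto_sandwich[OF _ _ tendsto_const lim2])
    show "\<forall>\<^sub>F n in sequentially. 0 \<le> 1 / real (totient n)"
      by simp
    show "\<forall>\<^sub>F n in sequentially. 1 / real (totient n) \<le> K / sqrt (real n)"
      using ev by eventually_elim (rule le3)
  qed
qed

section \<open>Passing to the limit\<close>

text \<open>The functional equation absorbs the pole at 0:
  \<open>x Beta x y = Gamma (x + 1) Gamma y / Gamma (x + y)\<close> is continuous at
  \<open>(0, 1)\<close> with value 1.\<close>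

lemma tendsto_mult_Beta:
  assumes x: "(x \<longlongrightarrow> 0) F" "\<forall>\<^sub>F n in F. x n > (0 :: real)" and y: "(y \<longlongrightarrow> 1) F"
  shows "((\<lambda>n. x n * Beta (x n) (y n)) \<longlongrightarrow> 1) F"
proof -
  have "((\<lambda>n. Gamma (x n + 1) * Gamma (y n) / Gamma (x n + y n)) \<longlongrightarrow>
      Gamma (0 + 1) * Gamma 1 / Gamma (0 + 1 :: real)) F"
    by (intro tendsto_intros x y) (auto simp: nonpos_Ints_def)
  moreover have "\<forall>\<^sub>F n in F. Gamma (x n + 1) * Gamma (y n) / Gamma (x n + y n) = x n * Beta (x n) (y n)"
    using x(2)
  proof eventually_elim
    case (elim n)
    then have "Gamma (x n + 1) = x n * Gamma (x n)"
      by (intro Gamma_plus1) (auto elim!: nonpos_Ints_cases)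
    then show ?case
      by (simp add: Beta_def)
  qed
  ultimately show ?thesis
    by (simp add: filterlim_cong)
qed

text \<open>\<open>Beta (1/2) (1/2) = pi\<close> makes the second term cancel \<open>2 pi\<close>,
  and both differences of Beta terms vanish after writing \<open>2/n\<close> as
  \<open>2 * (1/n)\<close> and as \<open>2/3 * (3/n)\<close>; only 16/3 remains.\<close>

lemma area_upper_tendsto: "area_upper \<longlonglongrightarrow> 16 / 3"
proof -
  define b where "b n = 1 / real (totient n)" for n
  have b: "b \<longlonglongrightarrow> 0"
    using tendsto_divisor_ln(3) by (simp add: b_def[abs_def])
  have eq: "4 / real (totient n) = 4 * b n" "2 / real (totient n) = 2 * b n" for n
    by (simp_all add: b_def)
  have E: "(\<lambda>n. exp (2 * (real (num_divisors n) ^ 2 * ln (real n) / real (totient n)))) \<longlonglongrightarrow> exp (2 * 0)"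
    by (intro tendsto_intros tendsto_divisor_ln(1))
  have y: "(\<lambda>n. 1 - 4 * b n) \<longlonglongrightarrow> 1 - 4 * 0"
    by (intro tendsto_intros b)
  have "(\<lambda>n. 1 / real n * Beta (1 / real n) (1 - 4 * b n)) \<longlonglongrightarrow> 1"
    using y by (intro tendsto_mult_Beta) (real_asymp, auto intro: eventually_mono[OF eventually_gt_at_top[of 0]])
  then have B1: "(\<lambda>n. 2 * (1 / real n * Beta (1 / real n) (1 - 4 * b n))) \<longlonglongrightarrow> 2 * 1"
    by (intro tendsto_intros)
  have "(\<lambda>n. 3 / real n * Beta (3 / real n) (1 - 4 * b n)) \<longlonglongrightarrow> 1"
    using y by (intro tendsto_mult_Beta) (real_asymp, auto intro: eventually_mono[OF eventually_gt_at_top[of 0]])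
  then have B3: "(\<lambda>n. 2 / 3 * (3 / real n * Beta (3 / real n) (1 - 4 * b n))) \<longlonglongrightarrow> 2 / 3 * 1"
    by (intro tendsto_intros)
  have "(\<lambda>n. Gamma (1 / 2) * Gamma (1 / 2 - 2 * b n) / Gamma (1 / 2 + (1 / 2 - 2 * b n))) \<longlonglongrightarrow>
      Gamma (1 / 2) * Gamma (1 / 2 - 2 * 0) / Gamma (1 / 2 + (1 / 2 - 2 * 0) :: real)"
    by (intro tendsto_intros b) (auto elim!: nonpos_Ints_cases)
  then have B: "(\<lambda>n. Beta (1 / 2) (1 / 2 - 2 * b n)) \<longlonglongrightarrow> pi"
    by (simp add: Beta_def Gamma_one_half_real)
  have "(\<lambda>n. 2 powr (4 * b n) * exp (2 * (real (num_divisors n) ^ 2 * ln (real n) / real (totient n))) *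
      (16 / 3 + 2 powr (1 - 4 * b n) * Beta (1 / 2) (1 / 2 - 2 * b n) - 2 * pi +
      (2 * (1 / real n * Beta (1 / real n) (1 - 4 * b n)) - 2) -
      (2 / 3 * (3 / real n * Beta (3 / real n) (1 - 4 * b n)) - 2 / 3))) \<longlonglongrightarrow>
      2 powr (4 * 0) * exp (2 * 0) * (16 / 3 + 2 powr (1 - 4 * 0) * pi - 2 * pi + (2 * 1 - 2) - (2 / 3 * 1 - 2 / 3))"
    by (intro tendsto_mult tendsto_add tendsto_diff tendsto_powr tendsto_const b E B B1 B3) auto
  then show ?thesis
    by (simp add: area_upper_def[abs_def] eq[abs_def] mult.assoc)
qed

lemma form_area_tendsto: "(\<lambda>n. form_area (Psi n)) \<longlonglongrightarrow> ennreal (16 / 3)"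
proof (rule tendsto_sandwich[where h = "\<lambda>n. ennreal (area_upper n)" and
      f = "\<lambda>n. ennreal (16 / 3 * exp (- (2 * (real (num_divisors n) * ln (real n) / real (totient n)))))"])
  have "(\<lambda>n. 1 / real (totient n)) \<longlonglongrightarrow> 0"
    by (rule tendsto_divisor_ln)
  then have "\<forall>\<^sub>F n in sequentially. 1 / real (totient n) < 1 / 6"
    by (rule order_tendstoD) simp
  \<comment> \<open>The index 0 has to be excluded: there \<open>1 / real (totient n)\<close> is
    \<open>1 / 0 = 0\<close> and would pass the test.\<close>
  then have ev: "\<forall>\<^sub>F n in sequentially. totient n \<ge> 6"
    using eventually_gt_at_top[of 0]
  proof eventually_elim
    case (elim n)
    then have "real (totient n) > 0"
      by simp
    with elim(1) have "real (totient n) \<ge> 6"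
      by (simp add: field_simps)
    then show ?case
      by simp
  qed
  show "\<forall>\<^sub>F n in sequentially. form_area (Psi n) \<le> ennreal (area_upper n)"
    using ev by eventually_elim (rule less_imp_le[OF form_area_less])
  show "(\<lambda>n. ennreal (area_upper n)) \<longlonglongrightarrow> ennreal (16 / 3)"
    by (intro tendsto_ennrealI area_upper_tendsto)
  show "\<forall>\<^sub>F n in sequentially. ennreal (16 / 3 * exp (- (2 * (real (num_divisors n) * ln (real n) / real (totient n)))))
      \<le> form_area (Psi n)"
    using eventually_ge_at_top[of 4]
  proof eventually_elim
    case (elim n)
    from form_area_gt[OF this] show ?case
      by (simp add: mult.assoc less_imp_le)
  qed
  have "(\<lambda>n. 16 / 3 * exp (- (2 * (real (num_divisors n) * ln (real n) / real (totient n))))) \<longlonglongrightarrow> 16 / 3 * exp (- (2 * 0))"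
    by (intro tendsto_intros tendsto_divisor_ln)
  then show "(\<lambda>n. ennreal (16 / 3 * exp (- (2 * (real (num_divisors n) * ln (real n) / real (totient n)))))) \<longlonglongrightarrow> ennreal (16 / 3)"
    by (intro tendsto_ennrealI) simp
qed

theorem theorem1:
  shows "(\<forall>n::nat. n > 0 \<and> totient n \<ge> 6 \<longrightarrow>
      form_area (Psi n) >
        ennreal (16 / 3 * exp (- (2 * real (num_divisors n) * ln (real n) / real (totient n)))) \<and>
      form_area (Psi n) <
        ennreal (2 powr (4 / real (totient n))
          * exp (2 * real (num_divisors n) ^ 2 * ln (real n) / real (totient n))
          * (16 / 3
             + 2 powr (1 - 4 / real (totient n)) * Beta (1 / 2) (1 / 2 - 2 / real (totient n))
             - 2 * pi
             + (2 / real n * Beta (1 / real n) (1 - 4 / real (totient n)) - 2)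
             - (2 / real n * Beta (3 / real n) (1 - 4 / real (totient n)) - 2 / 3))))
    \<and> ((\<lambda>n. form_area (Psi n)) \<longlonglongrightarrow> ennreal (16 / 3))"
proof (intro conjI allI impI)
  fix n :: nat assume n: "n > 0 \<and> totient n \<ge> 6"
  then have "n \<ge> 4"
    using totient_le[of n] by linarith
  from form_area_gt[OF this]
  show "form_area (Psi n) >
      ennreal (16 / 3 * exp (- (2 * real (num_divisors n) * ln (real n) / real (totient n))))" .
  from n show "form_area (Psi n) < ennreal (2 powr (4 / real (totient n))
          * exp (2 * real (num_divisors n) ^ 2 * ln (real n) / real (totient n))
          * (16 / 3
             + 2 powr (1 - 4 / real (totient n)) * Beta (1 / 2) (1 / 2 - 2 / real (totient n))
             - 2 * pi
             + (2 / real n * Beta (1 / real n) (1 - 4 / real (totient n)) - 2)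
             - (2 / real n * Beta (3 / real n) (1 - 4 / real (totient n)) - 2 / 3)))"
    using form_area_less[of n] unfolding area_upper_def by blast
qed (rule form_area_tendsto)

end
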